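(* Let $AP$ be a finite set of atomic propositions, $\Sigma=2^{AP}$, and let $\mathcal A$ be an $\mathrm{HWGT}_{cf}$ over $\Sigma$. Then one can construct a $\mathrm{cCTL}^*_f$ formula $\varphi_{\mathcal A}$ such that $\mathcal L(\mathcal A)=\mathcal L(\varphi_{\mathcal A})$.
   Context: Trees: a tree $T=(V_T,E_T)$ is a connected acyclic directed graph with root $\epsilon_T$, each node having finitely many but at least one child (unranked, unordered, infinite). A path is a finite or infinite sequence of nodes starting at the root, each element after the first a child of its predecessor; $\pi(i)$ its $i$-th node. A $\Sigma$-tree is $(T,\tau)$ with $\tau:V_T\to\Sigma$. Logic $\mathrm{cCTL}^*_f$: $\varphi ::= \mathsf{D}^n\varphi \mid p \mid \neg\varphi \mid \varphi\vee\varphi \mid \mathsf{E}\varphi \mid \mathsf{X}\varphi \mid \varphi\,\mathsf{U}\,\varphi$, evaluated at a $\Sigma$-tree $\mathcal T$, a finite non-empty path $\pi$ and position $i$: $\mathsf{D}^n\psi$ iff $\pi$ does not end at $\pi(i)$ and there are $n$ distinct finite paths coinciding with $\pi$ up to $i$, pairwise differing at $i+1$, each satisfying $\psi$ at $i+1$; $p$ iff $p\in\tau(\pi(i))$; $\mathsf{E}\psi$ iff some finite path coinciding with $\pi$ up to $i$ satisfies $\psi$ at $i$; $\mathsf{X}\psi$ iff $\pi$ does not end at $\pi(i)$ and $\psi$ holds at $i+1$; $\psi\,\mathsf{U}\,\psi'$ iff there is a position $j\ge i$ of $\pi$ with $\psi'$ at $j$ and $\psi$ at all $k$, $i\le k<j$.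 $\mathcal L(\varphi)$ is the set of $\Sigma$-trees $\mathcal T$ with $\mathcal T,\pi,0\models\varphi$ for every finite non-empty path $\pi$. Automata: a GTA is $\mathcal A=\langle Q,\Sigma,\delta,q_I,\Omega\rangle$ with finite $Q$, $q_I\in Q$, $\Omega:Q\to\mathbb N$, $\delta:Q\times\Sigma\to\mathcal B^+(\{\diamond_k,\square_k\mid k\ge1\}\times Q)$ (positive Boolean formulas over atoms $(\diamond_k,q),(\square_k,q)$; $\diamond=\diamond_1,\square=\square_1$). A run on $(T,\tau)$ is a $(V_T\times Q)$-labelled tree $(R,\rho)$ (possibly with leaves) with $\rho(\epsilon_R)=(\epsilon_T,q_I)$ and each node $s$ with $\rho(s)=(n,q)$ satisfying $\delta(q,\tau(n))$, where $s\models(\diamond_k,q')$ iff $n$ has $k$ distinct children $n_1,\dots,n_k$ each with a child of $s$ labelled $(n_i,q')$, and $s\models(\square_k,q')$ iff for all but at most $k-1$ children $n'$ of $n$, $s$ has a child labelled $(n',q')$; $\top$ always holds, $\bot$ never. A maximal run path is accepting if finite, or infinite with even maximal priority among states occurring infinitely often; a run is successful if all maximal paths are accepting; $\mathcal L(\mathcal A)$ is the set of trees with a successful run. An HWGT is a GTA whose states are partitioned into components with a partial order such that transitions from a component lead only to the same or lower components, each component $Q_i$ being existential (for all $\sigma$, $q,q'\in Q_i$: $q'$ occurs in the DNF of $\delta(q,\sigma)$ only in atoms $(\diamond,q')$, each disjunct containing at most one atom with a state of $Q_i$), universal (dually with CNF and $(\square,q')$), or transient (no state of $Q_i$ occurs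 in $\delta(q,\sigma)$ for $q\in Q_i$); universal states have even priority, existential states odd (so an infinite run path is accepting iff it eventually stays in a universal component). For a positive Boolean formula $\theta$ (e.g. an atom), $\mathcal A^\theta$ is $\mathcal A$ with a fresh initial state $q_\theta$, $\delta(q_\theta,\sigma)=\theta$ for all $\sigma$. Linearization: let $B$ be the set of atoms occurring in images of $\delta$. For a non-transient component $Q_i$ and $q\in Q_i$, $\mathcal A_{Q_i,q}$ is the word automaton with states $Q_i\uplus\{q_{exit}\}$, alphabet $\Sigma\times 2^B$, initial state $q$, defined as follows. If $Q_i$ is existential: a nondeterministic coB\"uchi automaton with rejecting set $Q_i$ (a word is accepted iff some run visits $Q_i$ only finitely often), with $q_{exit}\in\delta'(q',(\sigma,C))$ iff $q'=q_{exit}$ or the DNF of $\delta(q',\sigma)$ contains a clause $\bigwedge C$, and $q''\in\delta'(q',(\sigma,C))$ ($q',q''\in Q_i$) iff the DNF of $\delta(q',\sigma)$ contains a clause $(\diamond,q'')\wedge\bigwedge C$. If $Q_i$ is universal: a universal B\"uchi automaton with accepting set $Q_i$ (a word is accepted iff every run visits $Q_i$ infinitely often), with $q_{exit}\in\delta'(q',(\sigma,C))$ iff $q'=q_{exit}$ or the CNF of $\delta(q',\sigma)$ contains a clause $\bigvee C$, and $q''\in\delta'(q',(\sigma,C))$ iff the CNF of $\delta(q',\sigma)$ contains a clause $(\square,q'')\vee\bigvee C$. $B_{Q_i}$ is the set of $C\subseteq B$ such that $\delta'(q',(\sigma,C))\cap Q_i\neq\emptyset$ for some $q'\in Q_i$,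 $\sigma\in\Sigma$. A word automaton is counter-free if for all states $q$, finite words $\iota$ and $n\ge1$: if it has a path on $\iota^n$ from $q$ to $q$, then it has a path on $\iota$ from $q$ to $q$. An HWGT satisfies mutual exclusion if for every non-transient component $Q_i$ and all $C\neq C'$ in $B_{Q_i}$ there are atoms $\alpha\in C$, $\beta\in C'$ with $\mathcal L(\mathcal A^\alpha)$ the complement of $\mathcal L(\mathcal A^\beta)$. $\mathrm{HWGT}_{cf}$ is the class of HWGTs satisfying mutual exclusion and such that every $\mathcal A_{Q_i,q}$ (non-transient $Q_i$, $q\in Q_i$) is counter-free. *)

theory Defs
  imports Main "HOL-Library.FuncSet" "HOL-Library.Disjoint_Sets" "HOL-Library.Infinite_Set"
begin

section \<open>Trees\<close>

record 'v tree =
  verts :: "'v set"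
  edges :: "('v \<times> 'v) set"
  root :: 'v

record ('v, 'a) ltree = "'v tree" +
  label :: "'v \<Rightarrow> 'a"

definition children :: "('v, 'z) tree_scheme \<Rightarrow> 'v \<Rightarrow> 'v set" where
  "children T v = {w. (v, w) \<in> edges T}"

text \<open>Finitely branching rooted trees, possibly with leaves. That the root has no parent follows
  from acyclicity and reachability.\<close>

definition fb_tree :: "('v, 'z) tree_scheme \<Rightarrow> bool" where
  "fb_tree T \<longleftrightarrow>
     root T \<in> verts T \<and>
     edges T \<subseteq> verts T \<times> verts T \<and>
     acyclic (edges T) \<and>
     (\<forall>v \<in> verts T. (root T, v) \<in> (edges T)\<^sup>*) \<and>
     (\<forall>u u' v. (u, v) \<in> edges T \<longrightarrow> (u', v) \<in> edges T \<longrightarrow> u = u') \<and>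
     (\<forall>v \<in> verts T. finite (children T v))"

definition sigma_trees :: "'a set \<Rightarrow> ('v, 'a) ltree set" where
  "sigma_trees \<Sigma> = {T. fb_tree T \<and> (\<forall>v \<in> verts T. children T v \<noteq> {}) \<and> label T \<in> verts T \<rightarrow> \<Sigma>}"

definition finite_paths :: "('v, 'z) tree_scheme \<Rightarrow> 'v list set" where
  "finite_paths T =
     {\<pi>. \<pi> \<noteq> [] \<and> hd \<pi> = root T \<and> (\<forall>i. Suc i < length \<pi> \<longrightarrow> \<pi> ! Suc i \<in> children T (\<pi> ! i))}"

definition infinite_paths :: "('v, 'z) tree_scheme \<Rightarrow> (nat \<Rightarrow> 'v) set" where
  "infinite_paths T = {\<pi>. \<pi> 0 = root T \<and> (\<forall>i. \<pi> (Suc i) \<in> children T (\<pi> i))}"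


section \<open>The logic cCTL*f\<close>

datatype (props: 'p) cctl =
    Count nat "'p cctl"
  | Prop 'p
  | Neg "'p cctl"
  | Disj "'p cctl" "'p cctl"
  | EPath "'p cctl"
  | Next "'p cctl"
  | Until "'p cctl" "'p cctl"

text \<open>Only meaningful for \<open>\<pi> \<in> finite_paths T\<close> and \<open>i < length \<pi>\<close>. Under that proviso
  \<open>take (Suc i) \<pi>' = take (Suc i) \<pi>\<close> says that \<open>\<pi>'\<close> has a position \<open>i\<close> and coincides
  with \<open>\<pi>\<close> up to it.\<close>

primrec sat :: "('v, 'p set) ltree \<Rightarrow> 'v list \<Rightarrow> nat \<Rightarrow> 'p cctl \<Rightarrow> bool" where
  "sat T \<pi> i (Count n \<psi>) \<longleftrightarrow>
     Suc i < length \<pi> \<and>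
     (\<exists>P \<subseteq> finite_paths T. finite P \<and> card P = n \<and>
        inj_on (\<lambda>\<pi>'. \<pi>' ! Suc i) P \<and>
        (\<forall>\<pi>' \<in> P. take (Suc i) \<pi>' = take (Suc i) \<pi> \<and> Suc i < length \<pi>' \<and> sat T \<pi>' (Suc i) \<psi>))"
| "sat T \<pi> i (Prop p) \<longleftrightarrow> p \<in> label T (\<pi> ! i)"
| "sat T \<pi> i (Neg \<psi>) \<longleftrightarrow> \<not> sat T \<pi> i \<psi>"
| "sat T \<pi> i (Disj \<psi> \<psi>') \<longleftrightarrow> sat T \<pi> i \<psi> \<or> sat T \<pi> i \<psi>'"
| "sat T \<pi> i (EPath \<psi>) \<longleftrightarrow>
     (\<exists>\<pi>' \<in> finite_paths T. take (Suc i) \<pi>' = take (Suc i) \<pi> \<and> sat T \<pi>' i \<psi>)"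
| "sat T \<pi> i (Next \<psi>) \<longleftrightarrow> Suc i < length \<pi> \<and> sat T \<pi> (Suc i) \<psi>"
| "sat T \<pi> i (Until \<psi> \<psi>') \<longleftrightarrow>
     (\<exists>j. i \<le> j \<and> j < length \<pi> \<and> sat T \<pi> j \<psi>' \<and> (\<forall>k. i \<le> k \<and> k < j \<longrightarrow> sat T \<pi> k \<psi>))"

definition form_lang :: "'p set \<Rightarrow> 'p cctl \<Rightarrow> ('v, 'p set) ltree set" where
  "form_lang AP \<phi> = {T \<in> sigma_trees (Pow AP). \<forall>\<pi> \<in> finite_paths T. sat T \<pi> 0 \<phi>}"


section \<open>Positive Boolean formulas\<close>

datatype (atoms: 'a) pbf =
    PTrue
  | PFalse
  | PAtom 'a
  | PAnd "'a pbf" "'a pbf"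
  | POr "'a pbf" "'a pbf"

primrec pbf_sat :: "('a \<Rightarrow> bool) \<Rightarrow> 'a pbf \<Rightarrow> bool" where
  "pbf_sat v PTrue \<longleftrightarrow> True"
| "pbf_sat v PFalse \<longleftrightarrow> False"
| "pbf_sat v (PAtom a) \<longleftrightarrow> v a"
| "pbf_sat v (PAnd f g) \<longleftrightarrow> pbf_sat v f \<and> pbf_sat v g"
| "pbf_sat v (POr f g) \<longleftrightarrow> pbf_sat v f \<or> pbf_sat v g"

text \<open>Normal forms as sets of clauses, clauses as sets of atoms, obtained by distributivity
  alone: subsumed clauses are kept, so a formula already in normal form keeps all its clauses.\<close>

primrec dnf :: "'a pbf \<Rightarrow> 'a set set" where
  "dnf PTrue = {{}}"
| "dnf PFalse = {}"
| "dnf (PAtom a) = {{a}}"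
| "dnf (PAnd f g) = {K \<union> L | K L. K \<in> dnf f \<and> L \<in> dnf g}"
| "dnf (POr f g) = dnf f \<union> dnf g"

primrec cnf :: "'a pbf \<Rightarrow> 'a set set" where
  "cnf PTrue = {}"
| "cnf PFalse = {{}}"
| "cnf (PAtom a) = {{a}}"
| "cnf (PAnd f g) = cnf f \<union> cnf g"
| "cnf (POr f g) = {K \<union> L | K L. K \<in> cnf f \<and> L \<in> cnf g}"

lemma pbf_sat_dnf: "pbf_sat v f \<longleftrightarrow> (\<exists>K \<in> dnf f. \<forall>a \<in> K. v a)"
proof (induction f)
  case (PAnd f g)
  have "(\<exists>K \<in> dnf (PAnd f g). \<forall>a \<in> K. v a) \<longleftrightarrow> (\<exists>K \<in> dnf f. \<exists>L \<in> dnf g. \<forall>a \<in> K \<union> L. v a)"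
    by auto
  also have "\<dots> \<longleftrightarrow> (\<exists>K \<in> dnf f. \<forall>a \<in> K. v a) \<and> (\<exists>L \<in> dnf g. \<forall>a \<in> L. v a)"
    by blast
  finally show ?case using PAnd by simp
qed auto

lemma pbf_sat_cnf: "pbf_sat v f \<longleftrightarrow> (\<forall>K \<in> cnf f. \<exists>a \<in> K. v a)"
proof (induction f)
  case (POr f g)
  have "(\<forall>K \<in> cnf (POr f g). \<exists>a \<in> K. v a) \<longleftrightarrow> (\<forall>K \<in> cnf f. \<forall>L \<in> cnf g. \<exists>a \<in> K \<union> L. v a)"
    by auto
  also have "\<dots> \<longleftrightarrow> (\<forall>K \<in> cnf f. \<exists>a \<in> K. v a) \<or> (\<forall>L \<in> cnf g. \<exists>a \<in> L. v a)"
    by blast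
  finally show ?case using POr by simp
qed auto


section \<open>Graded tree automata\<close>

datatype modality = Dia nat | Box nat

primrec grade :: "modality \<Rightarrow> nat" where
  "grade (Dia k) = k"
| "grade (Box k) = k"

type_synonym 'q atom = "modality \<times> 'q"

record ('q, 'a) gta =
  states :: "'q set"
  alphabet :: "'a set"
  delta :: "'q \<Rightarrow> 'a \<Rightarrow> 'q atom pbf"
  init :: 'q
  prio :: "'q \<Rightarrow> nat"

definition gta :: "('q, 'a, 'z) gta_scheme \<Rightarrow> bool" where
  "gta A \<longleftrightarrow>
     finite (states A) \<and> init A \<in> states A \<and>
     (\<forall>q \<in> states A. \<forall>\<sigma> \<in> alphabet A. \<forall>(m, q') \<in> atoms (delta A q \<sigma>). grade m \<ge> 1 \<and> q' \<in> states A)"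

primrec modal_sat ::
  "('v, 'a) ltree \<Rightarrow> ('r, 'v \<times> 'q) ltree \<Rightarrow> 'r \<Rightarrow> 'v \<Rightarrow> 'q \<Rightarrow> modality \<Rightarrow> bool" where
  "modal_sat T R s n q' (Dia k) \<longleftrightarrow>
     (\<exists>N \<subseteq> children T n. finite N \<and> card N = k \<and> (\<forall>n' \<in> N. \<exists>s' \<in> children R s. label R s' = (n', q')))"
| "modal_sat T R s n q' (Box k) \<longleftrightarrow>
     card {n' \<in> children T n. \<not> (\<exists>s' \<in> children R s. label R s' = (n', q'))} \<le> k - 1"

text \<open>The node type \<open>'r\<close> of runs is instantiated to \<^typ>\<open>nat\<close> in \<open>gta_lang\<close>:
  finitely branching trees are countable.\<close>

definition is_run ::
  "('q, 'a, 'z) gta_scheme \<Rightarrow> ('v, 'a) ltree \<Rightarrow> ('r, 'v \<times> 'q) ltree \<Rightarrow> bool" where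
  "is_run A T R \<longleftrightarrow>
     fb_tree R \<and> label R \<in> verts R \<rightarrow> verts T \<times> states A \<and>
     label R (root R) = (root T, init A) \<and>
     (\<forall>s \<in> verts R. \<forall>n q. label R s = (n, q) \<longrightarrow>
        pbf_sat (\<lambda>(m, q'). modal_sat T R s n q' m) (delta A q (label T n)))"

text \<open>Finite maximal paths are always accepting, so only infinite ones are constrained.\<close>

definition successful ::
  "('q, 'a, 'z) gta_scheme \<Rightarrow> ('r, 'v \<times> 'q) ltree \<Rightarrow> bool" where
  "successful A R \<longleftrightarrow>
     (\<forall>\<pi> \<in> infinite_paths R. even (Max (prio A ` {q. \<exists>\<^sub>\<infinity>i. snd (label R (\<pi> i)) = q})))"

definition gta_lang :: "('q, 'a, 'z) gta_scheme \<Rightarrow> ('v, 'a) ltree set" where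
  "gta_lang A = {T \<in> sigma_trees (alphabet A).
     \<exists>R :: (nat, 'v \<times> 'q) ltree. is_run A T R \<and> successful A R}"

text \<open>The automaton \<open>A\<^sup>\<theta>\<close>: \<^const>\<open>None\<close> is the fresh initial state. Its priority is
  immaterial, as it occurs in no transition.\<close>

definition with_init :: "('q, 'a, 'z) gta_scheme \<Rightarrow> 'q atom pbf \<Rightarrow> ('q option, 'a) gta" where
  "with_init A \<theta> =
     \<lparr> states = insert None (Some ` states A),
       alphabet = alphabet A,
       delta = (\<lambda>q \<sigma>. map_pbf (map_prod id Some)
                  (case q of None \<Rightarrow> \<theta> | Some q' \<Rightarrow> delta A q' \<sigma>)),
       init = None,
       prio = case_option 0 (prio A) \<rparr>"


section \<open>Hesitant weak graded tree automata\<close>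

datatype kind = Existential | Universal | Transient

text \<open>\<open>(Qj, Qi) \<in> comp_le H\<close> means that \<open>Qj\<close> is the same as or lower than \<open>Qi\<close>.\<close>

record ('q, 'a) hwgt = "('q, 'a) gta" +
  comps :: "'q set set"
  comp_le :: "('q set \<times> 'q set) set"
  kind_of :: "'q set \<Rightarrow> kind"

definition existential_comp :: "('q, 'a, 'z) gta_scheme \<Rightarrow> 'q set \<Rightarrow> bool" where
  "existential_comp A Qi \<longleftrightarrow>
     (\<forall>q \<in> Qi. \<forall>\<sigma> \<in> alphabet A. \<forall>K \<in> dnf (delta A q \<sigma>).
        (\<forall>(m, q') \<in> K. q' \<in> Qi \<longrightarrow> m = Dia 1) \<and>
        (\<forall>a \<in> K. \<forall>b \<in> K. snd a \<in> Qi \<longrightarrow> snd b \<in> Qi \<longrightarrow> a = b))"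

definition universal_comp :: "('q, 'a, 'z) gta_scheme \<Rightarrow> 'q set \<Rightarrow> bool" where
  "universal_comp A Qi \<longleftrightarrow>
     (\<forall>q \<in> Qi. \<forall>\<sigma> \<in> alphabet A. \<forall>K \<in> cnf (delta A q \<sigma>).
        (\<forall>(m, q') \<in> K. q' \<in> Qi \<longrightarrow> m = Box 1) \<and>
        (\<forall>a \<in> K. \<forall>b \<in> K. snd a \<in> Qi \<longrightarrow> snd b \<in> Qi \<longrightarrow> a = b))"

definition transient_comp :: "('q, 'a, 'z) gta_scheme \<Rightarrow> 'q set \<Rightarrow> bool" where
  "transient_comp A Qi \<longleftrightarrow>
     (\<forall>q \<in> Qi. \<forall>\<sigma> \<in> alphabet A. \<forall>(m, q') \<in> atoms (delta A q \<sigma>). q' \<notin> Qi)"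

definition hwgt :: "('q, 'a, 'z) hwgt_scheme \<Rightarrow> bool" where
  "hwgt H \<longleftrightarrow>
     gta H \<and>
     partition_on (states H) (comps H) \<and>
     partial_order_on (comps H) (comp_le H) \<and>
     (\<forall>Qi \<in> comps H. \<forall>Qj \<in> comps H. \<forall>q \<in> Qi. \<forall>\<sigma> \<in> alphabet H.
        \<forall>(m, q') \<in> atoms (delta H q \<sigma>). q' \<in> Qj \<longrightarrow> (Qj, Qi) \<in> comp_le H) \<and>
     (\<forall>Qi \<in> comps H. case kind_of H Qi of
          Existential \<Rightarrow> existential_comp H Qi \<and> (\<forall>q \<in> Qi. odd (prio H q))
        | Universal \<Rightarrow> universal_comp H Qi \<and> (\<forall>q \<in> Qi. even (prio H q))
        | Transient \<Rightarrow> transient_comp H Qi)"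


section \<open>Word automata and linearization\<close>

datatype 's acceptance = Nondet_CoBuchi "'s set" | Universal_Buchi "'s set"

record ('s, 'b) word_automaton =
  wa_states :: "'s set"
  wa_alphabet :: "'b set"
  wa_trans :: "'s \<Rightarrow> 'b \<Rightarrow> 's set"
  wa_init :: 's
  wa_acc :: "'s acceptance"

definition wa_runs :: "('s, 'b) word_automaton \<Rightarrow> (nat \<Rightarrow> 'b) \<Rightarrow> (nat \<Rightarrow> 's) set" where
  "wa_runs M w = {r. r 0 = wa_init M \<and> (\<forall>i. r (Suc i) \<in> wa_trans M (r i) (w i))}"

definition wa_lang :: "('s, 'b) word_automaton \<Rightarrow> (nat \<Rightarrow> 'b) set" where
  "wa_lang M = {w. range w \<subseteq> wa_alphabet M \<and>
     (case wa_acc M of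
        Nondet_CoBuchi F \<Rightarrow> \<exists>r \<in> wa_runs M w. \<not> (\<exists>\<^sub>\<infinity>i. r i \<in> F)
      | Universal_Buchi F \<Rightarrow> \<forall>r \<in> wa_runs M w. \<exists>\<^sub>\<infinity>i. r i \<in> F)}"

primrec wa_path :: "('s, 'b) word_automaton \<Rightarrow> 's \<Rightarrow> 'b list \<Rightarrow> 's \<Rightarrow> bool" where
  "wa_path M p [] p' \<longleftrightarrow> p = p'"
| "wa_path M p (b # w) p' \<longleftrightarrow> (\<exists>r \<in> wa_trans M p b. wa_path M r w p')"

definition counter_free :: "('s, 'b) word_automaton \<Rightarrow> bool" where
  "counter_free M \<longleftrightarrow>
     (\<forall>q \<in> wa_states M. \<forall>w \<in> lists (wa_alphabet M). \<forall>n \<ge> 1.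
        wa_path M q (concat (replicate n w)) q \<longrightarrow> wa_path M q w q)"

definition occurring_atoms :: "('q, 'a, 'z) gta_scheme \<Rightarrow> 'q atom set" where
  "occurring_atoms A = (\<Union>q \<in> states A. \<Union>\<sigma> \<in> alphabet A. atoms (delta A q \<sigma>))"

text \<open>The next definitions are meant for non-transient components only. The exit state is
  \<^const>\<open>None\<close>. A clause of the form \<open>(\<diamond>, q'') \<and> \<And>C\<close> (or \<open>(\<box>, q'') \<or> \<Or>C\<close>)
  lists its atoms without repetition, hence \<open>(\<diamond>, q'') \<notin> C\<close>.\<close>

definition lin_clauses :: "('q, 'a, 'z) hwgt_scheme \<Rightarrow> 'q set \<Rightarrow> 'q \<Rightarrow> 'a \<Rightarrow> 'q atom set set" where
  "lin_clauses H Qi q \<sigma> =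
     (if kind_of H Qi = Existential then dnf (delta H q \<sigma>) else cnf (delta H q \<sigma>))"

definition lin_modality :: "('q, 'a, 'z) hwgt_scheme \<Rightarrow> 'q set \<Rightarrow> modality" where
  "lin_modality H Qi = (if kind_of H Qi = Existential then Dia 1 else Box 1)"

fun lin_trans ::
  "('q, 'a, 'z) hwgt_scheme \<Rightarrow> 'q set \<Rightarrow> 'q option \<Rightarrow> 'a \<times> 'q atom set \<Rightarrow> 'q option set" where
  "lin_trans H Qi None (\<sigma>, C) = {None}"
| "lin_trans H Qi (Some q') (\<sigma>, C) =
     (if C \<in> lin_clauses H Qi q' \<sigma> then {None} else {}) \<union>
     Some ` {q'' \<in> Qi. (lin_modality H Qi, q'') \<notin> C \<and>
                       insert (lin_modality H Qi, q'') C \<in> lin_clauses H Qi q' \<sigma>}"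

definition linearization ::
  "('q, 'a, 'z) hwgt_scheme \<Rightarrow> 'q set \<Rightarrow> 'q \<Rightarrow> ('q option, 'a \<times> 'q atom set) word_automaton" where
  "linearization H Qi q =
     \<lparr> wa_states = insert None (Some ` Qi),
       wa_alphabet = alphabet H \<times> Pow (occurring_atoms H),
       wa_trans = lin_trans H Qi,
       wa_init = Some q,
       wa_acc = (if kind_of H Qi = Existential then Nondet_CoBuchi (Some ` Qi)
                 else Universal_Buchi (Some ` Qi)) \<rparr>"

definition comp_atom_sets :: "('q, 'a, 'z) hwgt_scheme \<Rightarrow> 'q set \<Rightarrow> 'q atom set set" where
  "comp_atom_sets H Qi = {C. C \<subseteq> occurring_atoms H \<and>
     (\<exists>q' \<in> Qi. \<exists>\<sigma> \<in> alphabet H. lin_trans H Qi (Some q') (\<sigma>, C) \<inter> Some ` Qi \<noteq> {})}"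

text \<open>The argument of type \<^typ>\<open>'v itself\<close> fixes the type from which the nodes of the input
  trees are drawn. All trees being countable, every infinite type covers them up to isomorphism.\<close>

definition mutual_exclusion :: "'v itself \<Rightarrow> ('q, 'a, 'z) hwgt_scheme \<Rightarrow> bool" where
  "mutual_exclusion v H \<longleftrightarrow>
     (\<forall>Qi \<in> comps H. kind_of H Qi \<noteq> Transient \<longrightarrow>
        (\<forall>C \<in> comp_atom_sets H Qi. \<forall>C' \<in> comp_atom_sets H Qi. C \<noteq> C' \<longrightarrow>
           (\<exists>\<alpha> \<in> C. \<exists>\<beta> \<in> C'.
              (gta_lang (with_init H (PAtom \<alpha>)) :: ('v, 'a) ltree set) =
              sigma_trees (alphabet H) - gta_lang (with_init H (PAtom \<beta>)))))"

definition hwgt_cf :: "'v itself \<Rightarrow> ('q, 'a, 'z) hwgt_scheme \<Rightarrow> bool" where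
  "hwgt_cf v H \<longleftrightarrow>
     hwgt H \<and> mutual_exclusion v H \<and>
     (\<forall>Qi \<in> comps H. kind_of H Qi \<noteq> Transient \<longrightarrow> (\<forall>q \<in> Qi. counter_free (linearization H Qi q)))"

end

theory Submission
  imports Defs "HOL-Library.Countable_Set"
begin

text \<open>Fix a tree and let \<open>W q\<close> be the set of nodes at which \<open>\<A>\<close> accepts from state \<open>q\<close>. By induction
  along the order of the components, membership in \<open>W q\<close> is defined by a state formula. For an
  existential component \<open>W\<close> is a least fixpoint, so a node belongs to it iff some finite path labelled
  with a run of the linearization leads to a node where the component can be left; for a
  universal component the same holds of the complement of \<open>W\<close>. By mutual exclusion every node
  satisfies at most one set \<open>C \<in> B_{Q_i}\<close>, hence a path determines the word over \<open>\<Sigma> \<times> 2^B\<close> that is read.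
  It remains to describe the words leading from one state to another by a temporal formula.
  The powerset automaton of a counter-free automaton is counter-free, and for counter-free
  deterministic automata we follow Wilke: if some letter \<open>c\<close> is not a permutation of the states, cut
  words at the occurrences of \<open>c\<close>; the blocks in between avoid \<open>c\<close>, and the sequence of blocks is read
  by a counter-free automaton on the smaller state set \<open>c ` Q\<close>.\<close>

section \<open>Temporally definable languages of finite words\<close>

text \<open>Counter-freeness and mutual exclusion constrain only moves that stay inside a component.
  The formula of a component therefore reads these moves as letters and describes leaving the
  component by a separate state formula at the last node of the path. Finite paths suffice because
  the approximations converge after omega steps: branching and state set are finite, so one-step
  evaluation at a node looks at finitely many values. The stage at which a value first changes is a
  rank that falls along the path; the same rank bounds the stay in existential components when a run
  is built from the fixpoint. Complementing universal components does not spoil mutual exclusion: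
  two atoms with complementary languages can neither both hold nor both fail. The powerset is taken
  because Wilke's induction needs letters that act as functions on a finite set. That induction is
  nested: deleting \<open>c\<close> leaves fewer letters on the same states, while passing to blocks
  leaves fewer states but possibly more letters.\<close>

primrec until :: "('c list \<Rightarrow> bool) \<Rightarrow> ('c list \<Rightarrow> bool) \<Rightarrow> 'c list \<Rightarrow> bool" where
  "until P Q [] \<longleftrightarrow> Q []"
| "until P Q (a # w) \<longleftrightarrow> Q (a # w) \<or> (P (a # w) \<and> until P Q w)"

text \<open>A word of length \<open>n\<close> has the \<open>n + 1\<close> positions \<open>0, \<dots>, n\<close>, the last of which carries no
  letter. A path with \<open>n + 1\<close> nodes will be read as a word of length \<open>n\<close>.\<close>

inductive definable :: "'c set \<Rightarrow> ('c list \<Rightarrow> bool) \<Rightarrow> bool" for F where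
  true: "definable F (\<lambda>w. True)"
| letter: "a \<in> F \<Longrightarrow> definable F (\<lambda>w. w \<noteq> [] \<and> hd w = a)"
| neg: "definable F P \<Longrightarrow> definable F (\<lambda>w. \<not> P w)"
| disj: "definable F P \<Longrightarrow> definable F Q \<Longrightarrow> definable F (\<lambda>w. P w \<or> Q w)"
| "next": "definable F P \<Longrightarrow> definable F (\<lambda>w. w \<noteq> [] \<and> P (tl w))"
| until: "definable F P \<Longrightarrow> definable F Q \<Longrightarrow> definable F (until P Q)"
| cong: "definable F P \<Longrightarrow> (\<And>w. w \<in> lists F \<Longrightarrow> P w = Q w) \<Longrightarrow> definable F Q"

text \<open>Definability is semantic: an inductive class of predicates, so rule induction takes the
  place of induction on formulas. The rule \<open>cong\<close> asks for agreement on words over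
  \<open>F\<close> only; most equivalences below hold for all lists.\<close>

lemma definable_eq: "definable F P \<Longrightarrow> (\<And>w. P w = Q w) \<Longrightarrow> definable F Q"
  by (rule definable.cong)

lemma definable_conj:
  assumes "definable F P" "definable F Q"
  shows "definable F (\<lambda>w. P w \<and> Q w)"
  using definable.neg[OF definable.disj[OF definable.neg[OF assms(1)] definable.neg[OF assms(2)]]]
  by simp

lemma definable_const: "definable F (\<lambda>w. b)"
  using definable.true definable.neg[OF definable.true] by (cases b) simp_all

lemma definable_Bex:
  assumes "finite S" "\<And>x. x \<in> S \<Longrightarrow> definable F (P x)"
  shows "definable F (\<lambda>w. \<exists>x\<in>S. P x w)"
  using assms
proof (induction S rule: finite_induct)
  case empty
  show ?case using definable_const[of F False] by simp
next
  case (insert x S)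
  have "definable F (\<lambda>w. P x w \<or> (\<exists>x\<in>S. P x w))"
    by (rule definable.disj) (use insert in auto)
  then show ?case by simp
qed

lemma definable_Ball:
  assumes "finite S" "\<And>x. x \<in> S \<Longrightarrow> definable F (P x)"
  shows "definable F (\<lambda>w. \<forall>x\<in>S. P x w)"
proof -
  have "definable F (\<lambda>w. \<not> (\<exists>x\<in>S. \<not> P x w))"
    by (intro definable.neg definable_Bex) (use assms definable.neg in auto)
  then show ?thesis by simp
qed

text \<open>A letter of the image pulls back to the finite disjunction of its preimages. This is
  needed because the induction takes state transformations as letters, and several letters of a word
  automaton may induce the same transformation.\<close>

lemma definable_relabel:
  assumes "definable (h ` G) P" "finite G"
  shows "definable G (\<lambda>w. P (map h w))"
  using assms(1)
proof induction
  case true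
  show ?case by (rule definable.true)
next
  case (letter a)
  have "definable G (\<lambda>w. \<exists>b\<in>{b\<in>G. h b = a}. w \<noteq> [] \<and> hd w = b)"
    by (rule definable_Bex) (use assms(2) definable.letter in auto)
  then show ?case
    by (rule definable.cong) (auto simp: hd_map elim: lists.cases)
next
  case (neg P)
  show ?case by (rule definable.neg[OF neg(2)])
next
  case (disj P Q)
  show ?case by (rule definable.disj[OF disj(3,4)])
next
  case ("next" P)
  have "definable G (\<lambda>w. w \<noteq> [] \<and> P (map h (tl w)))"
    using "next"(2) by (rule definable.next)
  then show ?case by (simp add: map_tl)
next
  case (until P Q)
  have "until (\<lambda>w. P (map h w)) (\<lambda>w. Q (map h w)) w \<longleftrightarrow> until P Q (map h w)" for w
    by (induction w) auto
  then show ?case by (rule definable_eq[OF definable.until[OF until(3,4)]])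
next
  case (cong P Q)
  show ?case by (rule definable.cong[OF cong(3)]) (rule cong(2), auto)
qed

section \<open>Splitting words at a separator letter\<close>

lemma definable_mem:
  assumes "c \<in> F"
  shows "definable F (\<lambda>w. c \<in> set w)"
proof -
  have "definable F (until (\<lambda>w. True) (\<lambda>w. w \<noteq> [] \<and> hd w = c))"
    by (intro definable.intros assms)
  moreover have "until (\<lambda>w. True) (\<lambda>w. w \<noteq> [] \<and> hd w = c) w \<longleftrightarrow> c \<in> set w" for w
    by (induction w) auto
  ultimately show ?thesis by (rule definable_eq)
qed

lemma definable_hd_neq:
  assumes "c \<in> F"
  shows "definable F (\<lambda>w. w \<noteq> [] \<and> hd w \<noteq> c)"
proof -
  \<comment> \<open>\<open>w \<noteq> [] \<and> True\<close> is \<open>next\<close> of the true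
    predicate; it says that a letter remains without enumerating \<open>F\<close>.\<close>
  have "definable F (\<lambda>w. (w \<noteq> [] \<and> True) \<and> \<not> (w \<noteq> [] \<and> hd w = c))"
    by (intro definable_conj definable.next definable.neg definable.letter definable.true assms)
  then show ?thesis by (rule definable.cong) auto
qed

lemma takeWhile_in_lists:
  assumes "w \<in> lists F"
  shows "takeWhile (\<lambda>x. x \<noteq> c) w \<in> lists (F - {c})"
  using assms by (auto dest: set_takeWhileD)

text \<open>Relativization: the formula is evaluated as if the word ended at the first
  \<open>c\<close>, so \<open>next\<close> and \<open>until\<close> may not step past a position
  that reads \<open>c\<close>. Without \<open>c\<close>, \<open>takeWhile\<close> would return the
  whole word; the guard leaves that case to \<open>definable_avoiding\<close>.\<close>

lemma definable_before_first:
  assumes "definable (F - {c}) P" "c \<in> F"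
  shows "definable F (\<lambda>w. c \<in> set w \<and> P (takeWhile (\<lambda>x. x \<noteq> c) w))"
  using assms(1)
proof induction
  case true
  show ?case using definable_mem[OF assms(2)] by simp
next
  case (letter a)
  have "definable F (\<lambda>w. c \<in> set w \<and> (w \<noteq> [] \<and> hd w = a))"
    by (intro definable_conj definable_mem definable.letter) (use letter assms in auto)
  then show ?case
  proof (rule definable.cong)
    fix w
    show "(c \<in> set w \<and> (w \<noteq> [] \<and> hd w = a)) =
      (c \<in> set w \<and> takeWhile (\<lambda>x. x \<noteq> c) w \<noteq> [] \<and> hd (takeWhile (\<lambda>x. x \<noteq> c) w) = a)"
      using letter by (cases w) auto
  qed
next
  case (neg P)
  have "definable F (\<lambda>w. c \<in> set w \<and> \<not> (c \<in> set w \<and> P (takeWhile (\<lambda>x. x \<noteq> c) w)))"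
    by (intro definable_conj definable_mem definable.neg neg assms)
  then show ?case by (rule definable.cong) auto
next
  case (disj P Q)
  show ?case by (rule definable.cong[OF definable.disj[OF disj(3,4)]]) auto
next
  case ("next" P)
  have "definable F (\<lambda>w. (w \<noteq> [] \<and> hd w \<noteq> c) \<and>
      (w \<noteq> [] \<and> (c \<in> set (tl w) \<and> P (takeWhile (\<lambda>x. x \<noteq> c) (tl w)))))"
    by (intro definable_conj definable_hd_neq definable.next[where P="\<lambda>w. c \<in> set w \<and> P (takeWhile (\<lambda>x. x \<noteq> c) w)"] "next" assms)
  then show ?case
  proof (rule definable.cong)
    fix w
    show "((w \<noteq> [] \<and> hd w \<noteq> c) \<and>
      (w \<noteq> [] \<and> (c \<in> set (tl w) \<and> P (takeWhile (\<lambda>x. x \<noteq> c) (tl w))))) =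
      (c \<in> set w \<and> takeWhile (\<lambda>x. x \<noteq> c) w \<noteq> [] \<and> P (tl (takeWhile (\<lambda>x. x \<noteq> c) w)))"
      by (cases w) auto
  qed
next
  case (until P Q)
  let ?R = "\<lambda>P w. c \<in> set w \<and> P (takeWhile (\<lambda>x. x \<noteq> c) w)"
  have "definable F (until (\<lambda>w. (w \<noteq> [] \<and> hd w \<noteq> c) \<and> ?R P w) (?R Q))"
    by (intro definable.until definable_conj definable_hd_neq definable_mem until assms)
  moreover have "until (\<lambda>w. (w \<noteq> [] \<and> hd w \<noteq> c) \<and> ?R P w) (?R Q) w \<longleftrightarrow> ?R (until P Q) w" for w
    by (induction w) auto
  ultimately show ?case by (rule definable_eq)
next
  case (cong P Q)
  show ?case by (rule definable.cong[OF cong(3)]) (simp add: cong(2)[OF takeWhile_in_lists])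
qed

text \<open>Suffixes of a \<open>c\<close>-free word are \<open>c\<close>-free, so the guard can be
  carried through every connective. It keeps each evaluation inside \<open>lists (F - {c})\<close>,
  where \<open>cong\<close> over the smaller alphabet provides equality.\<close>

lemma definable_avoiding:
  assumes "definable (F - {c}) P" "c \<in> F"
  shows "definable F (\<lambda>w. c \<notin> set w \<and> P w)"
  using assms(1)
proof induction
  case true
  show ?case using definable.neg[OF definable_mem[OF assms(2)]] by simp
next
  case (letter a)
  show ?case
    by (intro definable_conj definable.neg definable_mem definable.letter assms) (use letter in auto)
next
  case (neg P)
  have "definable F (\<lambda>w. \<not> c \<in> set w \<and> \<not> (c \<notin> set w \<and> P w))"
    by (intro definable_conj definable_mem definable.neg neg assms)
  then show ?case by (rule definable.cong) auto
next
  case (disj P Q)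
  show ?case by (rule definable.cong[OF definable.disj[OF disj(3,4)]]) auto
next
  case ("next" P)
  have "definable F (\<lambda>w. \<not> c \<in> set w \<and> (w \<noteq> [] \<and> (c \<notin> set (tl w) \<and> P (tl w))))"
    by (intro definable_conj definable_mem definable.neg
          definable.next[where P="\<lambda>w. c \<notin> set w \<and> P w"] "next" assms)
  then show ?case by (rule definable.cong) (auto dest: list.set_sel(2))
next
  case (until P Q)
  have "definable F (\<lambda>w. \<not> c \<in> set w \<and> until (\<lambda>w. c \<notin> set w \<and> P w) (\<lambda>w. c \<notin> set w \<and> Q w) w)"
    by (intro definable_conj definable_mem definable.neg definable.until until assms)
  moreover have "(\<not> c \<in> set w \<and> until (\<lambda>w. c \<notin> set w \<and> P w) (\<lambda>w. c \<notin> set w \<and> Q w) w) \<longleftrightarrow>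
      c \<notin> set w \<and> until P Q w" for w
    by (induction w) auto
  ultimately show ?case by (rule definable_eq)
next
  case (cong P Q)
  show ?case by (rule definable.cong[OF cong(3)]) (use cong(2) in auto)
qed

definition after_first :: "'c \<Rightarrow> 'c list \<Rightarrow> 'c list" where
  "after_first c w = tl (dropWhile (\<lambda>x. x \<noteq> c) w)"

lemma after_first_Cons: "after_first c (a # w) = (if a = c then w else after_first c w)"
  by (simp add: after_first_def)

lemma after_first_in_lists: "w \<in> lists F \<Longrightarrow> after_first c w \<in> lists F"
  by (induction w) (auto simp: after_first_Cons, simp add: after_first_def)

lemma length_after_first: "c \<in> set w \<Longrightarrow> length (after_first c w) < length w"
  by (induction w) (auto simp: after_first_Cons)

lemma split_first: "c \<in> set w \<Longrightarrow> w = takeWhile (\<lambda>x. x \<noteq> c) w @ c # after_first c w"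
  by (induction w) (auto simp: after_first_Cons)

text \<open>The left argument of \<open>until\<close> forbids passing a \<open>c\<close>, so the
  position it finds is the first \<open>c\<close>; one \<open>next\<close> then skips the
  separator.\<close>

lemma definable_after_first:
  assumes "definable F P" "c \<in> F"
  shows "definable F (\<lambda>w. c \<in> set w \<and> P (after_first c w))"
proof -
  have "definable F (until (\<lambda>w. w \<noteq> [] \<and> hd w \<noteq> c) (\<lambda>w. (w \<noteq> [] \<and> hd w = c) \<and> (w \<noteq> [] \<and> P (tl w))))"
    by (intro definable.until definable_hd_neq definable_conj definable.letter definable.next assms)
  moreover have "until (\<lambda>w. w \<noteq> [] \<and> hd w \<noteq> c) (\<lambda>w. (w \<noteq> [] \<and> hd w = c) \<and> (w \<noteq> [] \<and> P (tl w))) w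
    \<longleftrightarrow> c \<in> set w \<and> P (after_first c w)" for w
    by (induction w) (auto simp: after_first_Cons)
  ultimately show ?thesis by (rule definable_eq)
qed

definition last_block :: "'c \<Rightarrow> 'c list \<Rightarrow> 'c list" where
  "last_block c w = rev (takeWhile (\<lambda>x. x \<noteq> c) (rev w))"

lemma last_block_notin:
  assumes "c \<notin> set w"
  shows "last_block c w = w"
proof -
  have "takeWhile (\<lambda>x. x \<noteq> c) (rev w) = rev w"
    using assms by (auto simp: takeWhile_eq_all_conv)
  then show ?thesis by (simp only: last_block_def rev_rev_ident)
qed

lemma last_block_append: "last_block c (u @ c # w) = last_block c w"
proof (cases "c \<in> set w")
  case True
  then have "takeWhile (\<lambda>x. x \<noteq> c) (rev w @ c # rev u) = takeWhile (\<lambda>x. x \<noteq> c) (rev w)"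
    by (intro takeWhile_append1[of c]) auto
  then show ?thesis by (simp add: last_block_def)
next
  case False
  then have "takeWhile (\<lambda>x. x \<noteq> c) (rev w @ c # rev u) = rev w @ takeWhile (\<lambda>x. x \<noteq> c) (c # rev u)"
    by (intro takeWhile_append2) auto
  then show ?thesis using False last_block_notin[OF False] by (simp add: last_block_def)
qed

text \<open>The last block begins behind the unique \<open>c\<close> that has no further
  \<open>c\<close> after it. A future formula can find it: eventually a \<open>c\<close> followed by
  a \<open>c\<close>-free rest that satisfies \<open>P\<close>.\<close>

lemma definable_last_block:
  assumes "definable (F - {c}) P" "c \<in> F"
  shows "definable F (\<lambda>w. c \<in> set w \<and> P (last_block c w))"
proof -
  let ?N = "\<lambda>w. c \<notin> set w \<and> P w"
  have "definable F (until (\<lambda>w. True) (\<lambda>w. (w \<noteq> [] \<and> hd w = c) \<and> (w \<noteq> [] \<and> ?N (tl w))))"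
    by (intro definable.until definable.true definable_conj definable.letter definable.next[where P="?N"] definable_avoiding assms)
  moreover have "until (\<lambda>w. True) (\<lambda>w. (w \<noteq> [] \<and> hd w = c) \<and> (w \<noteq> [] \<and> ?N (tl w))) w
    \<longleftrightarrow> c \<in> set w \<and> P (last_block c w)" for w
  proof (induction w)
    case (Cons a w)
    show ?case
    proof (cases "c \<in> set w")
      case True
      then have "last_block c (a # w) = last_block c w"
        using split_first[OF True] last_block_append[of c "a # takeWhile (\<lambda>x. x \<noteq> c) w"]
          last_block_append[of c "takeWhile (\<lambda>x. x \<noteq> c) w"] by (metis append_Cons)
      then show ?thesis using Cons True by auto
    next
      case False
      then show ?thesis using Cons last_block_append[of c "[]" w] last_block_notin[OF False] by auto
    qed
  qed simp
  ultimately show ?thesis by (rule definable_eq)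
qed

section \<open>Counter-free transformation semigroups\<close>

text \<open>The letters are the state transformations themselves, so an automaton is merely a set of
  functions. This lets the effect of a whole block serve as a letter of the next automaton.\<close>

definition run :: "('s \<Rightarrow> 's) list \<Rightarrow> 's \<Rightarrow> 's" where
  "run w = fold (\<lambda>f. f) w"

lemma run_simps [simp]: "run [] p = p" "run (f # w) p = run w (f p)" "run (u @ w) p = run w (run u p)"
  by (simp_all add: run_def)

lemma run_closed: "w \<in> lists F \<Longrightarrow> (\<And>f. f \<in> F \<Longrightarrow> f ` Q \<subseteq> Q) \<Longrightarrow> p \<in> Q \<Longrightarrow> run w p \<in> Q"
  by (induction w arbitrary: p) auto

text \<open>The closing separator \<open>c\<close> belongs to the block. Restriction to
  \<open>S\<close> makes the map extensional: blocks with the same effect on \<open>S\<close> become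
  the same letter, and a finite \<open>S\<close> admits only finitely many letters.\<close>

definition block_map :: "('s \<Rightarrow> 's) \<Rightarrow> 's set \<Rightarrow> ('s \<Rightarrow> 's) list \<Rightarrow> 's \<Rightarrow> 's" where
  "block_map c S u = restrict (\<lambda>p. c (run u p)) S"

text \<open>Only blocks closed by a \<open>c\<close> are listed. What follows the last
  \<open>c\<close> is left to \<open>last_block\<close>, and a \<open>c\<close>-free word has no
  blocks.\<close>

function blocks :: "('s \<Rightarrow> 's) \<Rightarrow> 's set \<Rightarrow> ('s \<Rightarrow> 's) list \<Rightarrow> ('s \<Rightarrow> 's) list" where
  "blocks c S w = (if c \<in> set w
     then block_map c S (takeWhile (\<lambda>x. x \<noteq> c) w) # blocks c S (after_first c w) else [])"
  by auto
termination
  by (relation "measure (\<lambda>(c, S, w). length w)") (auto simp: length_after_first)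

declare blocks.simps [simp del]

lemma blocks_mem: "c \<in> set w \<Longrightarrow> blocks c S w =
    block_map c S (takeWhile (\<lambda>x. x \<noteq> c) w) # blocks c S (after_first c w)"
  by (subst blocks.simps) simp

lemma blocks_notin: "c \<notin> set w \<Longrightarrow> blocks c S w = []"
  by (subst blocks.simps) simp

lemma blocks_if:
  "(blocks c S w \<noteq> [] \<and> P (blocks c S w)) \<longleftrightarrow> c \<in> set w \<and>
     P (block_map c S (takeWhile (\<lambda>x. x \<noteq> c) w) # blocks c S (after_first c w))"
  by (cases "c \<in> set w") (simp_all add: blocks_mem blocks_notin)

lemma blocks_in_lists:
  assumes "w \<in> lists F"
  shows "blocks c S w \<in> lists (block_map c S ` lists (F - {c}))"
  using assms
proof (induction c S w rule: blocks.induct)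
  case (1 c S w)
  then show ?case
    using takeWhile_in_lists[OF 1(2), of c] after_first_in_lists[OF 1(2), of c]
    by (subst blocks.simps) auto
qed

text \<open>Each closed block ends with \<open>c\<close> and so leads from \<open>c\<close>
  Q\<open>back into\<close>c \<open>Q\<close>, where the restricted block maps agree with the real
  action. The start state must already lie there, which is why the first block is treated apart in
  the final induction.\<close>

lemma run_blocks:
  assumes "w \<in> lists F" "c \<in> F" "\<And>f. f \<in> F \<Longrightarrow> f ` Q \<subseteq> Q" "p \<in> c ` Q"
  shows "run w p = run (last_block c w) (run (blocks c (c ` Q) w) p)"
  using assms(1,4)
proof (induction w arbitrary: p rule: length_induct)
  case (1 w)
  show ?case
  proof (cases "c \<in> set w")
    case True
    let ?u = "takeWhile (\<lambda>x. x \<noteq> c) w" and ?r = "after_first c w"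
    have w: "w = ?u @ c # ?r" by (rule split_first[OF True])
    have "p \<in> Q" using 1(3) assms(2,3) by blast
    moreover have "?u \<in> lists F" using 1(2) by (auto dest: set_takeWhileD)
    ultimately have "run ?u p \<in> Q" using run_closed[OF _ assms(3)] by simp
    then have q: "c (run ?u p) \<in> c ` Q" by blast
    have "run w p = run ?r (c (run ?u p))" by (subst w) simp
    also have "\<dots> = run (last_block c ?r) (run (blocks c (c ` Q) ?r) (c (run ?u p)))"
      by (rule 1(1)[rule_format, OF length_after_first[OF True] after_first_in_lists[OF 1(2)] q])
    also have "last_block c ?r = last_block c w"
      by (subst (2) w) (simp only: last_block_append)
    also have "run (blocks c (c ` Q) ?r) (c (run ?u p)) = run (blocks c (c ` Q) w) p"
      using True 1(3) by (simp add: block_map_def blocks_mem)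
    finally show ?thesis .
  next
    case False
    then show ?thesis by (simp add: last_block_notin blocks_notin)
  qed
qed

text \<open>Formulas over block sequences are translated back to formulas over words. Positions of
  the block word are the start of the word and the positions right after a \<open>c\<close>: a
  letter becomes a property of the prefix before the next \<open>c\<close>, and \<open>next\<close>
  becomes a jump behind it.\<close>

lemma definable_blocks:
  assumes "definable (block_map c S ` lists (F - {c})) K" "c \<in> F"
    and blk: "\<And>f. f \<in> block_map c S ` lists (F - {c}) \<Longrightarrow> definable (F - {c}) (\<lambda>u. block_map c S u = f)"
  shows "definable F (\<lambda>w. K (blocks c S w))"
  using assms(1)
proof induction
  case true
  show ?case by (rule definable.true)
next
  case (letter f)
  show ?case
    by (rule definable.cong[OF definable_before_first[OF blk[OF letter] assms(2)]])
      (subst blocks_if[where P="\<lambda>w. hd w = f"], simp)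
next
  case (neg P)
  show ?case by (rule definable.neg[OF neg(2)])
next
  case (disj P Q)
  show ?case by (rule definable.disj[OF disj(3,4)])
next
  case ("next" P)
  show ?case
    by (rule definable.cong[OF definable_after_first[OF "next"(2) assms(2)]])
      (subst blocks_if[where P="\<lambda>w. P (tl w)"], simp)
next
  case (until P Q)
  let ?P = "\<lambda>w. P (blocks c S w)" and ?Q = "\<lambda>w. Q (blocks c S w)"
  \<comment> \<open>In the simulated \<open>until\<close>, \<open>?A\<close> passes freely over
    positions not reading \<open>c\<close> and at a \<open>c\<close> demands \<open>P\<close> of the
    block word behind it; \<open>?B\<close> stops at a \<open>c\<close> with \<open>Q\<close> behind
    it. The initial position follows no \<open>c\<close>, so \<open>D\<close> treats it
    separately.\<close>
  let ?A = "\<lambda>w. \<not> (w \<noteq> [] \<and> hd w = c) \<or> (w \<noteq> [] \<and> ?P (tl w))"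
  let ?B = "\<lambda>w. (w \<noteq> [] \<and> hd w = c) \<and> (w \<noteq> [] \<and> ?Q (tl w))"
  have D: "definable F (\<lambda>w. ?Q w \<or> (?P w \<and> until ?A ?B w))"
    by (intro definable.until definable.disj definable.neg definable_conj definable.letter
        definable.next[where P = ?P] definable.next[where P = ?Q] until assms)
  have V: "until ?A ?B w \<longleftrightarrow> c \<in> set w \<and>
      (?Q (after_first c w) \<or> (?P (after_first c w) \<and> until ?A ?B (after_first c w)))" for w
    by (induction w) (auto simp: after_first_Cons)
  have U: "until P Q (blocks c S w) \<longleftrightarrow> ?Q w \<or> (?P w \<and> until ?A ?B w)" for w
  proof (induction w rule: length_induct)
    case (1 w)
    show ?case
    proof (cases "c \<in> set w")
      case True
      then have IH: "until P Q (blocks c S (after_first c w)) \<longleftrightarrow>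
          ?Q (after_first c w) \<or> (?P (after_first c w) \<and> until ?A ?B (after_first c w))"
        by (rule 1[rule_format, OF length_after_first])
      have b: "blocks c S w = block_map c S (takeWhile (\<lambda>x. x \<noteq> c) w) # blocks c S (after_first c w)"
        by (rule blocks_mem[OF True])
      have "until P Q (blocks c S w) \<longleftrightarrow> ?Q w \<or> (?P w \<and> until P Q (blocks c S (after_first c w)))"
        by (simp add: b)
      also have "\<dots> \<longleftrightarrow> ?Q w \<or> (?P w \<and> until ?A ?B w)"
        unfolding IH V[of w] using True by simp
      finally show ?thesis .
    next
      case False
      then have b: "blocks c S w = []" by (rule blocks_notin)
      show ?thesis using V[of w] False by (simp add: b)
    qed
  qed
  show ?case by (rule definable_eq[OF D]) (rule U[symmetric])
next
  case (cong P Q)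
  show ?case
    by (rule definable.cong[OF cong(3)]) (simp add: cong(2)[OF blocks_in_lists])
qed

section \<open>Wilke's induction for counter-free deterministic automata\<close>

definition counter_free_on :: "'s set \<Rightarrow> ('s \<Rightarrow> 's) set \<Rightarrow> bool" where
  "counter_free_on Q F \<longleftrightarrow>
     (\<forall>w\<in>lists F. \<forall>q\<in>Q. \<forall>n\<ge>1. (run w ^^ n) q = q \<longrightarrow> run w q = q)"

text \<open>Pigeonhole gives \<open>(f ^^ i) q = (f ^^ j) q\<close> with \<open>i < j\<close>;
  injectivity cancels the first \<open>i\<close> applications.\<close>

lemma permutation_power_id:
  assumes "finite Q" "f ` Q = Q" "q \<in> Q"
  shows "\<exists>n\<ge>1. (f ^^ n) q = q"
proof -
  have mem: "(f ^^ i) q \<in> Q" for i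
    using assms by (induction i) auto
  have inj: "inj_on f Q" using assms by (simp add: eq_card_imp_inj_on)
  have "\<not> inj (\<lambda>i. (f ^^ i) q)"
  proof
    assume "inj (\<lambda>i. (f ^^ i) q)"
    moreover have "range (\<lambda>i. (f ^^ i) q) \<subseteq> Q" using mem by blast
    ultimately show False using assms(1) by (meson finite_subset range_inj_infinite)
  qed
  then obtain i j where ij: "i < j" "(f ^^ i) q = (f ^^ j) q"
    unfolding inj_def by (metis linorder_neqE_nat)
  have "(f ^^ i) x = (f ^^ i) y \<Longrightarrow> x \<in> Q \<Longrightarrow> y \<in> Q \<Longrightarrow> x = y" for x y
  proof (induction i arbitrary: x y)
    case (Suc i)
    have "f x \<in> Q" "f y \<in> Q" using Suc assms by auto
    then have "f x = f y" using Suc by (simp add: funpow_swap1)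
    then show ?case using Suc inj by (simp add: inj_on_def)
  qed simp
  moreover have "(f ^^ i) ((f ^^ (j - i)) q) = (f ^^ i) q"
    using ij fun_cong[OF funpow_add[of i "j - i" f], of q] by simp
  ultimately have "(f ^^ (j - i)) q = q" using mem assms(3) by blast
  then show ?thesis using ij(1) by (intro exI[of _ "j - i"]) auto
qed

lemma block_map_closed:
  assumes f: "f \<in> block_map c (c ` Q) ` lists (F - {c})" and c: "c \<in> F"
    and cl: "\<And>f. f \<in> F \<Longrightarrow> f ` Q \<subseteq> Q"
  shows "f ` c ` Q \<subseteq> c ` Q"
proof
  fix y assume "y \<in> f ` c ` Q"
  then obtain x where x: "x \<in> c ` Q" "y = f x" by blast
  obtain u where u: "u \<in> lists (F - {c})" "f = block_map c (c ` Q) u" using f by blast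
  have "u \<in> lists F" using u(1) by auto
  moreover have "x \<in> Q" using x(1) cl[OF c] by auto
  ultimately have "run u x \<in> Q" by (intro run_closed[OF _ cl])
  then show "y \<in> c ` Q" using x u(2) by (simp add: block_map_def)
qed

lemma counter_free_on_blocks:
  assumes cf: "counter_free_on Q F" and c: "c \<in> F" and cl: "\<And>f. f \<in> F \<Longrightarrow> f ` Q \<subseteq> Q"
  shows "counter_free_on (c ` Q) (block_map c (c ` Q) ` lists (F - {c}))"
proof -
  let ?S = "c ` Q" and ?F = "block_map c (c ` Q) ` lists (F - {c})"
  note clS = block_map_closed[OF _ c cl]
  have ex: "\<exists>w\<in>lists F. \<forall>p\<in>?S. run w' p = run w p" if "w' \<in> lists ?F" for w'
    using that
  proof (induction w')
    case Nil
    show ?case by (rule bexI[of _ "[]"]) auto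
  next
    case (Cons f w')
    then obtain u w where uw: "u \<in> lists (F - {c})" "f = block_map c ?S u"
      "w \<in> lists F" "\<forall>p\<in>?S. run w' p = run w p" by blast
    have "u @ c # w \<in> lists F" using uw c by auto
    moreover have "run (f # w') p = run (u @ c # w) p" if "p \<in> ?S" for p
    proof -
      have "f p \<in> ?S" using clS[OF Cons(1)] that by auto
      then have "run w' (f p) = run w (f p)" using uw(4) by blast
      then show ?thesis using uw(2) that by (simp add: block_map_def)
    qed
    ultimately show ?case by blast
  qed
  show ?thesis unfolding counter_free_on_def
  proof (intro ballI allI impI)
    fix w' q and n :: nat
    assume a: "w' \<in> lists ?F" "q \<in> ?S" "1 \<le> n" "(run w' ^^ n) q = q"
    obtain w where w: "w \<in> lists F" "\<forall>p\<in>?S. run w' p = run w p" using ex[OF a(1)] by blast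
    have "(run w' ^^ i) q \<in> ?S \<and> (run w' ^^ i) q = (run w ^^ i) q" for i
    proof (induction i)
      case (Suc i)
      have "run w' ((run w' ^^ i) q) \<in> ?S" by (rule run_closed[OF a(1) clS conjunct1[OF Suc]])
      then show ?case using Suc w(2) by auto
    qed (use a in auto)
    then have "(run w ^^ n) q = q" using a(4) by metis
    moreover have "q \<in> Q" using a(2) cl c by blast
    ultimately have "run w q = q" using cf w(1) a(3) unfolding counter_free_on_def by blast
    then show "run w' q = q" using bspec[OF w(2) a(2)] by simp
  qed
qed

theorem definable_counter_free:
  fixes Q :: "'s set"
  assumes "finite Q" "finite F" "\<And>f. f \<in> F \<Longrightarrow> f ` Q \<subseteq> Q" "counter_free_on Q F" "p \<in> Q"
  shows "definable F (\<lambda>w. run w p = q)"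
  using assms
proof (induction "card Q" arbitrary: Q F p q rule: less_induct)
  case outer: less
  note IHQ = outer(1)
  have fQ: "finite Q" by fact
  from outer(3-6) show ?case
  proof (induction "card F" arbitrary: F p q rule: less_induct)
    case (less F p q)
    note cl = less(3) and cf = less(4) and p = less(5)
    show ?case
    proof (cases "\<forall>f\<in>F. f ` Q = Q")
      case True
      \<comment> \<open>A permutation has a power fixing \<open>x\<close>, so counter-freeness for
        the one-letter word \<open>[f]\<close> makes \<open>f\<close> itself fix
        \<open>x\<close>.\<close>
      have id: "f x = x" if fx: "f \<in> F" "x \<in> Q" for f x
      proof -
        obtain n where n: "n \<ge> 1" "(f ^^ n) x = x"
          using permutation_power_id[OF fQ bspec[OF True fx(1)] fx(2)] by blast
        have f: "run [f] = f" by (simp add: fun_eq_iff)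
        have "[f] \<in> lists F" using that by simp
        then have "(run [f] ^^ n) x = x \<longrightarrow> run [f] x = x"
          using cf that(2) n(1) unfolding counter_free_on_def by blast
        then show ?thesis using n(2) unfolding f by simp
      qed
      have "run w p = p" if "w \<in> lists F" for w
        using that p by (induction w) (auto simp: id)
      then show ?thesis
        by (intro definable.cong[OF definable_const[of F "p = q"]]) simp
    next
      case False
      then obtain c where c: "c \<in> F" "c ` Q \<noteq> Q" by blast
      let ?B = "F - {c}" and ?S = "c ` Q"
      let ?F = "block_map c ?S ` lists ?B"
      have SQ: "?S \<subset> Q" using c cl by blast
      \<comment> \<open>Inner induction: one letter fewer, the same states.\<close>
      have defB: "definable ?B (\<lambda>w. run w p = q)" if "p \<in> Q" for p q
      proof (rule less(1))
        show "card ?B < card F" using c(1) less(2) by (intro psubset_card_mono) auto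
        show "counter_free_on Q ?B" using cf unfolding counter_free_on_def by blast
      qed (use less(2) cl that in auto)
      note clS = block_map_closed[OF _ c(1) cl]
      have "f \<in> ?S \<rightarrow>\<^sub>E ?S" if "f \<in> ?F" for f
      proof (rule PiE_I)
        show "f x \<in> ?S" if "x \<in> ?S" for x using clS[OF \<open>f \<in> ?F\<close>] that by auto
        show "f x = undefined" if "x \<notin> ?S" for x
          using \<open>f \<in> ?F\<close> that by (auto simp: block_map_def)
      qed
      \<comment> \<open>There are infinitely many blocks, but only finitely many extensional maps on
        \<open>?S\<close>.\<close>
      then have "?F \<subseteq> ?S \<rightarrow>\<^sub>E ?S" by (rule subsetI)
      then have finF: "finite ?F" using fQ by (meson finite_PiE finite_imageI finite_subset)
      have defF: "definable ?F (\<lambda>w. run w p = q)" if "p \<in> ?S" for p q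
        by (rule IHQ[OF psubset_card_mono[OF fQ SQ] finite_imageI[OF fQ] finF clS
              counter_free_on_blocks[OF cf c(1) cl] that])
      have c_def: "definable ?B (\<lambda>u. c (run u x) = y)" if "x \<in> Q" for x y
      proof -
        have "definable ?B (\<lambda>u. \<exists>z\<in>{z\<in>Q. c z = y}. run u x = z)"
          by (rule definable_Bex) (use fQ defB that in auto)
        then show ?thesis
        proof (rule definable.cong)
          fix u assume "u \<in> lists ?B"
          then have "u \<in> lists F" by auto
          then have "run u x \<in> Q" by (rule run_closed[OF _ cl that])
          then show "(\<exists>z\<in>{z\<in>Q. c z = y}. run u x = z) = (c (run u x) = y)" by simp
        qed
      qed
      have blk: "definable ?B (\<lambda>u. block_map c ?S u = f)" if "f \<in> ?F" for f
      proof -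
        have "definable ?B (\<lambda>u. \<forall>x\<in>?S. c (run u x) = f x)"
          by (rule definable_Ball[OF finite_imageI[OF fQ]]) (use SQ c_def in blast)
        moreover have "f \<in> extensional ?S" using that by (auto simp: block_map_def)
        then have "(\<forall>x\<in>?S. c (run u x) = f x) \<longleftrightarrow> block_map c ?S u = f" for u
          unfolding block_map_def fun_eq_iff restrict_def extensional_def by auto
        ultimately show ?thesis by simp
      qed
      \<comment> \<open>\<open>p1\<close> is the state after the first \<open>c\<close> and
        \<open>p2\<close> the state after the last one. The first block is read from
        \<open>p\<close>, which need not lie in \<open>c\<close>
        Q\<open>; the middle blocks are read by the automaton on\<close>c \<open>Q\<close>; the last
        block contains no \<open>c\<close>.\<close>
      let ?R = "\<lambda>p1 p2 w. ((c \<in> set w \<and> c (run (takeWhile (\<lambda>x. x \<noteq> c) w) p) = p1) \<and>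
          (c \<in> set w \<and> run (blocks c ?S (after_first c w)) p1 = p2)) \<and>
          (c \<in> set w \<and> run (last_block c w) p2 = q)"
      have "definable F (?R p1 p2)" if "p1 \<in> ?S" "p2 \<in> ?S" for p1 p2
      proof -
        have "p2 \<in> Q" using that SQ by blast
        then show ?thesis
          by (intro definable_conj
            definable_before_first[where P="\<lambda>u. c (run u p) = p1"]
            definable_after_first[where P="\<lambda>w. run (blocks c ?S w) p1 = p2"]
            definable_last_block[where P="\<lambda>u. run u p2 = q"]
            definable_blocks[where K="\<lambda>w. run w p1 = p2"] defF defB c_def c(1) p that blk)
      qed
      then have "definable F (\<lambda>w. \<exists>p1\<in>?S. \<exists>p2\<in>?S. ?R p1 p2 w)"
        by (intro definable_Bex) (use fQ in auto)
      then have "definable F (\<lambda>w. (c \<notin> set w \<and> run w p = q) \<or> (\<exists>p1\<in>?S. \<exists>p2\<in>?S. ?R p1 p2 w))"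
        by (intro definable.disj definable_avoiding defB p c(1))
      then show ?thesis
      proof (rule definable.cong)
        fix w assume w: "w \<in> lists F"
        show "((c \<notin> set w \<and> run w p = q) \<or> (\<exists>p1\<in>?S. \<exists>p2\<in>?S. ?R p1 p2 w)) = (run w p = q)"
        proof (cases "c \<in> set w")
          case True
          let ?u = "takeWhile (\<lambda>x. x \<noteq> c) w" and ?r = "after_first c w"
          have "?u \<in> lists F" using w by (auto dest: set_takeWhileD)
          then have "run ?u p \<in> Q" by (rule run_closed[OF _ cl p])
          then have p1: "c (run ?u p) \<in> ?S" by blast
          have r: "?r \<in> lists F" by (rule after_first_in_lists[OF w])
          have p2: "run (blocks c ?S ?r) (c (run ?u p)) \<in> ?S"
            by (rule run_closed[OF blocks_in_lists[OF r] clS p1])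
          have "run w p = run ?r (c (run ?u p))"
            by (subst split_first[OF True]) simp
          also have "\<dots> = run (last_block c ?r) (run (blocks c ?S ?r) (c (run ?u p)))"
            by (rule run_blocks[OF r c(1) cl p1])
          also have "last_block c ?r = last_block c w"
            by (subst (2) split_first[OF True]) (simp only: last_block_append)
          finally show ?thesis using True p1 p2 by simp
        qed auto
      qed
    qed
  qed
qed

section \<open>Evaluation of weak graded automata\<close>

lemma pbf_sat_mono:
  "pbf_sat f \<theta> \<Longrightarrow> (\<And>a. a \<in> atoms \<theta> \<Longrightarrow> f a \<Longrightarrow> g a) \<Longrightarrow> pbf_sat g \<theta>"
  by (induction \<theta>) auto

lemma pbf_sat_cong: "(\<And>a. a \<in> atoms \<theta> \<Longrightarrow> f a = g a) \<Longrightarrow> pbf_sat f \<theta> = pbf_sat g \<theta>"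
  by (induction \<theta>) auto

lemma pbf_sat_map: "pbf_sat f (map_pbf g \<theta>) = pbf_sat (\<lambda>a. f (g a)) \<theta>"
  by (induction \<theta>) auto

primrec modal_holds :: "('v, 'z) tree_scheme \<Rightarrow> 'v \<Rightarrow> modality \<Rightarrow> ('v \<Rightarrow> bool) \<Rightarrow> bool" where
  "modal_holds T v (Dia k) P \<longleftrightarrow> (\<exists>N \<subseteq> children T v. finite N \<and> card N = k \<and> (\<forall>w\<in>N. P w))"
| "modal_holds T v (Box k) P \<longleftrightarrow> card {w \<in> children T v. \<not> P w} \<le> k - 1"

lemma modal_sat_eq:
  "modal_sat T R s n q m = modal_holds T n m (\<lambda>n'. \<exists>s'\<in>children R s. label R s' = (n', q))"
  by (cases m) simp_all

text \<open>Finiteness matters for \<open>Box\<close>: \<open>card\<close> of an infinite set is 0,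
  so passing to a smaller set of failing children could raise the cardinality.\<close>

lemma modal_holds_mono:
  assumes "modal_holds T v m P" "finite (children T v)" "\<And>w. w \<in> children T v \<Longrightarrow> P w \<Longrightarrow> P' w"
  shows "modal_holds T v m P'"
proof (cases m)
  case (Dia k)
  then show ?thesis using assms(1,3) by (auto simp: subset_iff)
next
  case (Box k)
  have "card {w \<in> children T v. \<not> P' w} \<le> card {w \<in> children T v. \<not> P w}"
    by (rule card_mono) (use assms(2,3) in auto)
  then show ?thesis using assms(1) Box by simp
qed

lemma modal_holds_cong:
  assumes "children T v = children T' v" "\<And>w. w \<in> children T v \<Longrightarrow> P w = P' w"
  shows "modal_holds T v m P = modal_holds T' v m P'"
proof (cases m)
  case (Dia k)
  then show ?thesis using assms by (auto simp: subset_iff)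
next
  case (Box k)
  have "{w \<in> children T v. \<not> P w} = {w \<in> children T' v. \<not> P' w}" using assms by auto
  then show ?thesis using Box by simp
qed

section \<open>One-step evaluation and approximation of the fixpoint\<close>

definition local_sat ::
  "('q, 'a, 'z) gta_scheme \<Rightarrow> ('v, 'a) ltree \<Rightarrow> ('v \<Rightarrow> 'q \<Rightarrow> bool) \<Rightarrow> 'v \<Rightarrow> 'q \<Rightarrow> bool" where
  "local_sat G T X v q = pbf_sat (\<lambda>(m, p). modal_holds T v m (\<lambda>w. X w p)) (delta G q (label T v))"

lemma local_sat_mono:
  assumes "local_sat G T X v q" "finite (children T v)"
    "\<And>m p w. (m, p) \<in> atoms (delta G q (label T v)) \<Longrightarrow> w \<in> children T v \<Longrightarrow> X w p \<Longrightarrow> Y w p"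
  shows "local_sat G T Y v q"
  using assms(1) unfolding local_sat_def
proof (rule pbf_sat_mono)
  fix a assume a: "a \<in> atoms (delta G q (label T v))"
    "case a of (m, p) \<Rightarrow> modal_holds T v m (\<lambda>w. X w p)"
  obtain m p where mp: "a = (m, p)" by (cases a)
  have "modal_holds T v m (\<lambda>w. Y w p)"
    by (rule modal_holds_mono[OF _ assms(2), of _ "\<lambda>w. X w p"]) (use a mp assms(3) in auto)
  then show "case a of (m, p) \<Rightarrow> modal_holds T v m (\<lambda>w. Y w p)" using mp by simp
qed

lemma local_sat_cong:
  assumes "children T v = children T' v" "label T v = label T' v"
    "\<And>m p w. (m, p) \<in> atoms (delta G q (label T v)) \<Longrightarrow> w \<in> children T v \<Longrightarrow> X w p = Y w p"
  shows "local_sat G T X v q = local_sat G T' Y v q"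
  unfolding local_sat_def assms(2)[symmetric]
proof (rule pbf_sat_cong)
  fix a assume a: "a \<in> atoms (delta G q (label T v))"
  obtain m p where mp: "a = (m, p)" by (cases a)
  have "modal_holds T v m (\<lambda>w. X w p) = modal_holds T' v m (\<lambda>w. Y w p)"
    by (rule modal_holds_cong[OF assms(1)]) (use a mp assms(3) in auto)
  then show "(case a of (m, p) \<Rightarrow> modal_holds T v m (\<lambda>w. X w p)) =
      (case a of (m, p) \<Rightarrow> modal_holds T' v m (\<lambda>w. Y w p))" using mp by simp
qed

text \<open>Approximations of the fixpoint for the states of index \<open>n\<close>, starting from \<open>\<bottom>\<close> in existential
  components and from \<open>\<top>\<close> in universal ones; \<open>X\<close> gives the values of the states of smaller
  index.\<close>

primrec stage :: "('q, 'a, 'z) gta_scheme \<Rightarrow> ('q \<Rightarrow> nat) \<Rightarrow> ('q \<Rightarrow> kind) \<Rightarrow> ('v, 'a) ltree \<Rightarrow>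
    nat \<Rightarrow> ('v \<Rightarrow> 'q \<Rightarrow> bool) \<Rightarrow> nat \<Rightarrow> 'v \<Rightarrow> 'q \<Rightarrow> bool" where
  "stage G idx knd T n X 0 = (\<lambda>v q. if idx q = n then knd q \<noteq> Existential else X v q)"
| "stage G idx knd T n X (Suc j) =
     (\<lambda>v q. if idx q = n then local_sat G T (stage G idx knd T n X j) v q else X v q)"

text \<open>\<open>levels n\<close> holds the final values of the states of index below
  \<open>n\<close>. Requiring all stages from some point on is a limit that suits both the
  increasing sequences of existential states and the decreasing ones of the others.\<close>

primrec levels :: "('q, 'a, 'z) gta_scheme \<Rightarrow> ('q \<Rightarrow> nat) \<Rightarrow> ('q \<Rightarrow> kind) \<Rightarrow> ('v, 'a) ltree \<Rightarrow>
    nat \<Rightarrow> 'v \<Rightarrow> 'q \<Rightarrow> bool" where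
  "levels G idx knd T 0 = (\<lambda>v q. False)"
| "levels G idx knd T (Suc n) = (\<lambda>v q. if idx q = n
     then \<exists>j. \<forall>i\<ge>j. stage G idx knd T n (levels G idx knd T n) i v q
     else levels G idx knd T n v q)"

definition wins :: "('q, 'a, 'z) gta_scheme \<Rightarrow> ('q \<Rightarrow> nat) \<Rightarrow> ('q \<Rightarrow> kind) \<Rightarrow> ('v, 'a) ltree \<Rightarrow>
    'v \<Rightarrow> 'q \<Rightarrow> bool" where
  "wins G idx knd T v q = levels G idx knd T (Suc (idx q)) v q"

lemma levels_eq_wins: "idx q < n \<Longrightarrow> levels G idx knd T n v q = wins G idx knd T v q"
proof (induction n)
  case (Suc n)
  then show ?case by (cases "idx q = n") (auto simp: wins_def)
qed simp

lemma stage_lower: "idx q < n \<Longrightarrow>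
    stage G idx knd T n (levels G idx knd T n) j v q = wins G idx knd T v q"
  by (cases j) (simp_all add: levels_eq_wins)

lemma wins_stage: "wins G idx knd T v q \<longleftrightarrow>
    (\<exists>j. \<forall>i\<ge>j. stage G idx knd T (idx q) (levels G idx knd T (idx q)) i v q)"
  by (simp add: wins_def)

text \<open>Evaluation looks only downwards, so agreement on a set closed under children suffices.
  It will transfer values between a tree and its subtrees.\<close>

lemma wins_restrict:
  assumes D: "\<And>u. u \<in> D \<Longrightarrow> children T u = children T' u \<and> label T u = label T' u \<and> children T u \<subseteq> D"
    and "v \<in> D"
  shows "wins G idx knd T v q = wins G idx knd T' v q"
proof -
  have "levels G idx knd T n v q = levels G idx knd T' n v q" if "v \<in> D" for n v q
    using that
  proof (induction n arbitrary: v q)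
    case (Suc n)
    have "stage G idx knd T n (levels G idx knd T n) j v q =
        stage G idx knd T' n (levels G idx knd T' n) j v q" if "v \<in> D" for j v q
      using that
    proof (induction j arbitrary: v q)
      case 0
      then show ?case using Suc.IH by simp
    next
      case (Suc j)
      have "local_sat G T (stage G idx knd T n (levels G idx knd T n) j) v q =
        local_sat G T' (stage G idx knd T' n (levels G idx knd T' n) j) v q"
        by (rule local_sat_cong) (use D[OF Suc.prems] Suc.IH in auto)
      then show ?case using Suc.prems \<open>\<And>v q. v \<in> D \<Longrightarrow> levels G idx knd T n v q = levels G idx knd T' n v q\<close>
        by simp
    qed
    then show ?case using Suc by simp
  qed simp
  then show ?thesis using assms(2) by (simp add: wins_def del: levels.simps)
qed

text \<open>All transitions of \<open>with_init\<close> lead to states \<open>Some p\<close>, so the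
  recursion for \<open>Some q\<close> never consults the fresh state.\<close>

lemma wins_with_init:
  "wins (with_init G \<theta>) (case_option N idx) (case_option Transient knd) T v (Some q) = wins G idx knd T v q"
proof -
  let ?G = "with_init G \<theta>" and ?i = "case_option N idx" and ?k = "case_option Transient knd"
  have "levels ?G ?i ?k T n v (Some q) = levels G idx knd T n v q" for n v q
  proof (induction n arbitrary: v q)
    case (Suc n)
    have "stage ?G ?i ?k T n (levels ?G ?i ?k T n) j v (Some q) =
        stage G idx knd T n (levels G idx knd T n) j v q" for j v q
    proof (induction j arbitrary: v q)
      case 0
      then show ?case using Suc.IH by simp
    next
      case (Suc j)
      have "local_sat ?G T (stage ?G ?i ?k T n (levels ?G ?i ?k T n) j) v (Some q) =
        local_sat G T (stage G idx knd T n (levels G idx knd T n) j) v q"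
        unfolding local_sat_def
        by (simp add: with_init_def pbf_sat_map split_def)
          (simp add: with_init_def[symmetric] Suc.IH)
      then show ?case using \<open>\<And>v q. levels ?G ?i ?k T n v (Some q) = levels G idx knd T n v q\<close>
        by simp
    qed
    then show ?case using Suc by simp
  qed simp
  then show ?thesis by (simp add: wins_def del: levels.simps)
qed

text \<open>Only a single index is needed in place of the partial order on components: along a transition
  that does not decrease it the component, and hence the kind, does not change.\<close>

locale weak_gta =
  fixes G :: "('q, 'a, 'z) gta_scheme" and idx :: "'q \<Rightarrow> nat" and knd :: "'q \<Rightarrow> kind"
  assumes finite_states: "finite (states G)"
    and init_state: "init G \<in> states G"
    and trans_state: "q \<in> states G \<Longrightarrow> \<sigma> \<in> alphabet G \<Longrightarrow> (m, p) \<in> atoms (delta G q \<sigma>) \<Longrightarrow> p \<in> states G"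
    and trans_idx: "q \<in> states G \<Longrightarrow> \<sigma> \<in> alphabet G \<Longrightarrow> (m, p) \<in> atoms (delta G q \<sigma>) \<Longrightarrow>
      idx p < idx q \<or> idx p = idx q \<and> knd p = knd q \<and> knd q \<noteq> Transient"
    and odd_prio: "q \<in> states G \<Longrightarrow> knd q = Existential \<Longrightarrow> odd (prio G q)"
    and even_prio: "q \<in> states G \<Longrightarrow> knd q = Universal \<Longrightarrow> even (prio G q)"

lemma sigma_treesD:
  assumes "T \<in> sigma_trees \<Sigma>"
  shows "root T \<in> verts T" "v \<in> verts T \<Longrightarrow> finite (children T v)" "v \<in> verts T \<Longrightarrow> children T v \<noteq> {}"
    "v \<in> verts T \<Longrightarrow> w \<in> children T v \<Longrightarrow> w \<in> verts T" "v \<in> verts T \<Longrightarrow> label T v \<in> \<Sigma>"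
  using assms by (auto simp: sigma_trees_def fb_tree_def children_def)

locale weak_gta_on_tree = weak_gta G idx knd
  for G :: "('q, 'a, 'z) gta_scheme" and idx knd +
  fixes T :: "('v, 'a) ltree"
  assumes T: "T \<in> sigma_trees (alphabet G)"
begin

abbreviation "W \<equiv> wins G idx knd T"
abbreviation "st n \<equiv> stage G idx knd T n (levels G idx knd T n)"

lemmas tree = sigma_treesD[OF T]

lemma trans:
  assumes "v \<in> verts T" "q \<in> states G" "(m, p) \<in> atoms (delta G q (label T v))"
  shows "p \<in> states G" "idx p < idx q \<or> idx p = idx q \<and> knd p = knd q \<and> knd q \<noteq> Transient"
  using trans_state trans_idx tree(5) assms by blast+

text \<open>The start value is the least one for existential states and the greatest one for the
  others. A transition leads either to a smaller index, whose values do not depend on the stage, or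
  to the same index with the same kind, where the induction hypothesis points in the right
  direction.\<close>

lemma stage_chain:
  assumes "v \<in> verts T" "q \<in> states G" "idx q = n"
  shows "if knd q = Existential then st n j v q \<longrightarrow> st n (Suc j) v q
         else st n (Suc j) v q \<longrightarrow> st n j v q"
  using assms
proof (induction j arbitrary: v q)
  case 0
  then show ?case by simp
next
  case (Suc j)
  have fin: "finite (children T v)" using tree Suc by blast
  show ?case
  proof (cases "knd q = Existential")
    case True
    have "st n (Suc j) w p" if "(m, p) \<in> atoms (delta G q (label T v))" "w \<in> children T v" "st n j w p"
      for m p w
    proof (cases "idx p < n")
      case True
      then show ?thesis using that(3) stage_lower by metis
    next
      case False
      then have "idx p = n" "knd p = Existential" "p \<in> states G"
        using trans[OF Suc.prems(1,2) that(1)] Suc.prems True by auto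
      then show ?thesis using Suc.IH[of w p] that tree(4) Suc.prems(1) by simp
    qed
    then have "local_sat G T (st n (Suc j)) v q" if "local_sat G T (st n j) v q"
      by (rule local_sat_mono[OF that fin])
    then show ?thesis using True Suc.prems by simp
  next
    case False
    have "st n j w p" if "(m, p) \<in> atoms (delta G q (label T v))" "w \<in> children T v" "st n (Suc j) w p"
      for m p w
    proof (cases "idx p < n")
      case True
      then show ?thesis using that(3) stage_lower by metis
    next
      case F: False
      then have "idx p = n" "knd p \<noteq> Existential" "p \<in> states G"
        using trans[OF Suc.prems(1,2) that(1)] Suc.prems False by auto
      then show ?thesis using Suc.IH[of w p] that tree(4) Suc.prems(1) by simp
    qed
    then have "local_sat G T (st n j) v q" if "local_sat G T (st n (Suc j)) v q"
      by (rule local_sat_mono[OF that fin])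
    then show ?thesis using False Suc.prems by simp
  qed
qed

lemma stage_mono:
  assumes "v \<in> verts T" "q \<in> states G" "knd q = Existential" "st (idx q) j v q" "j \<le> i"
  shows "st (idx q) i v q"
  using assms(5,4)
  by (induction i rule: dec_induct) (use stage_chain[OF assms(1,2) refl] assms(3) in auto)

lemma stage_antimono:
  assumes "v \<in> verts T" "q \<in> states G" "knd q \<noteq> Existential" "\<not> st (idx q) j v q" "j \<le> i"
  shows "\<not> st (idx q) i v q"
  using assms(5,4)
  by (induction i rule: dec_induct) (use stage_chain[OF assms(1,2) refl] assms(3) in auto)

lemma wins_existential:
  assumes "v \<in> verts T" "q \<in> states G" "knd q = Existential"
  shows "W v q \<longleftrightarrow> (\<exists>j. st (idx q) j v q)"
  unfolding wins_stage using stage_mono[OF assms] by blast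

lemma wins_non_existential:
  assumes "v \<in> verts T" "q \<in> states G" "knd q \<noteq> Existential"
  shows "W v q \<longleftrightarrow> (\<forall>j. st (idx q) j v q)"
  unfolding wins_stage using stage_antimono[OF assms] by (meson nat_le_linear)

lemma stage_eventually:
  assumes "v \<in> verts T" "q \<in> states G" "idx q \<le> n"
  shows "\<forall>\<^sub>F i in sequentially. st n i v q = W v q"
proof (cases "idx q < n")
  case True
  then show ?thesis by (simp add: stage_lower)
next
  case False
  then have n: "n = idx q" using assms by simp
  show ?thesis
  proof (cases "knd q = Existential")
    case True
    show ?thesis unfolding eventually_sequentially n
      using wins_existential[OF assms(1,2) True] stage_mono[OF assms(1,2) True] by blast
  next
    case False
    show ?thesis unfolding eventually_sequentially n
      using wins_non_existential[OF assms(1,2) False] stage_antimono[OF assms(1,2) False] by blast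
  qed
qed

text \<open>The limit is reached at omega: finitely many children and states are relevant, so a
  single stage \<open>i\<close> has the final value at all of them while stage \<open>Suc i\<close>
  has the final value at \<open>v\<close>.\<close>

lemma wins_unfold:
  assumes "v \<in> verts T" "q \<in> states G"
  shows "W v q \<longleftrightarrow> local_sat G T W v q"
proof -
  let ?n = "idx q"
  let ?S = "{p \<in> states G. idx p \<le> ?n}"
  have "\<forall>\<^sub>F i in sequentially. \<forall>w\<in>children T v. \<forall>p\<in>?S. st ?n i w p = W w p"
    by (intro eventually_ball_finite ballI stage_eventually)
      (use tree assms finite_states in auto)
  moreover have "\<forall>\<^sub>F i in sequentially. st ?n (Suc i) v q = W v q"
    using stage_eventually[OF assms order_refl] by (simp only: eventually_sequentially_Suc[of "\<lambda>i. st ?n i v q = W v q"])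
  ultimately have "\<forall>\<^sub>F i in sequentially. (\<forall>w\<in>children T v. \<forall>p\<in>?S. st ?n i w p = W w p) \<and>
      st ?n (Suc i) v q = W v q"
    by (rule eventually_conj)
  then obtain i where i: "\<And>w p. w \<in> children T v \<Longrightarrow> p \<in> ?S \<Longrightarrow> st ?n i w p = W w p"
    "st ?n (Suc i) v q = W v q" by (auto simp: eventually_sequentially)
  have "W v q \<longleftrightarrow> local_sat G T (st ?n i) v q" using i(2) by simp
  also have "\<dots> \<longleftrightarrow> local_sat G T W v q"
    by (rule local_sat_cong[OF refl refl]) (use i(1) trans[OF assms] in fastforce)
  finally show ?thesis .
qed

text \<open>One formula for both polarities: the first stage at which the value departs from its
  start value. It is meaningful for winning existential and for losing universal positions.\<close>

definition rank :: "'v \<Rightarrow> 'q \<Rightarrow> nat" where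
  "rank v q = (LEAST j. st (idx q) j v q \<longleftrightarrow> knd q = Existential)"

text \<open>Stage 0 is false, so the rank is some \<open>Suc i\<close> and the transition formula
  holds over stage \<open>i\<close>. Successors of the same index that are true at stage
  \<open>i\<close> have rank at most \<open>i\<close>.\<close>

lemma rank_existential:
  assumes "v \<in> verts T" "q \<in> states G" "knd q = Existential" "W v q"
  shows "local_sat G T (\<lambda>w p. W w p \<and> (idx p = idx q \<longrightarrow> rank w p < rank v q)) v q"
proof -
  let ?n = "idx q"
  have "\<exists>j. st ?n j v q \<longleftrightarrow> knd q = Existential"
    using wins_existential[OF assms(1-3)] assms(3,4) by simp
  from LeastI_ex[OF this] have r: "st ?n (rank v q) v q"
    unfolding rank_def[symmetric] using assms(3) by simp
  then obtain i where i: "rank v q = Suc i" using assms(3) by (cases "rank v q") auto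
  have "local_sat G T (st ?n i) v q" using r i by simp
  then show ?thesis
  proof (rule local_sat_mono)
    show "finite (children T v)" using tree assms by blast
    fix m p w assume a: "(m, p) \<in> atoms (delta G q (label T v))" "w \<in> children T v" "st ?n i w p"
    have p: "p \<in> states G" "idx p < ?n \<or> idx p = ?n \<and> knd p = knd q"
      using trans[OF assms(1,2) a(1)] by auto
    have w: "w \<in> verts T" using tree(4) assms(1) a(2) by blast
    show "W w p \<and> (idx p = ?n \<longrightarrow> rank w p < rank v q)"
    proof (cases "idx p = ?n")
      case True
      then have k: "knd p = Existential" using p assms by simp
      have s: "st (idx p) i w p" using a(3) True by simp
      then have "rank w p \<le> i" unfolding rank_def using k by (intro Least_le) simp
      then show ?thesis using wins_existential[OF w p(1) k] s i by auto
    next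
      case False
      then have "idx p < ?n" using p(2) by simp
      then show ?thesis using a(3) False by (simp add: stage_lower)
    qed
  qed
qed

text \<open>The dual, stated by refutation: even if every successor of the same index whose rank
  does not decrease is counted as winning, the transition formula fails. Hence some losing successor
  is of lower index or of smaller rank.\<close>

lemma rank_universal:
  assumes "v \<in> verts T" "q \<in> states G" "knd q = Universal" "\<not> W v q"
  shows "\<not> local_sat G T (\<lambda>w p. W w p \<or> (idx p = idx q \<and> \<not> rank w p < rank v q)) v q"
proof
  let ?n = "idx q"
  assume l: "local_sat G T (\<lambda>w p. W w p \<or> (idx p = idx q \<and> \<not> rank w p < rank v q)) v q"
  have ne: "knd q \<noteq> Existential" using assms by simp
  have "\<exists>j. st ?n j v q \<longleftrightarrow> knd q = Existential"
    using wins_non_existential[OF assms(1,2) ne] assms(4) ne by simp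
  from LeastI_ex[OF this] have r: "\<not> st ?n (rank v q) v q"
    unfolding rank_def[symmetric] using ne by simp
  then obtain i where i: "rank v q = Suc i" using ne by (cases "rank v q") auto
  have "local_sat G T (st ?n i) v q" using l
  proof (rule local_sat_mono)
    show "finite (children T v)" using tree assms by blast
    fix m p w assume a: "(m, p) \<in> atoms (delta G q (label T v))" "w \<in> children T v"
      "W w p \<or> (idx p = idx q \<and> \<not> rank w p < rank v q)"
    have p: "p \<in> states G" "idx p < ?n \<or> idx p = ?n \<and> knd p = knd q"
      using trans[OF assms(1,2) a(1)] by auto
    have w: "w \<in> verts T" using tree(4) assms(1) a(2) by blast
    show "st ?n i w p"
    proof (cases "idx p = ?n")
      case True
      then have k: "knd p \<noteq> Existential" using p ne by simp
      show ?thesis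
      proof (rule ccontr)
        assume "\<not> ?thesis"
        then have s: "\<not> st (idx p) i w p" using True by simp
        then have "rank w p \<le> i" unfolding rank_def using k by (intro Least_le) simp
        then show False using wins_non_existential[OF w p(1) k] s i a(3) by auto
      qed
    next
      case False
      then have "idx p < ?n" using p(2) by simp
      then show ?thesis using a(3) False by (simp add: stage_lower)
    qed
  qed
  then show False using r i by simp
qed

end

section \<open>Membership in the fixpoint versus successful runs\<close>

lemma infinite_path_from:
  assumes R: "fb_tree R" and f0: "f 0 \<in> verts R" and f: "\<And>i. f (Suc i) \<in> children R (f i)"
  shows "\<exists>\<pi>\<in>infinite_paths R. \<exists>k. \<forall>i. \<pi> (k + i) = f i"
proof -
  have "(root R, f 0) \<in> (edges R)\<^sup>*" using R f0 by (auto simp: fb_tree_def)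
  then obtain k where "(root R, f 0) \<in> edges R ^^ k" using rtrancl_imp_relpow by blast
  then obtain g where g: "g 0 = root R" "g k = f 0" "\<And>i. i < k \<Longrightarrow> (g i, g (Suc i)) \<in> edges R"
    unfolding relpow_fun_conv by blast
  define \<pi> where "\<pi> i = (if i < k then g i else f (i - k))" for i
  have "\<pi> (Suc i) \<in> children R (\<pi> i)" for i
  proof (cases "i < k")
    case True
    then have "\<pi> (Suc i) = g (Suc i)" using g(2) unfolding \<pi>_def by (cases "Suc i = k") auto
    then show ?thesis using g(3)[OF True] True by (simp add: \<pi>_def children_def)
  next
    case False
    then have "Suc i - k = Suc (i - k)" by simp
    then show ?thesis using False f by (simp add: \<pi>_def)
  qed
  moreover have "\<pi> 0 = root R" using g(1,2) by (auto simp: \<pi>_def)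
  moreover have "\<pi> (k + i) = f i" for i by (simp add: \<pi>_def)
  ultimately show ?thesis unfolding infinite_paths_def by blast
qed

text \<open>By pigeonhole some state of \<open>S\<close> recurs, and every recurring state lies in
  \<open>S\<close>; so the maximum is attained there. If all of \<open>S\<close> has priorities of
  one parity, this decides acceptance.\<close>

lemma Max_prio_tail:
  fixes r :: "nat \<Rightarrow> 'q"
  assumes S: "finite S" and mem: "\<And>i. k \<le> i \<Longrightarrow> r i \<in> S"
  shows "Max (pr ` {q. \<exists>\<^sub>\<infinity>i. r i = q}) \<in> pr ` S"
proof -
  let ?I = "{q. \<exists>\<^sub>\<infinity>i. r i = q}"
  have sub: "?I \<subseteq> S"
  proof
    fix q assume "q \<in> ?I"
    then have "\<forall>m. \<exists>i\<ge>m. r i = q" by (simp add: INFM_nat_le)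
    then obtain i where "i \<ge> k" "r i = q" by blast
    then show "q \<in> S" using mem[of i] by simp
  qed
  have "\<exists>q\<in>S. \<exists>\<^sub>\<infinity>i. r (k + i) = q"
  proof -
    have "finite (range (\<lambda>i. r (k + i)))" by (rule finite_subset[OF _ S]) (use mem in auto)
    then obtain i0 where i0: "infinite {i. r (k + i) = r (k + i0)}"
      using pigeonhole_infinite[of UNIV "\<lambda>i. r (k + i)"] by auto
    show ?thesis
      by (rule bexI[of _ "r (k + i0)"]) (use i0 mem in \<open>auto simp: frequently_cofinite\<close>)
  qed
  then obtain q where q: "\<exists>\<^sub>\<infinity>i. r (k + i) = q" by blast
  have "\<exists>\<^sub>\<infinity>i. r i = q" unfolding INFM_nat_le
  proof
    fix m
    have "\<forall>m. \<exists>i\<ge>m. r (k + i) = q" using q by (simp add: INFM_nat_le)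
    then obtain i where "i \<ge> m" "r (k + i) = q" by blast
    then show "\<exists>n\<ge>m. r n = q" by (intro exI[of _ "k + i"]) auto
  qed
  then have "?I \<noteq> {}" by blast
  moreover have "finite ?I" using sub S finite_subset by blast
  ultimately have "Max (pr ` ?I) \<in> pr ` ?I" by (intro Max_in) auto
  then show ?thesis using sub by blast
qed

context weak_gta_on_tree
begin

text \<open>Acceptance is used only for existential states: it makes the descent through them in the
  run well-founded, and induction upwards computes a least fixpoint. For universal states induction
  on the rank is enough: if all successors of smaller rank win, \<open>rank_universal\<close> rules
  out that the node loses.\<close>

lemma wins_if_run:
  fixes R :: "('r, 'v \<times> 'q) ltree"
  assumes run: "is_run G T R" and succ: "successful G R"
  shows "s \<in> verts R \<Longrightarrow> label R s = (v, q) \<Longrightarrow> W v q"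
proof (induction "idx q" arbitrary: s v q rule: less_induct)
  case outer: less
  have R: "fb_tree R" using run by (simp add: is_run_def)
  have child: "s' \<in> verts R" if "s' \<in> children R s" for s s'
    using R that by (auto simp: fb_tree_def children_def)
  have lab: "v \<in> verts T" "q \<in> states G" if "s \<in> verts R" "label R s = (v, q)" for s v q
    using run that by (force simp: is_run_def)+
  have loc: "local_sat G T (\<lambda>w p. \<exists>s'\<in>children R s. label R s' = (w, p)) v q"
    if "s \<in> verts R" "label R s = (v, q)" for s v q
    using run that unfolding is_run_def local_sat_def modal_sat_eq by blast
  have fin: "finite (children T v)" if "s \<in> verts R" "label R s = (v, q)" for s v q
    using tree(2) lab that by blast
  let ?n = "idx q"
  have low: "W v' q'" if "s' \<in> verts R" "label R s' = (v', q')" "idx q' < ?n" for s' v' q'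
    using outer(1) that by blast
  show ?case
  proof (cases "knd q")
    case Transient
    have "local_sat G T W v q" using loc[OF outer(2,3)] fin[OF outer(2,3)]
    proof (rule local_sat_mono)
      fix m p w assume a: "(m, p) \<in> atoms (delta G q (label T v))" "\<exists>s'\<in>children R s. label R s' = (w, p)"
      then have "idx p < ?n" using trans[OF lab[OF outer(2,3)] a(1)] Transient by auto
      then show "W w p" using a(2) low child by blast
    qed
    then show ?thesis using wins_unfold[OF lab[OF outer(2,3)]] by simp
  next
    case Existential
    define S where "S = {p \<in> states G. knd p = Existential}"
    \<comment> \<open>\<open>r\<close> ranges over all existential states, whatever their component:
      a path that stays among odd priorities is rejecting in any case.\<close>
    define r where "r = {(s', s). s \<in> verts R \<and> s' \<in> children R s \<and>
        snd (label R s) \<in> S \<and> snd (label R s') \<in> S}"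
    have "wf r" unfolding wf_iff_no_infinite_down_chain
    proof
      assume "\<exists>f. \<forall>i. (f (Suc i), f i) \<in> r"
      then obtain f where f: "\<And>i. (f (Suc i), f i) \<in> r" by blast
      have f0: "f 0 \<in> verts R" and fS: "\<And>i. f (Suc i) \<in> children R (f i)"
        and st: "\<And>i. snd (label R (f i)) \<in> S" using f unfolding r_def by auto
      obtain \<pi> k where \<pi>: "\<pi> \<in> infinite_paths R" "\<And>i. \<pi> (k + i) = f i"
        using infinite_path_from[of R f, OF R f0 fS] by blast
      have "snd (label R (\<pi> i)) \<in> S" if "k \<le> i" for i
        using st[of "i - k"] \<pi>(2)[of "i - k"] that by simp
      moreover have "finite S" using finite_states by (simp add: S_def)
      ultimately have "Max (prio G ` {q. \<exists>\<^sub>\<infinity>i. snd (label R (\<pi> i)) = q}) \<in> prio G ` S"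
        by (intro Max_prio_tail)
      then have "odd (Max (prio G ` {q. \<exists>\<^sub>\<infinity>i. snd (label R (\<pi> i)) = q}))"
        using odd_prio by (auto simp: S_def)
      then show False using succ \<pi>(1) by (simp add: successful_def)
    qed
    then have "s \<in> verts R \<Longrightarrow> label R s = (v, q') \<Longrightarrow> idx q' = ?n \<Longrightarrow> knd q' = Existential \<Longrightarrow> W v q'"
      for s v q'
    proof (induction s arbitrary: v q' rule: wf_induct_rule)
      case (less s)
      note l = less.prems(1,2)
      have "local_sat G T W v q'" using loc[OF l] fin[OF l]
      proof (rule local_sat_mono)
        fix m p w assume a: "(m, p) \<in> atoms (delta G q' (label T v))" "\<exists>s'\<in>children R s. label R s' = (w, p)"
        then obtain s' where s': "s' \<in> children R s" "label R s' = (w, p)" by blast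
        have p: "p \<in> states G" "idx p < ?n \<or> idx p = ?n \<and> knd p = Existential"
          using trans[OF lab[OF l] a(1)] less.prems by auto
        show "W w p"
        proof (cases "idx p < ?n")
          case True
          then show ?thesis using low[OF child[OF s'(1)] s'(2)] by blast
        next
          case False
          then have "(s', s) \<in> r" unfolding r_def S_def using s' l lab[OF l] p less.prems by auto
          then show ?thesis using less.IH[OF _ child[OF s'(1)] s'(2)] p False by blast
        qed
      qed
      then show ?case using wins_unfold[OF lab[OF l]] by simp
    qed
    then show ?thesis using outer(2,3) Existential by blast
  next
    case Universal
    have "s \<in> verts R \<Longrightarrow> label R s = (v, q') \<Longrightarrow> idx q' = ?n \<Longrightarrow> knd q' = Universal \<Longrightarrow> W v q'"
      for s v q'
    proof (induction "rank v q'" arbitrary: s v q' rule: less_induct)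
      case (less v q' s)
      note l = less.prems(1,2)
      show ?case
      proof (rule ccontr)
        assume n: "\<not> W v q'"
        have "local_sat G T (\<lambda>w p. W w p \<or> (idx p = idx q' \<and> \<not> rank w p < rank v q')) v q'"
          using loc[OF l] fin[OF l]
        proof (rule local_sat_mono)
          fix m p w assume a: "(m, p) \<in> atoms (delta G q' (label T v))" "\<exists>s'\<in>children R s. label R s' = (w, p)"
          then obtain s' where s': "s' \<in> children R s" "label R s' = (w, p)" by blast
          have p: "idx p < ?n \<or> idx p = ?n \<and> knd p = Universal"
            using trans[OF lab[OF l] a(1)] less.prems by auto
          show "W w p \<or> (idx p = idx q' \<and> \<not> rank w p < rank v q')"
          proof (cases "idx p < ?n")
            case True
            then show ?thesis using low[OF child[OF s'(1)] s'(2)] by blast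
          next
            case False
            then show ?thesis
              using less.hyps[OF _ child[OF s'(1)] s'(2)] p less.prems(3) by auto
          qed
        qed
        then show False using rank_universal[OF lab[OF l] less.prems(4) n] by blast
      qed
    qed
    then show ?thesis using outer(2,3) Universal by blast
  qed
qed

text \<open>No choice is made: every winning successor that occurs in the transition is kept. This
  is harmless since transition formulas are positive. Only within existential components is the rank
  required to fall, to prevent an infinite stay.\<close>

definition strategy_step :: "'v \<times> 'q \<Rightarrow> 'v \<times> 'q \<Rightarrow> bool" where
  "strategy_step = (\<lambda>(v, q) (w, p). w \<in> children T v \<and> W w p \<and>
     (\<exists>m. (m, p) \<in> atoms (delta G q (label T v))) \<and>
     (idx p = idx q \<longrightarrow> knd q = Existential \<longrightarrow> rank w p < rank v q))"

definition plays :: "('v \<times> 'q) list set" where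
  "plays = {xs. xs \<noteq> [] \<and> hd xs = (root T, init G) \<and> successively strategy_step xs}"

text \<open>Histories are taken as nodes so that the same pair reached in two ways gives two nodes
  and the graph is a tree. They are then numbered because \<open>gta_lang\<close> fixes the node
  type of runs to \<open>nat\<close>.\<close>

definition play_run :: "(nat, 'v \<times> 'q) ltree" where
  "play_run = \<lparr> verts = to_nat_on plays ` plays,
     edges = {(to_nat_on plays xs, to_nat_on plays (xs @ [y])) | xs y. xs \<in> plays \<and> xs @ [y] \<in> plays},
     root = to_nat_on plays [(root T, init G)],
     label = (\<lambda>n. last (from_nat_into plays n)) \<rparr>"

lemma plays_snoc: "xs \<in> plays \<Longrightarrow> xs @ [y] \<in> plays \<longleftrightarrow> strategy_step (last xs) y"
  by (auto simp: plays_def successively_append_iff)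

lemma plays_butlast: "xs @ [y] \<in> plays \<Longrightarrow> xs \<noteq> [] \<Longrightarrow> xs \<in> plays"
  by (auto simp: plays_def successively_append_iff)

lemma play_root: "[(root T, init G)] \<in> plays"
  by (simp add: plays_def)

lemma play_mem: 
  assumes "W (root T) (init G)" "xs \<in> plays"
  shows "set xs \<subseteq> {(v, q). v \<in> verts T \<and> q \<in> states G \<and> W v q}"
  using assms(2)
proof (induction xs rule: rev_induct)
  case (snoc y xs)
  show ?case
  proof (cases "xs = []")
    case True
    then have "y = (root T, init G)" using snoc(2) by (simp add: plays_def)
    then show ?thesis using True tree(1) init_state assms(1) by simp
  next
    case False
    have xs: "xs \<in> plays" by (rule plays_butlast[OF snoc(2) False])
    have st: "strategy_step (last xs) y" using plays_snoc[OF xs] snoc(2) by simp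
    obtain v q w p where eq: "last xs = (v, q)" "y = (w, p)" by (metis prod.exhaust)
    have "(v, q) \<in> set xs" using False eq(1) last_in_set by metis
    then have vq: "v \<in> verts T" "q \<in> states G" using snoc.IH[OF xs] by auto
    obtain m where m: "(m, p) \<in> atoms (delta G q (label T v))" and w: "w \<in> children T v" "W w p"
      using st eq by (auto simp: strategy_step_def)
    have "w \<in> verts T" by (rule tree(4)[OF vq(1) w(1)])
    moreover have "p \<in> states G" by (rule trans(1)[OF vq m])
    ultimately show ?thesis using snoc.IH[OF xs] eq w by simp
  qed
qed simp

lemma countable_verts: "countable (verts T)"
proof -
  have "verts T \<subseteq> (edges T)\<^sup>* `` {root T}" using T by (auto simp: sigma_trees_def fb_tree_def)
  moreover have "countable ((edges T)\<^sup>* `` {root T})"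
  proof (rule countable_rtrancl)
    fix Y :: "'v set" assume "countable Y"
    then show "countable (edges T `` Y)"
    proof (rule countable_Image[rotated])
      fix y
      have "edges T `` {y} = children T y" by (auto simp: children_def)
      moreover have "finite (children T y)"
      proof (cases "y \<in> verts T")
        case False
        then have "children T y = {}" using T by (auto simp: sigma_trees_def fb_tree_def children_def)
        then show ?thesis by simp
      qed (rule tree(2))
      ultimately show "countable (edges T `` {y})" by (simp add: countable_finite)
    qed
  qed simp
  ultimately show ?thesis by (rule countable_subset)
qed

lemma countable_plays:
  assumes "W (root T) (init G)"
  shows "countable plays"
proof (rule countable_subset)
  show "plays \<subseteq> lists (verts T \<times> states G)"
    using play_mem[OF assms] by (fastforce simp: in_lists_conv_set)
  show "countable (lists (verts T \<times> states G))"
    by (intro countable_lists countable_SIGMA countable_verts countable_finite finite_states)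
qed

text \<open>Along an infinite path the index never increases, so index and kind are eventually
  constant. A transient state cannot repeat its index, and an existential one would make the rank
  fall forever; what remains is universal and hence even.\<close>

lemma play_run_successful:
  assumes win: "W (root T) (init G)"
  shows "is_run G T play_run" "successful G play_run"
proof -
  let ?e = "to_nat_on plays"
  note cnt = countable_plays[OF win]
  have inj: "?e xs = ?e ys \<longleftrightarrow> xs = ys" if "xs \<in> plays" "ys \<in> plays" for xs ys
    using to_nat_on_inj[OF cnt that] .
  have dec: "from_nat_into plays (?e xs) = xs" if "xs \<in> plays" for xs
    using from_nat_into_to_nat_on[OF cnt that] .
  have lab: "label play_run (?e xs) = last xs" if "xs \<in> plays" for xs
    using dec[OF that] by (simp add: play_run_def)
  have edgeD: "\<exists>xs y. xs \<in> plays \<and> xs @ [y] \<in> plays \<and> a = ?e xs \<and> b = ?e (xs @ [y])"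
    if "(a, b) \<in> edges play_run" for a b
  proof -
    have "\<exists>xs y. (a, b) = (?e xs, ?e (xs @ [y])) \<and> xs \<in> plays \<and> xs @ [y] \<in> plays"
      using that by (simp add: play_run_def)
    then show ?thesis by blast
  qed
  have edgeI: "(?e xs, ?e (xs @ [y])) \<in> edges play_run" if "xs \<in> plays" "xs @ [y] \<in> plays" for xs y
  proof -
    have "\<exists>xs' y'. (?e xs, ?e (xs @ [y])) = (?e xs', ?e (xs' @ [y'])) \<and> xs' \<in> plays \<and> xs' @ [y'] \<in> plays"
      using that by blast
    then show ?thesis by (simp add: play_run_def)
  qed
  have edge: "(?e xs, n) \<in> edges play_run \<longleftrightarrow> (\<exists>y. n = ?e (xs @ [y]) \<and> strategy_step (last xs) y)"
    if xs: "xs \<in> plays" for xs n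
  proof
    assume "(?e xs, n) \<in> edges play_run"
    then obtain xs' y where *: "xs' \<in> plays" "xs' @ [y] \<in> plays" "?e xs = ?e xs'" "n = ?e (xs' @ [y])"
      using edgeD by blast
    have "xs' = xs" using inj[OF xs *(1)] *(3) by simp
    then show "\<exists>y. n = ?e (xs @ [y]) \<and> strategy_step (last xs) y"
      using *(2,4) plays_snoc[OF xs] by blast
  next
    assume "\<exists>y. n = ?e (xs @ [y]) \<and> strategy_step (last xs) y"
    then show "(?e xs, n) \<in> edges play_run" using edgeI[OF xs] plays_snoc[OF xs] by blast
  qed
  have ne: "xs \<noteq> []" if "xs \<in> plays" for xs using that by (simp add: plays_def)
  have last: "v \<in> verts T" "q \<in> states G" "W v q" if "xs \<in> plays" "last xs = (v, q)" for xs v q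
    using play_mem[OF win that(1)] last_in_set[OF ne[OF that(1)]] that(2) by auto
  have chld: "children play_run (?e xs) = (\<lambda>y. ?e (xs @ [y])) ` {y. strategy_step (last xs) y}"
    if "xs \<in> plays" for xs
    unfolding children_def using edge[OF that] by auto
  have fin: "finite {y. strategy_step (last xs) y}" if xs: "xs \<in> plays" for xs
  proof -
    obtain v q where vq: "last xs = (v, q)" by (cases "last xs")
    have "{y. strategy_step (last xs) y} \<subseteq> children T v \<times> states G"
      using trans(1)[OF last(1,2)[OF xs vq]] by (auto simp: strategy_step_def vq)
    moreover have "finite (children T v \<times> states G)"
      using tree(2)[OF last(1)[OF xs vq]] finite_states by simp
    ultimately show ?thesis by (rule finite_subset)
  qed
  have reach: "(root play_run, ?e xs) \<in> (edges play_run)\<^sup>*" if "xs \<in> plays" for xs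
    using that
  proof (induction xs rule: rev_induct)
    case Nil
    then show ?case using ne by blast
  next
    case (snoc y xs)
    show ?case
    proof (cases "xs = []")
      case True
      then show ?thesis using snoc(2) by (simp add: plays_def play_run_def)
    next
      case False
      then have xs: "xs \<in> plays" by (rule plays_butlast[OF snoc(2)])
      have "(?e xs, ?e (xs @ [y])) \<in> edges play_run" by (rule edgeI[OF xs snoc(2)])
      then show ?thesis using snoc(1)[OF xs] by (rule rtrancl_into_rtrancl[rotated])
    qed
  qed
  have acyc: "acyclic (edges play_run)"
  proof (rule acyclic_subset)
    show "acyclic (inv_image less_than (\<lambda>n. length (from_nat_into plays n)))"
      by (intro wf_acyclic wf_inv_image wf_less_than)
    show "edges play_run \<subseteq> inv_image less_than (\<lambda>n. length (from_nat_into plays n))"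
    proof
      fix ab assume "ab \<in> edges play_run"
      then obtain xs y where "xs \<in> plays" "xs @ [y] \<in> plays" "ab = (?e xs, ?e (xs @ [y]))"
        using edgeD by (cases ab) blast
      then show "ab \<in> inv_image less_than (\<lambda>n. length (from_nat_into plays n))"
        by (simp add: dec)
    qed
  qed
  have uniq: "u = u'" if un: "(u, n) \<in> edges play_run" "(u', n) \<in> edges play_run" for u u' n
  proof -
    obtain xs y where 1: "xs \<in> plays" "xs @ [y] \<in> plays" "u = ?e xs" "n = ?e (xs @ [y])"
      using edgeD[OF un(1)] by blast
    obtain xs' y' where 2: "xs' \<in> plays" "xs' @ [y'] \<in> plays" "u' = ?e xs'" "n = ?e (xs' @ [y'])"
      using edgeD[OF un(2)] by blast
    show ?thesis using inj[OF 1(2) 2(2)] 1 2 by simp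
  qed
  have vs: "verts play_run = ?e ` plays" by (simp add: play_run_def)
  have fb: "fb_tree play_run"
    unfolding fb_tree_def
  proof (intro conjI)
    show "root play_run \<in> verts play_run" using play_root by (simp add: play_run_def)
    show "edges play_run \<subseteq> verts play_run \<times> verts play_run" by (auto simp: play_run_def)
    show "\<forall>v\<in>verts play_run. (root play_run, v) \<in> (edges play_run)\<^sup>*" using reach vs by auto
    show "\<forall>v\<in>verts play_run. finite (children play_run v)" using vs chld fin by auto
    show "\<forall>u u' v. (u, v) \<in> edges play_run \<longrightarrow> (u', v) \<in> edges play_run \<longrightarrow> u = u'" using uniq by blast
  qed (rule acyc)
  have sat: "pbf_sat (\<lambda>(m, p). modal_sat T play_run (?e xs) v p m) (delta G q (label T v))"
    if xs: "xs \<in> plays" and vq: "last xs = (v, q)" for xs v q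
  proof -
    note vq' = last[OF xs vq]
    have "local_sat G T (\<lambda>w p. W w p \<and> (idx p = idx q \<longrightarrow> knd q = Existential \<longrightarrow> rank w p < rank v q)) v q"
    proof (cases "knd q = Existential")
      case True
      then show ?thesis using rank_existential[OF vq'(1,2) True vq'(3)] by simp
    next
      case False
      then show ?thesis using wins_unfold[OF vq'(1,2)] vq'(3) by simp
    qed
    then have "local_sat G T (\<lambda>w p. \<exists>s'\<in>children play_run (?e xs). label play_run s' = (w, p)) v q"
      using tree(2)[OF vq'(1)]
    proof (rule local_sat_mono)
      fix m p w assume a: "(m, p) \<in> atoms (delta G q (label T v))" "w \<in> children T v"
        "W w p \<and> (idx p = idx q \<longrightarrow> knd q = Existential \<longrightarrow> rank w p < rank v q)"
      have st: "strategy_step (last xs) (w, p)" unfolding vq strategy_step_def using a by auto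
      then have "xs @ [(w, p)] \<in> plays" using plays_snoc[OF xs] by simp
      then have "label play_run (?e (xs @ [(w, p)])) = (w, p)" using lab by simp
      then show "\<exists>s'\<in>children play_run (?e xs). label play_run s' = (w, p)"
        unfolding chld[OF xs] using st by blast
    qed
    then show ?thesis unfolding local_sat_def modal_sat_eq .
  qed
  show "is_run G T play_run" unfolding is_run_def
  proof (intro conjI ballI allI impI)
    show "fb_tree play_run" by (rule fb)
    show "label play_run \<in> verts play_run \<rightarrow> verts T \<times> states G"
    proof
      fix s assume "s \<in> verts play_run"
      then obtain xs where xs: "xs \<in> plays" "s = ?e xs" using vs by blast
      then show "label play_run s \<in> verts T \<times> states G"
        using last[OF xs(1)] lab[OF xs(1)] by (cases "last xs") auto
    qed
    show "label play_run (root play_run) = (root T, init G)"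
      using lab[OF play_root] by (simp add: play_run_def)
    fix s v q assume "s \<in> verts play_run" "label play_run s = (v, q)"
    then obtain xs where "xs \<in> plays" "s = ?e xs" "last xs = (v, q)" using vs lab by auto
    then show "pbf_sat (\<lambda>(m, p). modal_sat T play_run s v p m) (delta G q (label T v))"
      using sat by blast
  qed
  show "successful G play_run" unfolding successful_def
  proof
    fix \<pi> assume \<pi>: "\<pi> \<in> infinite_paths play_run"
    have \<pi>0: "\<pi> 0 = root play_run" and \<pi>S: "\<And>i. \<pi> (Suc i) \<in> children play_run (\<pi> i)"
      using \<pi> by (auto simp: infinite_paths_def)
    have ex: "\<exists>xs\<in>plays. \<pi> i = ?e xs" for i
    proof (cases i)
      case 0
      then show ?thesis using \<pi>0 play_root by (auto simp: play_run_def)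
    next
      case (Suc j)
      then show ?thesis using \<pi>S[of j] edgeD[of "\<pi> j" "\<pi> i"] unfolding children_def by auto
    qed
    define z where "z i = label play_run (\<pi> i)" for i
    have zst: "strategy_step (z i) (z (Suc i))" for i
    proof -
      obtain xs where xs: "xs \<in> plays" "\<pi> i = ?e xs" using ex by blast
      obtain y where y: "\<pi> (Suc i) = ?e (xs @ [y])" "strategy_step (last xs) y"
        using \<pi>S[of i] unfolding xs(2) chld[OF xs(1)] by blast
      have "xs @ [y] \<in> plays" using plays_snoc[OF xs(1)] y by simp
      then have "z (Suc i) = y" using lab y(1) by (simp add: z_def)
      moreover have "z i = last xs" using lab xs by (simp add: z_def)
      ultimately show ?thesis using y(2) by simp
    qed
    have zin: "fst (z i) \<in> verts T" "snd (z i) \<in> states G" for i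
    proof -
      obtain xs where xs: "xs \<in> plays" "\<pi> i = ?e xs" using ex by blast
      then have "z i = last xs" using lab by (simp add: z_def)
      then show "fst (z i) \<in> verts T" "snd (z i) \<in> states G"
        using last[OF xs(1)] by (metis prod.collapse)+
    qed
    let ?q = "\<lambda>i. snd (z i)"
    have step: "idx (?q (Suc i)) < idx (?q i) \<or>
        idx (?q (Suc i)) = idx (?q i) \<and> knd (?q (Suc i)) = knd (?q i) \<and> knd (?q i) \<noteq> Transient" for i
    proof -
      obtain m where "(m, ?q (Suc i)) \<in> atoms (delta G (?q i) (label T (fst (z i))))"
        using zst[of i] by (auto simp: strategy_step_def split_def)
      then show ?thesis by (rule trans(2)[OF zin])
    qed
    \<comment> \<open>The least index met on the path; from its first occurrence on the index cannot
      change.\<close>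
    define n where "n = (LEAST n. \<exists>i. idx (?q i) = n)"
    have "\<exists>i. idx (?q i) = n" unfolding n_def by (rule LeastI[of _ "idx (?q 0)"]) blast
    then obtain k where k: "idx (?q k) = n" by blast
    have least: "n \<le> idx (?q i)" for i unfolding n_def by (rule Least_le) blast
    have const: "idx (?q (k + i)) = n \<and> knd (?q (k + i)) = knd (?q k)" for i
    proof (induction i)
      case (Suc i)
      then show ?case using step[of "k + i"] least[of "Suc (k + i)"] by auto
    qed (simp add: k)
    have nT: "knd (?q k) \<noteq> Transient" using step[of k] const[of 1] k by auto
    have nE: "knd (?q k) \<noteq> Existential"
    proof
      assume E: "knd (?q k) = Existential"
      define f where "f i = rank (fst (z (k + i))) (?q (k + i))" for i
      have f: "f (Suc i) < f i" for i
        using zst[of "k + i"] const[of i] const[of "Suc i"] E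
        by (auto simp: strategy_step_def split_def f_def)
      have "f i + i \<le> f 0" for i
      proof (induction i)
        case (Suc i)
        then show ?case using f[of i] by simp
      qed simp
      from this[of "Suc (f 0)"] show False by simp
    qed
    have U: "knd (?q k) = Universal" using nT nE by (cases "knd (?q k)") auto
    let ?S = "{p \<in> states G. knd p = Universal}"
    have "snd (label play_run (\<pi> i)) \<in> ?S" if "k \<le> i" for i
      using const[of "i - k"] U zin(2)[of i] that by (simp add: z_def)
    then have "Max (prio G ` {q. \<exists>\<^sub>\<infinity>i. snd (label play_run (\<pi> i)) = q}) \<in> prio G ` ?S"
      by (intro Max_prio_tail) (simp_all add: finite_states)
    then show "even (Max (prio G ` {q. \<exists>\<^sub>\<infinity>i. snd (label play_run (\<pi> i)) = q}))"
      using even_prio by auto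
  qed
qed

theorem gta_lang_iff_wins: "T \<in> gta_lang G \<longleftrightarrow> W (root T) (init G)"
proof
  assume "T \<in> gta_lang G"
  then obtain R :: "(nat, 'v \<times> 'q) ltree" where R: "is_run G T R" "successful G R"
    by (auto simp: gta_lang_def)
  have "root R \<in> verts R" "label R (root R) = (root T, init G)"
    using R(1) by (auto simp: is_run_def fb_tree_def)
  then show "W (root T) (init G)" by (rule wins_if_run[OF R])
next
  assume "W (root T) (init G)"
  then show "T \<in> gta_lang G" using play_run_successful T by (auto simp: gta_lang_def)
qed

end

section \<open>Path predicates definable in cCTL*f\<close>

definition segment :: "('v, 'z) tree_scheme \<Rightarrow> 'v list \<Rightarrow> bool" where
  "segment T \<rho> \<longleftrightarrow> \<rho> \<noteq> [] \<and> successively (\<lambda>u w. w \<in> children T u) \<rho>"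

lemma finite_paths_iff: "\<pi> \<in> finite_paths T \<longleftrightarrow> segment T \<pi> \<and> hd \<pi> = root T"
  by (auto simp: finite_paths_def segment_def successively_conv_nth)

lemma segment_drop: "segment T \<pi> \<Longrightarrow> i < length \<pi> \<Longrightarrow> segment T (drop i \<pi>)"
  by (auto simp: segment_def successively_conv_nth)

lemma segment_Cons: "segment T (v # \<rho>) \<longleftrightarrow> \<rho> = [] \<or> hd \<rho> \<in> children T v \<and> segment T \<rho>"
  by (auto simp: segment_def successively_Cons)

lemma segment_splice:
  assumes "\<pi> \<in> finite_paths T" "i < length \<pi>" "segment T \<rho>" "hd \<rho> = \<pi> ! i"
  shows "take i \<pi> @ \<rho> \<in> finite_paths T" "take (Suc i) (take i \<pi> @ \<rho>) = take (Suc i) \<pi>"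
proof -
  obtain r where r: "\<rho> = \<pi> ! i # r" using assms(3,4) by (cases \<rho>) (auto simp: segment_def)
  have \<pi>: "successively (\<lambda>u w. w \<in> children T u) \<pi>" "\<pi> \<noteq> []" "hd \<pi> = root T"
    using assms(1) by (auto simp: finite_paths_iff segment_def)
  have s: "successively (\<lambda>u w. w \<in> children T u) (take i \<pi> @ [\<pi> ! i] @ drop (Suc i) \<pi>)"
    using \<pi>(1) assms(2) by (simp add: id_take_nth_drop[symmetric])
  have "successively (\<lambda>u w. w \<in> children T u) (take i \<pi> @ \<rho>)"
    using s assms(3) unfolding r by (simp add: successively_append_iff segment_def)
  moreover have "hd (take i \<pi> @ \<rho>) = root T"
    using \<pi>(2,3) assms(4) by (cases "i = 0") (simp_all add: hd_conv_nth[symmetric] hd_append)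
  ultimately show "take i \<pi> @ \<rho> \<in> finite_paths T"
    using r by (simp add: finite_paths_iff segment_def)
  show "take (Suc i) (take i \<pi> @ \<rho>) = take (Suc i) \<pi>"
    using assms(2) by (simp add: r take_Suc_conv_app_nth)
qed

lemma segment_verts:
  assumes "T \<in> sigma_trees \<Sigma>" "segment T \<rho>" "hd \<rho> \<in> verts T"
  shows "set \<rho> \<subseteq> verts T"
  using assms(2,3)
proof (induction \<rho>)
  case (Cons v \<rho>)
  then show ?case
    using sigma_treesD(4)[OF assms(1)] by (cases "\<rho> = []") (auto simp: segment_Cons)
qed simp

lemma take_Suc_eqD:
  assumes "take (Suc i) \<pi>' = take (Suc i) \<pi>" "i < length \<pi>"
  shows "i < length \<pi>'" "\<pi>' ! i = \<pi> ! i"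
proof -
  have "length (take (Suc i) \<pi>') = length (take (Suc i) \<pi>)" using assms by simp
  then show "i < length \<pi>'" using assms(2) by simp
  have "take (Suc i) \<pi>' ! i = take (Suc i) \<pi> ! i" using assms by simp
  then show "\<pi>' ! i = \<pi> ! i" by simp
qed

text \<open>The logic has no past operators, so truth at position \<open>i\<close> can be expressed
  by a predicate on the suffix \<open>drop i \<pi>\<close>. \<open>P0\<close> records the
  propositions a formula may mention.\<close>

definition path_definable ::
  "'p set \<Rightarrow> 'p set \<Rightarrow> (('v, 'p set) ltree \<Rightarrow> 'v list \<Rightarrow> bool) \<Rightarrow> bool" where
  "path_definable AP P0 R \<longleftrightarrow> (\<exists>\<phi>. props \<phi> \<subseteq> P0 \<and>
     (\<forall>T \<in> sigma_trees (Pow AP). \<forall>\<pi> \<in> finite_paths T. \<forall>i < length \<pi>.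
        sat T \<pi> i \<phi> \<longleftrightarrow> R T (drop i \<pi>)))"

abbreviation state_definable ::
  "'p set \<Rightarrow> 'p set \<Rightarrow> (('v, 'p set) ltree \<Rightarrow> 'v \<Rightarrow> bool) \<Rightarrow> bool" where
  "state_definable AP P0 S \<equiv> path_definable AP P0 (\<lambda>T \<rho>. S T (hd \<rho>))"

lemma path_definable_cong:
  assumes "path_definable AP P0 R"
    and "\<And>T \<rho>. T \<in> sigma_trees (Pow AP) \<Longrightarrow> segment T \<rho> \<Longrightarrow> set \<rho> \<subseteq> verts T \<Longrightarrow> R T \<rho> = R' T \<rho>"
  shows "path_definable AP P0 R'"
proof -
  have "R T (drop i \<pi>) = R' T (drop i \<pi>)"
    if "T \<in> sigma_trees (Pow AP)" "\<pi> \<in> finite_paths T" "i < length \<pi>" for T \<pi> i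
  proof (rule assms(2)[OF that(1)])
    have \<pi>: "segment T \<pi>" "hd \<pi> = root T" using that(2) by (auto simp: finite_paths_iff)
    show "segment T (drop i \<pi>)" by (rule segment_drop[OF \<pi>(1) that(3)])
    have "set \<pi> \<subseteq> verts T"
      by (rule segment_verts[OF that(1) \<pi>(1)]) (use sigma_treesD(1)[OF that(1)] \<pi>(2) in simp)
    then show "set (drop i \<pi>) \<subseteq> verts T" using set_drop_subset by fast
  qed
  moreover obtain \<phi> where "props \<phi> \<subseteq> P0" "\<forall>T \<in> sigma_trees (Pow AP). \<forall>\<pi> \<in> finite_paths T.
      \<forall>i < length \<pi>. sat T \<pi> i \<phi> \<longleftrightarrow> R T (drop i \<pi>)"
    using assms(1) unfolding path_definable_def by blast
  ultimately show ?thesis unfolding path_definable_def by (intro exI[of _ \<phi>]) simp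
qed

lemma state_definable_cong:
  fixes S S' :: "('v, 'p set) ltree \<Rightarrow> 'v \<Rightarrow> bool"
  assumes "state_definable AP P0 S"
    and "\<And>T v. T \<in> sigma_trees (Pow AP) \<Longrightarrow> v \<in> verts T \<Longrightarrow> S T v = S' T v"
  shows "state_definable AP P0 S'"
proof (rule path_definable_cong[OF assms(1)])
  fix T :: "('v, 'p set) ltree" and \<rho> assume a: "T \<in> sigma_trees (Pow AP)" "segment T \<rho>" "set \<rho> \<subseteq> verts T"
  have "hd \<rho> \<in> verts T" using a(2,3) hd_in_set[of \<rho>] by (auto simp: segment_def)
  then show "S T (hd \<rho>) = S' T (hd \<rho>)" by (rule assms(2)[OF a(1)])
qed

lemma path_definable_neg: "path_definable AP P0 R \<Longrightarrow> path_definable AP P0 (\<lambda>T \<rho>. \<not> R T \<rho>)"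
  unfolding path_definable_def
  by (elim exE, rule_tac x="Neg \<phi>" in exI) simp

lemma path_definable_disj:
  assumes "path_definable AP P0 R" "path_definable AP P0 R'"
  shows "path_definable AP P0 (\<lambda>T \<rho>. R T \<rho> \<or> R' T \<rho>)"
proof -
  obtain \<phi> \<phi>' where "props \<phi> \<subseteq> P0" "props \<phi>' \<subseteq> P0"
    "\<forall>T \<in> sigma_trees (Pow AP). \<forall>\<pi> \<in> finite_paths T. \<forall>i < length \<pi>. sat T \<pi> i \<phi> \<longleftrightarrow> R T (drop i \<pi>)"
    "\<forall>T \<in> sigma_trees (Pow AP). \<forall>\<pi> \<in> finite_paths T. \<forall>i < length \<pi>. sat T \<pi> i \<phi>' \<longleftrightarrow> R' T (drop i \<pi>)"
    using assms unfolding path_definable_def by auto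
  then show ?thesis unfolding path_definable_def
    by (intro exI[of _ "Disj \<phi> \<phi>'"]) simp
qed

lemma path_definable_conj:
  assumes "path_definable AP P0 R" "path_definable AP P0 R'"
  shows "path_definable AP P0 (\<lambda>T \<rho>. R T \<rho> \<and> R' T \<rho>)"
  using path_definable_neg[OF path_definable_disj[OF path_definable_neg[OF assms(1)] path_definable_neg[OF assms(2)]]]
  by simp

lemma path_definable_prop: "p \<in> P0 \<Longrightarrow> state_definable AP P0 (\<lambda>T v. p \<in> label T v)"
  unfolding path_definable_def
  by (intro exI[of _ "Prop p"]) (simp add: hd_drop_conv_nth)

text \<open>The grammar has no Boolean constants; they must be written as a tautology or
  contradiction over some proposition. This is the reason for requiring a nonempty
  \<open>P0\<close>.\<close>

lemma path_definable_const:
  assumes "P0 \<noteq> {}"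
  shows "path_definable AP P0 (\<lambda>T \<rho>. b)"
proof -
  obtain p where "p \<in> P0" using assms by blast
  then have p: "state_definable AP P0 (\<lambda>T v. p \<in> label T v)" by (rule path_definable_prop)
  show ?thesis
    using path_definable_disj[OF p path_definable_neg[OF p]] path_definable_conj[OF p path_definable_neg[OF p]]
    by (cases b) simp_all
qed

lemma path_definable_Bex:
  assumes "P0 \<noteq> {}" "finite S" "\<And>x. x \<in> S \<Longrightarrow> path_definable AP P0 (R x)"
  shows "path_definable AP P0 (\<lambda>T \<rho>. \<exists>x\<in>S. R x T \<rho>)"
  using assms(2,3)
proof (induction S rule: finite_induct)
  case empty
  show ?case using path_definable_const[OF assms(1), of AP False] by simp
next
  case (insert x S)
  have "path_definable AP P0 (\<lambda>T \<rho>. R x T \<rho> \<or> (\<exists>x\<in>S. R x T \<rho>))"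
    by (rule path_definable_disj) (use insert in auto)
  then show ?case by simp
qed

lemma path_definable_Ball:
  assumes "P0 \<noteq> {}" "finite S" "\<And>x. x \<in> S \<Longrightarrow> path_definable AP P0 (R x)"
  shows "path_definable AP P0 (\<lambda>T \<rho>. \<forall>x\<in>S. R x T \<rho>)"
proof -
  have "path_definable AP P0 (\<lambda>T \<rho>. \<not> (\<exists>x\<in>S. \<not> R x T \<rho>))"
    by (intro path_definable_neg path_definable_Bex assms(1,2)) (use assms(3) path_definable_neg in auto)
  then show ?thesis by simp
qed

lemma path_definable_next:
  assumes "path_definable AP P0 R"
  shows "path_definable AP P0 (\<lambda>T \<rho>. tl \<rho> \<noteq> [] \<and> R T (tl \<rho>))"
proof -
  obtain \<phi> where "props \<phi> \<subseteq> P0" and \<phi>: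
    "\<forall>T \<in> sigma_trees (Pow AP). \<forall>\<pi> \<in> finite_paths T. \<forall>i < length \<pi>. sat T \<pi> i \<phi> \<longleftrightarrow> R T (drop i \<pi>)"
    using assms unfolding path_definable_def by auto
  then show ?thesis unfolding path_definable_def
    by (intro exI[of _ "Next \<phi>"]) (auto simp: drop_Suc tl_drop simp flip: not_less)
qed

lemma path_definable_until:
  assumes "path_definable AP P0 R" "path_definable AP P0 R'"
  shows "path_definable AP P0 (\<lambda>T \<rho>. \<exists>j<length \<rho>. R' T (drop j \<rho>) \<and> (\<forall>k<j. R T (drop k \<rho>)))"
proof -
  obtain \<phi> \<phi>' where pr: "props \<phi> \<subseteq> P0" "props \<phi>' \<subseteq> P0" and
    \<phi>: "\<forall>T \<in> sigma_trees (Pow AP). \<forall>\<pi> \<in> finite_paths T. \<forall>i < length \<pi>. sat T \<pi> i \<phi> \<longleftrightarrow> R T (drop i \<pi>)" and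
    \<phi>': "\<forall>T \<in> sigma_trees (Pow AP). \<forall>\<pi> \<in> finite_paths T. \<forall>i < length \<pi>. sat T \<pi> i \<phi>' \<longleftrightarrow> R' T (drop i \<pi>)"
    using assms unfolding path_definable_def by auto
  have "sat T \<pi> i (Until \<phi> \<phi>') \<longleftrightarrow>
      (\<exists>j<length (drop i \<pi>). R' T (drop j (drop i \<pi>)) \<and> (\<forall>k<j. R T (drop k (drop i \<pi>))))"
    if "T \<in> sigma_trees (Pow AP)" "\<pi> \<in> finite_paths T" "i < length \<pi>" for T \<pi> i
  proof
    assume "sat T \<pi> i (Until \<phi> \<phi>')"
    then obtain j where j: "i \<le> j" "j < length \<pi>" "sat T \<pi> j \<phi>'" "\<And>k. i \<le> k \<Longrightarrow> k < j \<Longrightarrow> sat T \<pi> k \<phi>"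
      by auto
    have "R' T (drop (j - i) (drop i \<pi>))" using j(1-3) \<phi>' that(1,2) by simp
    moreover have "R T (drop k (drop i \<pi>))" if "k < j - i" for k
    proof -
      have "sat T \<pi> (k + i) \<phi>" "k + i < length \<pi>" using j(2) j(4)[of "k + i"] that by auto
      then show ?thesis using \<phi> \<open>T \<in> sigma_trees (Pow AP)\<close> \<open>\<pi> \<in> finite_paths T\<close> by simp
    qed
    moreover have "j - i < length (drop i \<pi>)" using j by simp
    ultimately show "\<exists>j<length (drop i \<pi>). R' T (drop j (drop i \<pi>)) \<and> (\<forall>k<j. R T (drop k (drop i \<pi>)))"
      by blast
  next
    assume "\<exists>j<length (drop i \<pi>). R' T (drop j (drop i \<pi>)) \<and> (\<forall>k<j. R T (drop k (drop i \<pi>)))"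
    then obtain j where j: "j + i < length \<pi>" "R' T (drop (j + i) \<pi>)" "\<And>k. k < j \<Longrightarrow> R T (drop (k + i) \<pi>)"
      by (auto simp: less_diff_conv)
    have "sat T \<pi> (j + i) \<phi>'" using j(1,2) \<phi>' that by simp
    moreover have "sat T \<pi> k \<phi>" if "i \<le> k" "k < j + i" for k
    proof -
      have "R T (drop k \<pi>)" using j(3)[of "k - i"] that by simp
      then show ?thesis using \<phi> \<open>T \<in> sigma_trees (Pow AP)\<close> \<open>\<pi> \<in> finite_paths T\<close> j(1) that by simp
    qed
    ultimately show "sat T \<pi> i (Until \<phi> \<phi>')"
      unfolding sat.simps using j(1) by (intro exI[of _ "j + i"]) simp
  qed
  then show ?thesis unfolding path_definable_def
    by (intro exI[of _ "Until \<phi> \<phi>'"]) (use pr in simp)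
qed

lemma state_definable_path:
  assumes "path_definable AP P0 R"
  shows "state_definable AP P0 (\<lambda>T v. \<exists>\<rho>. segment T \<rho> \<and> hd \<rho> = v \<and> R T \<rho>)"
proof -
  obtain \<phi> where pr: "props \<phi> \<subseteq> P0" and \<phi>:
    "\<forall>T \<in> sigma_trees (Pow AP). \<forall>\<pi> \<in> finite_paths T. \<forall>i < length \<pi>. sat T \<pi> i \<phi> \<longleftrightarrow> R T (drop i \<pi>)"
    using assms unfolding path_definable_def by auto
  have "sat T \<pi> i (EPath \<phi>) \<longleftrightarrow> (\<exists>\<rho>. segment T \<rho> \<and> hd \<rho> = hd (drop i \<pi>) \<and> R T \<rho>)"
    if T: "T \<in> sigma_trees (Pow AP)" and \<pi>: "\<pi> \<in> finite_paths T" and i: "i < length \<pi>" for T \<pi> i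
  proof
    assume "sat T \<pi> i (EPath \<phi>)"
    then obtain \<pi>' where \<pi>': "\<pi>' \<in> finite_paths T" "take (Suc i) \<pi>' = take (Suc i) \<pi>" "sat T \<pi>' i \<phi>"
      by auto
    note t = take_Suc_eqD[OF \<pi>'(2) i]
    have "R T (drop i \<pi>')" using \<phi> T \<pi>' t by simp
    moreover have "segment T (drop i \<pi>')" using segment_drop t(1) \<pi>'(1) by (auto simp: finite_paths_iff)
    ultimately show "\<exists>\<rho>. segment T \<rho> \<and> hd \<rho> = hd (drop i \<pi>) \<and> R T \<rho>"
      using t i by (intro exI[of _ "drop i \<pi>'"]) (simp add: hd_drop_conv_nth)
  next
    assume "\<exists>\<rho>. segment T \<rho> \<and> hd \<rho> = hd (drop i \<pi>) \<and> R T \<rho>"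
    then obtain \<rho> where \<rho>: "segment T \<rho>" "hd \<rho> = \<pi> ! i" "R T \<rho>" using i by (auto simp: hd_drop_conv_nth)
    note s = segment_splice[OF \<pi> i \<rho>(1,2)]
    have d: "drop i (take i \<pi> @ \<rho>) = \<rho>" using i by simp
    have "i < length (take i \<pi> @ \<rho>)" using take_Suc_eqD(1)[OF s(2) i] .
    then have "sat T (take i \<pi> @ \<rho>) i \<phi>" using \<phi> T s(1) \<rho>(3) d by simp
    then show "sat T \<pi> i (EPath \<phi>)" unfolding sat.simps using s by blast
  qed
  then show ?thesis unfolding path_definable_def
    by (intro exI[of _ "EPath \<phi>"]) (use pr in simp)
qed

text \<open>\<open>Count\<close> also demands that the current path continue beyond position
  \<open>i\<close>. Prefixing \<open>EPath\<close> removes this dependence on the path, because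
  every node has a child along which to continue.\<close>

lemma state_definable_count:
  assumes "state_definable AP P0 S"
  shows "state_definable AP P0 (\<lambda>T v. \<exists>N \<subseteq> children T v. finite N \<and> card N = k \<and> (\<forall>w\<in>N. S T w))"
proof -
  obtain \<phi> where pr: "props \<phi> \<subseteq> P0" and \<phi>:
    "\<And>T \<pi> i. T \<in> sigma_trees (Pow AP) \<Longrightarrow> \<pi> \<in> finite_paths T \<Longrightarrow> i < length \<pi> \<Longrightarrow>
       sat T \<pi> i \<phi> \<longleftrightarrow> S T (\<pi> ! i)"
    using assms unfolding path_definable_def by (auto simp: hd_drop_conv_nth)
  have "sat T \<pi> i (EPath (Count k \<phi>)) \<longleftrightarrow>
      (\<exists>N \<subseteq> children T (\<pi> ! i). finite N \<and> card N = k \<and> (\<forall>w\<in>N. S T w))"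
    if T: "T \<in> sigma_trees (Pow AP)" and \<pi>: "\<pi> \<in> finite_paths T" and i: "i < length \<pi>" for T \<pi> i
  proof
    assume "sat T \<pi> i (EPath (Count k \<phi>))"
    then obtain \<pi>' P where \<pi>': "take (Suc i) \<pi>' = take (Suc i) \<pi>" and
      P: "P \<subseteq> finite_paths T" "finite P" "card P = k" "inj_on (\<lambda>\<pi>'. \<pi>' ! Suc i) P" and
      Pi: "\<And>\<pi>''. \<pi>'' \<in> P \<Longrightarrow> take (Suc i) \<pi>'' = take (Suc i) \<pi>' \<and> Suc i < length \<pi>'' \<and> sat T \<pi>'' (Suc i) \<phi>"
      by auto
    let ?N = "(\<lambda>\<pi>'. \<pi>' ! Suc i) ` P"
    have "\<pi>'' ! Suc i \<in> children T (\<pi> ! i)" "S T (\<pi>'' ! Suc i)" if "\<pi>'' \<in> P" for \<pi>''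
    proof -
      have t: "take (Suc i) \<pi>'' = take (Suc i) \<pi>" using Pi[OF that] \<pi>' by simp
      have p: "\<pi>'' \<in> finite_paths T" using P(1) that by blast
      then show "\<pi>'' ! Suc i \<in> children T (\<pi> ! i)"
        using Pi[OF that] take_Suc_eqD(2)[OF t i] by (auto simp: finite_paths_def)
      show "S T (\<pi>'' ! Suc i)" using \<phi>[OF T p] Pi[OF that] by blast
    qed
    then have "?N \<subseteq> children T (\<pi> ! i)" "\<forall>w\<in>?N. S T w" by auto
    moreover have "finite ?N" "card ?N = k" using P by (auto simp: card_image)
    ultimately show "\<exists>N \<subseteq> children T (\<pi> ! i). finite N \<and> card N = k \<and> (\<forall>w\<in>N. S T w)" by blast
  next
    assume "\<exists>N \<subseteq> children T (\<pi> ! i). finite N \<and> card N = k \<and> (\<forall>w\<in>N. S T w)"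
    then obtain N where N: "N \<subseteq> children T (\<pi> ! i)" "finite N" "card N = k" "\<And>w. w \<in> N \<Longrightarrow> S T w" by blast
    let ?e = "\<lambda>w. take i \<pi> @ [\<pi> ! i, w]"
    have li: "length (take i \<pi>) = i" using i by simp
    have nth: "?e w ! Suc i = w" for w using li by (simp add: nth_append)
    have len: "Suc i < length (?e w)" for w using li by simp
    have e: "?e w \<in> finite_paths T" "take (Suc i) (?e w) = take (Suc i) \<pi>" if "w \<in> children T (\<pi> ! i)" for w
      using segment_splice[OF \<pi> i, of "[\<pi> ! i, w]"] that by (auto simp: segment_def)
    have sp: "set \<pi> \<subseteq> verts T"
      by (rule segment_verts[OF T]) (use \<pi> sigma_treesD(1)[OF T] in \<open>auto simp: finite_paths_iff\<close>)
    \<comment> \<open>The path chosen for \<open>EPath\<close> goes to an arbitrary child,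
      independent of \<open>N\<close>, which is empty for \<open>k = 0\<close>.\<close>
    then obtain w0 where w0: "w0 \<in> children T (\<pi> ! i)" using sigma_treesD(3)[OF T, of "\<pi> ! i"] i nth_mem by fast
    have "sat T (?e w0) i (Count k \<phi>)"
      unfolding sat.simps
    proof (intro conjI exI[of _ "?e ` N"])
      show "Suc i < length (?e w0)" by (rule len)
      show "?e ` N \<subseteq> finite_paths T" using e(1) N(1) by blast
      show "finite (?e ` N)" using N(2) by simp
      show "card (?e ` N) = k" using N(3) by (subst card_image) (auto simp: inj_on_def)
      show "inj_on (\<lambda>\<pi>'. \<pi>' ! Suc i) (?e ` N)" by (auto simp: inj_on_def nth)
      show "\<forall>\<pi>'\<in>?e ` N. take (Suc i) \<pi>' = take (Suc i) (?e w0) \<and> Suc i < length \<pi>' \<and> sat T \<pi>' (Suc i) \<phi>"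
      proof
        fix \<pi>' assume "\<pi>' \<in> ?e ` N"
        then obtain w where w: "w \<in> N" "\<pi>' = ?e w" by blast
        have wc: "w \<in> children T (\<pi> ! i)" using w N(1) by blast
        have "sat T (?e w) (Suc i) \<phi>" using \<phi>[OF T e(1)[OF wc] len] N(4)[OF w(1)] by (simp only: nth)
        then show "take (Suc i) \<pi>' = take (Suc i) (?e w0) \<and> Suc i < length \<pi>' \<and> sat T \<pi>' (Suc i) \<phi>"
          using e(2)[OF wc] e(2)[OF w0] len[of w] unfolding w(2) by (simp only: simp_thms)
      qed
    qed
    then show "sat T \<pi> i (EPath (Count k \<phi>))" using e[OF w0] by (subst sat.simps) blast
  qed
  then show ?thesis unfolding path_definable_def
    by (intro exI[of _ "EPath (Count k \<phi>)"]) (use pr in \<open>simp add: hd_drop_conv_nth del: sat.simps\<close>)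
qed

text \<open>More than \<open>k - 1\<close> failing children means a set of exactly
  \<open>Suc (k - 1)\<close> of them. This form is correct for truncated subtraction and reduces
  \<open>Box\<close> to a negated count.\<close>

lemma modal_holds_Box:
  assumes "finite (children T v)"
  shows "modal_holds T v (Box k) P \<longleftrightarrow>
    \<not> (\<exists>N \<subseteq> children T v. finite N \<and> card N = Suc (k - 1) \<and> (\<forall>w\<in>N. \<not> P w))"
proof -
  let ?F = "{w \<in> children T v. \<not> P w}"
  have fin: "finite ?F" using assms by simp
  have "(\<exists>N \<subseteq> children T v. finite N \<and> card N = Suc (k - 1) \<and> (\<forall>w\<in>N. \<not> P w)) \<longleftrightarrow> Suc (k - 1) \<le> card ?F"
  proof
    assume "\<exists>N \<subseteq> children T v. finite N \<and> card N = Suc (k - 1) \<and> (\<forall>w\<in>N. \<not> P w)"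
    then obtain N where "N \<subseteq> ?F" "card N = Suc (k - 1)" by blast
    then show "Suc (k - 1) \<le> card ?F" using card_mono[OF fin, of N] by simp
  next
    assume "Suc (k - 1) \<le> card ?F"
    then obtain N where "N \<subseteq> ?F" "card N = Suc (k - 1)" "finite N"
      by (rule obtain_subset_with_card_n)
    then show "\<exists>N \<subseteq> children T v. finite N \<and> card N = Suc (k - 1) \<and> (\<forall>w\<in>N. \<not> P w)" by blast
  qed
  then show ?thesis by auto
qed

lemma state_definable_modal:
  fixes S :: "('v, 'p set) ltree \<Rightarrow> 'v \<Rightarrow> bool"
  assumes "state_definable AP P0 S"
  shows "state_definable AP P0 (\<lambda>T v. modal_holds T v m (S T))"
proof (cases m)
  case (Dia k)
  show ?thesis unfolding Dia modal_holds.simps by (rule state_definable_count[OF assms])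
next
  case (Box k)
  note c = path_definable_neg[OF state_definable_count[OF path_definable_neg[OF assms], of "Suc (k - 1)"]]
  show ?thesis unfolding Box
  proof (rule state_definable_cong[OF c])
    fix T :: "('v, 'p set) ltree" and v assume "T \<in> sigma_trees (Pow AP)" "v \<in> verts T"
    then have "finite (children T v)" by (rule sigma_treesD(2))
    from modal_holds_Box[OF this] show "(\<not> (\<exists>N\<subseteq>children T v. finite N \<and> card N = Suc (k - 1) \<and> (\<forall>w\<in>N. \<not> S T w))) =
        modal_holds T v (Box k) (S T)" by blast
  qed
qed

lemma until_iff: "until P Q w \<longleftrightarrow> (\<exists>j\<le>length w. Q (drop j w) \<and> (\<forall>k<j. P (drop k w)))"
proof (induction w)
  case (Cons a w)
  have "(\<exists>j\<le>length (a # w). Q (drop j (a # w)) \<and> (\<forall>k<j. P (drop k (a # w)))) \<longleftrightarrow>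
      Q (a # w) \<or> (\<exists>j\<le>length w. Q (drop j w) \<and> (\<forall>k<Suc j. P (drop k (a # w))))" (is "?L \<longleftrightarrow> ?R")
  proof
    assume ?L
    then obtain j where j: "j \<le> length (a # w)" "Q (drop j (a # w))" "\<forall>k<j. P (drop k (a # w))" by blast
    show ?R
    proof (cases j)
      case 0
      then show ?thesis using j(2) by simp
    next
      case (Suc i)
      then have "i \<le> length w \<and> Q (drop i w) \<and> (\<forall>k<Suc i. P (drop k (a # w)))" using j by simp
      then show ?thesis by blast
    qed
  next
    assume ?R
    then show ?L
    proof
      assume "Q (a # w)"
      then show ?L by (intro exI[of _ 0]) simp
    next
      assume "\<exists>j\<le>length w. Q (drop j w) \<and> (\<forall>k<Suc j. P (drop k (a # w)))"
      then obtain j where "j \<le> length w" "Q (drop j w)" "\<forall>k<Suc j. P (drop k (a # w))" by blast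
      then show ?L by (intro exI[of _ "Suc j"]) simp
    qed
  qed
  moreover have "(\<forall>k<Suc j. P (drop k (a # w))) \<longleftrightarrow> P (a # w) \<and> (\<forall>k<j. P (drop k w))" for j
    by (simp add: All_less_Suc2)
  ultimately show ?case using Cons by auto
qed simp

text \<open>Word formulas become path formulas by substituting state formulas for letters. The last
  node of the path is not read, hence \<open>butlast\<close>, and a letter formula must in addition
  assert that a further node exists.\<close>

lemma path_definable_word:
  fixes \<l> :: "('v, 'p set) ltree \<Rightarrow> 'v \<Rightarrow> 'c"
  assumes "definable F P" and P0: "P0 \<noteq> {}"
    and alph: "\<And>T v. T \<in> sigma_trees (Pow AP) \<Longrightarrow> v \<in> verts T \<Longrightarrow> \<l> T v \<in> F"
    and lt: "\<And>a. a \<in> F \<Longrightarrow> state_definable AP P0 (\<lambda>T v. \<l> T v = a)"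
  shows "path_definable AP P0 (\<lambda>T \<rho>. P (map (\<l> T) (butlast \<rho>)))"
  using assms(1)
proof induction
  case true
  show ?case by (rule path_definable_const[OF P0])
next
  case (letter a)
  have "path_definable AP P0 (\<lambda>T \<rho>. (tl \<rho> \<noteq> [] \<and> True) \<and> \<l> T (hd \<rho>) = a)"
    by (intro path_definable_conj path_definable_next path_definable_const[OF P0] lt letter)
  then show ?case
  proof (rule path_definable_cong)
    fix T :: "('v, 'p set) ltree" and \<rho> assume "segment T \<rho>"
    then show "((tl \<rho> \<noteq> [] \<and> True) \<and> \<l> T (hd \<rho>) = a) =
      (map (\<l> T) (butlast \<rho>) \<noteq> [] \<and> hd (map (\<l> T) (butlast \<rho>)) = a)"
      by (cases \<rho>) (auto simp: segment_def)
  qed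
next
  case (neg P)
  show ?case by (rule path_definable_neg[OF neg(2)])
next
  case (disj P Q)
  show ?case by (rule path_definable_disj[OF disj(3,4)])
next
  case ("next" P)
  show ?case
  proof (rule path_definable_cong[OF path_definable_next[OF "next"(2)]])
    fix T :: "('v, 'p set) ltree" and \<rho> assume "segment T \<rho>"
    then show "(tl \<rho> \<noteq> [] \<and> P (map (\<l> T) (butlast (tl \<rho>)))) =
      (map (\<l> T) (butlast \<rho>) \<noteq> [] \<and> P (tl (map (\<l> T) (butlast \<rho>))))"
      by (cases \<rho>) (auto simp: segment_def)
  qed
next
  case (until P Q)
  show ?case
  proof (rule path_definable_cong[OF path_definable_until[OF until(3,4)]])
    fix T :: "('v, 'p set) ltree" and \<rho> assume "segment T \<rho>"
    then have "j < length \<rho> \<longleftrightarrow> j \<le> length (map (\<l> T) (butlast \<rho>))" for j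
      by (cases \<rho>) (auto simp: segment_def)
    then show "(\<exists>j<length \<rho>. Q (map (\<l> T) (butlast (drop j \<rho>))) \<and>
        (\<forall>k<j. P (map (\<l> T) (butlast (drop k \<rho>))))) = until P Q (map (\<l> T) (butlast \<rho>))"
      unfolding until_iff by (simp only: butlast_drop drop_map)
  qed
next
  case (cong P Q)
  show ?case
  proof (rule path_definable_cong[OF cong(3)])
    fix T :: "('v, 'p set) ltree" and \<rho> assume a: "T \<in> sigma_trees (Pow AP)" "set \<rho> \<subseteq> verts T"
    have "\<l> T v \<in> F" if "v \<in> set (butlast \<rho>)" for v
      by (rule alph[OF a(1)]) (use a(2) in_set_butlastD[OF that] in blast)
    then have "map (\<l> T) (butlast \<rho>) \<in> lists F" by auto
    then show "P (map (\<l> T) (butlast \<rho>)) = Q (map (\<l> T) (butlast \<rho>))" by (rule cong(2))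
  qed
qed

section \<open>Hesitant automata as weak automata\<close>

definition comp_of :: "('q, 'a, 'z) hwgt_scheme \<Rightarrow> 'q \<Rightarrow> 'q set" where
  "comp_of H q = (THE Qi. Qi \<in> comps H \<and> q \<in> Qi)"

text \<open>The size of the down-set turns the partial order into natural numbers strictly
  monotonically. Incomparable components may share an index, but no transition connects
  them.\<close>

definition comp_index :: "('q, 'a, 'z) hwgt_scheme \<Rightarrow> 'q \<Rightarrow> nat" where
  "comp_index H q = card {Qj \<in> comps H. (Qj, comp_of H q) \<in> comp_le H}"

definition comp_kind :: "('q, 'a, 'z) hwgt_scheme \<Rightarrow> 'q \<Rightarrow> kind" where
  "comp_kind H q = kind_of H (comp_of H q)"

lemma comp_of_eq:
  assumes "hwgt H" "Qi \<in> comps H" "q \<in> Qi"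
  shows "comp_of H q = Qi"
  unfolding comp_of_def
proof (rule the_equality)
  have p: "partition_on (states H) (comps H)" using assms(1) by (simp add: hwgt_def)
  fix Qj assume "Qj \<in> comps H \<and> q \<in> Qj"
  then show "Qj = Qi" using partition_onD2[OF p] assms(2,3) unfolding disjoint_def by blast
qed (use assms in simp)

lemma comp_of_state:
  assumes "hwgt H" "q \<in> states H"
  shows "comp_of H q \<in> comps H" "q \<in> comp_of H q"
proof -
  have "partition_on (states H) (comps H)" using assms(1) by (simp add: hwgt_def)
  then obtain Qi where "Qi \<in> comps H" "q \<in> Qi" using assms(2) partition_onD1 by blast
  then show "comp_of H q \<in> comps H" "q \<in> comp_of H q" using comp_of_eq[OF assms(1)] by auto
qed

lemma comp_subset_states: "hwgt H \<Longrightarrow> Qi \<in> comps H \<Longrightarrow> Qi \<subseteq> states H"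
  unfolding hwgt_def partition_on_def by blast

text \<open>A transition that leaves its component lowers the index: the down-set of the target is
  included by transitivity and, by antisymmetry, misses the source component.\<close>

lemma hwgt_trans:
  assumes H: "hwgt H" and q: "q \<in> states H" and \<sigma>: "\<sigma> \<in> alphabet H" and a: "(m, p) \<in> atoms (delta H q \<sigma>)"
  shows "p \<in> states H"
    "comp_of H p = comp_of H q \<and> comp_kind H q \<noteq> Transient \<or> comp_index H p < comp_index H q"
proof -
  show p: "p \<in> states H" using H q \<sigma> a unfolding hwgt_def gta_def by fast
  let ?P = "comp_of H p" and ?Q = "comp_of H q"
  note P = comp_of_state[OF H p] and Q = comp_of_state[OF H q]
  have po: "trans (comp_le H)" "antisym (comp_le H)" "refl_on (comps H) (comp_le H)"
    using H by (auto simp: hwgt_def partial_order_on_def preorder_on_def)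
  have le: "(?P, ?Q) \<in> comp_le H"
  proof -
    have "\<forall>Qi \<in> comps H. \<forall>Qj \<in> comps H. \<forall>q \<in> Qi. \<forall>\<sigma> \<in> alphabet H.
        \<forall>(m, q') \<in> atoms (delta H q \<sigma>). q' \<in> Qj \<longrightarrow> (Qj, Qi) \<in> comp_le H"
      using H unfolding hwgt_def by (elim conjE)
    from bspec[OF bspec[OF bspec[OF bspec[OF bspec[OF this Q(1)] P(1)] Q(2)] \<sigma>] a]
    show ?thesis using P(2) by simp
  qed
  have fin: "finite (comps H)"
    using H finite_elements by (auto simp: hwgt_def gta_def)
  show "?P = ?Q \<and> comp_kind H q \<noteq> Transient \<or> comp_index H p < comp_index H q"
  proof (cases "?P = ?Q")
    case True
    have "comp_kind H q \<noteq> Transient"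
    proof
      assume "comp_kind H q = Transient"
      then have "transient_comp H ?Q" using H Q(1) unfolding hwgt_def comp_kind_def by force
      then have "p \<notin> ?Q" using Q(2) \<sigma> a unfolding transient_comp_def by fast
      then show False using True P(2) by simp
    qed
    then show ?thesis using True by simp
  next
    case False
    have "{Qj \<in> comps H. (Qj, ?P) \<in> comp_le H} \<subset> {Qj \<in> comps H. (Qj, ?Q) \<in> comp_le H}"
    proof
      show "{Qj \<in> comps H. (Qj, ?P) \<in> comp_le H} \<subseteq> {Qj \<in> comps H. (Qj, ?Q) \<in> comp_le H}"
        using le po(1) by (auto elim: transE)
      have "?Q \<in> {Qj \<in> comps H. (Qj, ?Q) \<in> comp_le H}" using Q(1) po(3) by (auto simp: refl_on_def)
      moreover have "?Q \<notin> {Qj \<in> comps H. (Qj, ?P) \<in> comp_le H}"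
        using False le po(2) by (auto dest: antisymD)
      ultimately show "{Qj \<in> comps H. (Qj, ?P) \<in> comp_le H} \<noteq> {Qj \<in> comps H. (Qj, ?Q) \<in> comp_le H}"
        by blast
    qed
    then have "comp_index H p < comp_index H q"
      unfolding comp_index_def using fin by (intro psubset_card_mono) auto
    then show ?thesis by simp
  qed
qed

lemma hwgt_weak:
  assumes H: "hwgt H"
  shows "weak_gta H (comp_index H) (comp_kind H)"
proof
  show "finite (states H)" "init H \<in> states H" using H by (auto simp: hwgt_def gta_def)
  show "p \<in> states H" if "q \<in> states H" "\<sigma> \<in> alphabet H" "(m, p) \<in> atoms (delta H q \<sigma>)" for q \<sigma> m p
    by (rule hwgt_trans(1)[OF H that])
  show "comp_index H p < comp_index H q \<or>
      comp_index H p = comp_index H q \<and> comp_kind H p = comp_kind H q \<and> comp_kind H q \<noteq> Transient"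
    if "q \<in> states H" "\<sigma> \<in> alphabet H" "(m, p) \<in> atoms (delta H q \<sigma>)" for q \<sigma> m p
    using hwgt_trans(2)[OF H that] by (auto simp: comp_index_def comp_kind_def)
  have k: "case kind_of H Qi of
          Existential \<Rightarrow> existential_comp H Qi \<and> (\<forall>q \<in> Qi. odd (prio H q))
        | Universal \<Rightarrow> universal_comp H Qi \<and> (\<forall>q \<in> Qi. even (prio H q))
        | Transient \<Rightarrow> transient_comp H Qi" if "Qi \<in> comps H" for Qi
    using H that unfolding hwgt_def by blast
  show "odd (prio H q)" if "q \<in> states H" "comp_kind H q = Existential" for q
    using k[OF comp_of_state(1)[OF H that(1)]] comp_of_state(2)[OF H that(1)] that(2)
    by (simp add: comp_kind_def)
  show "even (prio H q)" if "q \<in> states H" "comp_kind H q = Universal" for q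
    using k[OF comp_of_state(1)[OF H that(1)]] comp_of_state(2)[OF H that(1)] that(2)
    by (simp add: comp_kind_def)
qed

text \<open>The fresh state is made transient with an index above all others, so each of its
  transitions is a strict descent.\<close>

lemma with_init_weak:
  assumes "weak_gta G idx knd" "\<And>m p. (m, p) \<in> atoms \<theta> \<Longrightarrow> p \<in> states G"
    "\<And>p. p \<in> states G \<Longrightarrow> idx p < N"
  shows "weak_gta (with_init G \<theta>) (case_option N idx) (case_option Transient knd)"
proof -
  interpret weak_gta G idx knd by fact
  have tr: "\<exists>p'. p = Some p' \<and> p' \<in> states G \<and> (case q of None \<Rightarrow> True | Some q' \<Rightarrow>
      idx p' < idx q' \<or> idx p' = idx q' \<and> knd p' = knd q' \<and> knd q' \<noteq> Transient)"
    if t: "q \<in> states (with_init G \<theta>)" "\<sigma> \<in> alphabet (with_init G \<theta>)"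
      "(m, p) \<in> atoms (delta (with_init G \<theta>) q \<sigma>)" for q \<sigma> m p
  proof (cases q)
    case None
    then show ?thesis using that(3) assms(2) by (auto simp: with_init_def pbf.set_map)
  next
    case (Some q')
    then have q': "q' \<in> states G" "\<sigma> \<in> alphabet G" using that(1,2) by (auto simp: with_init_def)
    obtain p' where "p = Some p'" "(m, p') \<in> atoms (delta G q' \<sigma>)"
      using t(3) Some by (auto simp: with_init_def pbf.set_map)
    then show ?thesis using trans_state[OF q'] trans_idx[OF q'] Some by auto
  qed
  show ?thesis
  proof
    show "finite (states (with_init G \<theta>))" using finite_states by (simp add: with_init_def)
    show "init (with_init G \<theta>) \<in> states (with_init G \<theta>)" by (simp add: with_init_def)
    fix q
    show "odd (prio (with_init G \<theta>) q)"
      if "q \<in> states (with_init G \<theta>)" "case_option Transient knd q = Existential"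
      using that odd_prio by (auto simp: with_init_def)
    show "even (prio (with_init G \<theta>) q)"
      if "q \<in> states (with_init G \<theta>)" "case_option Transient knd q = Universal"
      using that even_prio by (auto simp: with_init_def)
    fix \<sigma> m p
    assume a: "q \<in> states (with_init G \<theta>)" "\<sigma> \<in> alphabet (with_init G \<theta>)"
      "(m, p) \<in> atoms (delta (with_init G \<theta>) q \<sigma>)"
    obtain p' where p': "p = Some p'" "p' \<in> states G" "case q of None \<Rightarrow> True | Some q' \<Rightarrow>
      idx p' < idx q' \<or> idx p' = idx q' \<and> knd p' = knd q' \<and> knd q' \<noteq> Transient"
      using tr[OF a] by blast
    show "p \<in> states (with_init G \<theta>)" using p' by (simp add: with_init_def)
    show "case_option N idx p < case_option N idx q \<or>
        case_option N idx p = case_option N idx q \<and>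
        case_option Transient knd p = case_option Transient knd q \<and>
        case_option Transient knd q \<noteq> Transient"
      using p' assms(3)[OF p'(2)] by (cases q) auto
  qed
qed

text \<open>Mutual exclusion speaks of languages, that is, of what holds at the root. Restricting a
  tree to the descendants of \<open>v\<close> turns \<open>v\<close> into a root without changing
  the node type.\<close>

definition subtree :: "('v, 'a) ltree \<Rightarrow> 'v \<Rightarrow> ('v, 'a) ltree" where
  "subtree T v = (let D = (edges T)\<^sup>* `` {v} in
     T\<lparr>verts := D, edges := edges T \<inter> D \<times> D, root := v\<rparr>)"

lemma subtree_simps:
  "verts (subtree T v) = (edges T)\<^sup>* `` {v}" "root (subtree T v) = v" "label (subtree T v) = label T"
  "edges (subtree T v) = edges T \<inter> ((edges T)\<^sup>* `` {v}) \<times> ((edges T)\<^sup>* `` {v})"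
  by (simp_all add: subtree_def Let_def)

lemma subtree_children:
  assumes "u \<in> verts (subtree T v)"
  shows "children (subtree T v) u = children T u" "children T u \<subseteq> verts (subtree T v)"
  using assms by (auto simp: children_def subtree_simps intro: rtrancl_into_rtrancl)

lemma subtree_sigma_trees:
  assumes T: "T \<in> sigma_trees \<Sigma>" and v: "v \<in> verts T"
  shows "subtree T v \<in> sigma_trees \<Sigma>"
proof -
  let ?S = "subtree T v"
  have fb: "fb_tree T" using T by (simp add: sigma_trees_def)
  have "(v, u) \<in> (edges T)\<^sup>* \<Longrightarrow> u \<in> verts T \<and> (v, u) \<in> (edges ?S)\<^sup>*" for u
  proof (induction rule: rtrancl_induct)
    case (step y z)
    have "(y, z) \<in> edges ?S" using step by (auto simp: subtree_simps)
    then show ?case using step fb by (auto simp: fb_tree_def intro: rtrancl_into_rtrancl)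
  qed (use v in simp)
  then have sub: "u \<in> verts T" "(v, u) \<in> (edges ?S)\<^sup>*" if "u \<in> verts ?S" for u
    using that by (auto simp: subtree_simps)
  have "fb_tree ?S" unfolding fb_tree_def
  proof (intro conjI)
    show "root ?S \<in> verts ?S" by (simp add: subtree_simps)
    show "edges ?S \<subseteq> verts ?S \<times> verts ?S" by (auto simp: subtree_simps)
    show "acyclic (edges ?S)"
      by (rule acyclic_subset[of "edges T"]) (use fb in \<open>auto simp: fb_tree_def subtree_simps\<close>)
    show "\<forall>u\<in>verts ?S. (root ?S, u) \<in> (edges ?S)\<^sup>*" using sub(2) by (simp add: subtree_simps)
    have "\<forall>u u' v. (u, v) \<in> edges T \<longrightarrow> (u', v) \<in> edges T \<longrightarrow> u = u'" using fb by (simp add: fb_tree_def)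
    then show "\<forall>u u' v'. (u, v') \<in> edges ?S \<longrightarrow> (u', v') \<in> edges ?S \<longrightarrow> u = u'"
      unfolding subtree_simps by blast
    show "\<forall>u\<in>verts ?S. finite (children ?S u)"
      using sub(1) sigma_treesD(2)[OF T] by (simp add: subtree_children)
  qed
  moreover have "\<forall>u\<in>verts ?S. children ?S u \<noteq> {}"
    using sub(1) sigma_treesD(3)[OF T] by (simp add: subtree_children)
  moreover have "label ?S \<in> verts ?S \<rightarrow> \<Sigma>"
    using sub(1) sigma_treesD(5)[OF T] by (simp add: subtree_simps(3))
  ultimately show ?thesis by (simp add: sigma_trees_def)
qed

text \<open>One unfolding at the fresh initial state evaluates the atom at \<open>v\<close>; below
  it the values agree with those of the original automaton on the original tree.\<close>

lemma subtree_in_atom_lang: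
  assumes G: "weak_gta G idx knd" and p: "p \<in> states G"
    and T: "T \<in> sigma_trees (alphabet G)" and v: "v \<in> verts T"
  shows "subtree T v \<in> gta_lang (with_init G (PAtom (m, p))) \<longleftrightarrow>
    modal_holds T v m (\<lambda>w. wins G idx knd T w p)"
proof -
  let ?\<theta> = "PAtom (m, p)" and ?S = "subtree T v"
  define N where "N = Suc (Max (idx ` states G))"
  have N: "idx q < N" if "q \<in> states G" for q
    using that weak_gta.finite_states[OF G] by (simp add: N_def less_Suc_eq_le)
  let ?G = "with_init G ?\<theta>" and ?i = "case_option N idx" and ?k = "case_option Transient knd"
  have S: "?S \<in> sigma_trees (alphabet ?G)"
    using subtree_sigma_trees[OF T v] by (simp add: with_init_def)
  have "weak_gta ?G ?i ?k" by (rule with_init_weak[OF G _ N]) (use p in auto)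
  then interpret w: weak_gta_on_tree ?G ?i ?k ?S
    using S by (simp add: weak_gta_on_tree_def weak_gta_on_tree_axioms_def)
  have vS: "v \<in> verts ?S" by (simp add: subtree_simps)
  have "?S \<in> gta_lang ?G \<longleftrightarrow> wins ?G ?i ?k ?S v None"
    using w.gta_lang_iff_wins by (simp add: subtree_simps(2) with_init_def)
  also have "\<dots> \<longleftrightarrow> local_sat ?G ?S (wins ?G ?i ?k ?S) v None"
    by (rule w.wins_unfold[OF vS]) (simp add: with_init_def)
  also have "\<dots> \<longleftrightarrow> modal_holds ?S v m (\<lambda>w. wins ?G ?i ?k ?S w (Some p))"
    unfolding local_sat_def by (subst (1) with_init_def) simp
  also have "\<dots> \<longleftrightarrow> modal_holds ?S v m (\<lambda>w. wins G idx knd ?S w p)"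
    by (simp only: wins_with_init)
  also have "\<dots> \<longleftrightarrow> modal_holds T v m (\<lambda>w. wins G idx knd T w p)"
  proof (rule modal_holds_cong)
    show "children ?S v = children T v" by (rule subtree_children(1)[OF vS])
    fix w assume "w \<in> children ?S v"
    then have w: "w \<in> verts ?S" using subtree_children[OF vS] by blast
    show "wins G idx knd ?S w p = wins G idx knd T w p"
      by (rule wins_restrict[OF _ w]) (simp add: subtree_children subtree_simps(3))
  qed
  finally show ?thesis .
qed

section \<open>Non-transient components\<close>

lemma finite_atoms: "finite (atoms \<theta>)"
  by (induction \<theta>) auto

lemma dnf_atoms: "K \<in> dnf \<theta> \<Longrightarrow> K \<subseteq> atoms \<theta>"
  by (induction \<theta> arbitrary: K) fastforce+

lemma cnf_atoms: "K \<in> cnf \<theta> \<Longrightarrow> K \<subseteq> atoms \<theta>"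
  by (induction \<theta> arbitrary: K) fastforce+

lemma modal_holds_Dia1: "modal_holds T v (Dia 1) P \<longleftrightarrow> (\<exists>w\<in>children T v. P w)"
proof
  assume "modal_holds T v (Dia 1) P"
  then obtain N where "N \<subseteq> children T v" "card N = 1" "\<forall>w\<in>N. P w" by auto
  moreover then obtain w where "N = {w}" by (auto simp: card_1_singleton_iff)
  ultimately show "\<exists>w\<in>children T v. P w" by auto
next
  assume "\<exists>w\<in>children T v. P w"
  then obtain w where "w \<in> children T v" "P w" by blast
  then show "modal_holds T v (Dia 1) P" by (auto intro!: exI[of _ "{w}"])
qed

lemma modal_holds_Box1: "finite (children T v) \<Longrightarrow> modal_holds T v (Box 1) P \<longleftrightarrow> (\<forall>w\<in>children T v. P w)"
  by auto

text \<open>If \<open>r^n\<close> fixes \<open>P\<close>, every \<open>p \<in> P\<close> has an infinite chain of \<open>r^n\<close>-predecessors in the finite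
  set \<open>P\<close>; some predecessor lies on a cycle, hence carries an \<open>r\<close>-loop, which lengthens the path
  to \<open>p\<close> by one.\<close>

lemma image_power_fixed:
  fixes r :: "('s \<times> 's) set"
  assumes P: "finite P" "(r ^^ n) `` P = P" "n \<ge> 1"
    and loop: "\<And>q k. k \<ge> 1 \<Longrightarrow> (q, q) \<in> r ^^ k \<Longrightarrow> (q, q) \<in> r"
  shows "r `` P = P"
proof -
  have pow: "(r ^^ (n * k)) `` P = P" for k
  proof (induction k)
    case (Suc k)
    have "(r ^^ (n * Suc k)) `` P = (r ^^ n) `` ((r ^^ (n * k)) `` P)"
      by (simp add: add.commute[of n] relpow_add relcomp_Image)
    then show ?case using Suc P(2) by simp
  qed simp
  have sub: "P \<subseteq> r `` P"
  proof
    fix p assume p: "p \<in> P"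
    have "\<exists>g. \<forall>x\<in>P. g x \<in> P \<and> (g x, x) \<in> r ^^ n"
      by (rule bchoice) (use P(2) in blast)
    then obtain g where g: "\<And>x. x \<in> P \<Longrightarrow> g x \<in> P" "\<And>x. x \<in> P \<Longrightarrow> (g x, x) \<in> r ^^ n" by blast
    have gP: "(g ^^ i) x \<in> P" if "x \<in> P" for i x
      using that by (induction i) (auto intro: g(1))
    have gr: "((g ^^ i) x, x) \<in> r ^^ (n * i)" if "x \<in> P" for i x
    proof (induction i)
      case (Suc i)
      have "(g ((g ^^ i) x), (g ^^ i) x) \<in> r ^^ n" by (rule g(2)[OF gP[OF that]])
      then have "(g ((g ^^ i) x), x) \<in> r ^^ (n + n * i)" unfolding relpow_add using Suc by blast
      then show ?case by simp
    qed simp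
    have "\<not> inj (\<lambda>i. (g ^^ i) p)"
    proof
      assume "inj (\<lambda>i. (g ^^ i) p)"
      then have "infinite (range (\<lambda>i. (g ^^ i) p))" by (rule range_inj_infinite)
      moreover have "range (\<lambda>i. (g ^^ i) p) \<subseteq> P" using gP[OF p] by blast
      ultimately show False using P(1) finite_subset by blast
    qed
    then obtain i j where ij: "i < j" "(g ^^ i) p = (g ^^ j) p"
      unfolding inj_def by (metis linorder_neqE_nat)
    define s where "s = (g ^^ i) p"
    have s: "s \<in> P" unfolding s_def by (rule gP[OF p])
    have "(g ^^ (j - i)) s = s"
      using ij fun_cong[OF funpow_add[of "j - i" i g], of p] by (simp add: s_def)
    then have "(s, s) \<in> r ^^ (n * (j - i))" using gr[OF s, of "j - i"] by simp
    then have "(s, s) \<in> r" by (rule loop[rotated]) (use P(3) ij(1) in simp)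
    moreover have "(s, p) \<in> r ^^ (n * i)" unfolding s_def by (rule gr[OF p])
    ultimately have "(s, p) \<in> r ^^ Suc (n * i)" by (rule relpow_Suc_I2)
    then have "p \<in> r `` ((r ^^ (n * i)) `` P)" using s by auto
    then show "p \<in> r `` P" unfolding pow .
  qed
  obtain k where k: "n = Suc k" using P(3) by (cases n) auto
  have "r ^^ n = r O r ^^ k" using relpow_commute[of r k] by (simp add: k)
  then have "(r ^^ k) `` (r `` P) = P" using P(2) by (simp only: relcomp_Image)
  moreover have "r `` P \<subseteq> (r ^^ k) `` (r `` P)" for k
  proof (induction k)
    case (Suc k)
    have "r `` P \<subseteq> r `` (r `` P)" using sub by blast
    also have "\<dots> \<subseteq> r `` ((r ^^ k) `` (r `` P))" using Suc by blast
    finally show ?case by (simp add: relcomp_Image)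
  qed simp
  ultimately show ?thesis using sub by blast
qed

lemma wa_path_append: "wa_path M p (u @ w) p' \<longleftrightarrow> (\<exists>r. wa_path M p u r \<and> wa_path M r w p')"
  by (induction u arbitrary: p) auto

lemma label_definable:
  assumes AP: "finite AP" and P0: "P0 \<noteq> {}" "AP \<subseteq> P0" and "\<sigma> \<in> Pow AP"
  shows "state_definable AP P0 (\<lambda>(T :: ('v, 'p set) ltree) v. label T v = \<sigma>)"
proof -
  have "state_definable AP P0 (\<lambda>(T :: ('v, 'p set) ltree) v. \<forall>x\<in>AP. x \<in> label T v \<longleftrightarrow> x \<in> \<sigma>)"
  proof (rule path_definable_Ball[OF P0(1) AP])
    fix x assume "x \<in> AP"
    then have "state_definable AP P0 (\<lambda>(T :: ('v, 'p set) ltree) v. x \<in> label T v)"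
      by (intro path_definable_prop) (use P0(2) in blast)
    then show "state_definable AP P0 (\<lambda>(T :: ('v, 'p set) ltree) v. x \<in> label T v \<longleftrightarrow> x \<in> \<sigma>)"
      by (cases "x \<in> \<sigma>") (simp_all add: path_definable_neg)
  qed
  then show ?thesis
  proof (rule state_definable_cong)
    fix T :: "('v, 'p set) ltree" and v assume "T \<in> sigma_trees (Pow AP)" "v \<in> verts T"
    then have "label T v \<in> Pow AP" by (rule sigma_treesD(5))
    then show "(\<forall>x\<in>AP. x \<in> label T v \<longleftrightarrow> x \<in> \<sigma>) = (label T v = \<sigma>)" using assms(4) by blast
  qed
qed

lemma state_definable_by_label:
  fixes S :: "'p set \<Rightarrow> ('v, 'p set) ltree \<Rightarrow> 'v \<Rightarrow> bool"
  assumes "finite AP" "P0 \<noteq> {}" "AP \<subseteq> P0"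
    and "\<And>\<sigma>. \<sigma> \<in> Pow AP \<Longrightarrow> state_definable AP P0 (S \<sigma>)"
  shows "state_definable AP P0 (\<lambda>T v. S (label T v) T v)"
proof -
  have "state_definable AP P0 (\<lambda>T v. \<exists>\<sigma>\<in>Pow AP. label T v = \<sigma> \<and> S \<sigma> T v)"
    by (intro path_definable_Bex[OF assms(2)] path_definable_conj label_definable assms)
      (use assms(1) in simp_all)
  then show ?thesis
  proof (rule state_definable_cong)
    fix T :: "('v, 'p set) ltree" and v assume "T \<in> sigma_trees (Pow AP)" "v \<in> verts T"
    then have "label T v \<in> Pow AP" by (rule sigma_treesD(5))
    then show "(\<exists>\<sigma>\<in>Pow AP. label T v = \<sigma> \<and> S \<sigma> T v) = S (label T v) T v" by blast
  qed
qed

locale cf_component =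
  fixes A :: "('q, 'p set) hwgt" and AP P0 :: "'p set" and Qi :: "'q set" and vt :: "'v itself"
  assumes AP: "finite AP" "alphabet A = Pow AP" and cf: "hwgt_cf vt A"
    and Qi: "Qi \<in> comps A" "kind_of A Qi \<noteq> Transient"
    and P0: "P0 \<noteq> {}" "AP \<subseteq> P0"
begin

abbreviation W :: "('v, 'p set) ltree \<Rightarrow> 'v \<Rightarrow> 'q \<Rightarrow> bool" where
  "W \<equiv> wins A (comp_index A) (comp_kind A)"

abbreviation "ex \<equiv> kind_of A Qi = Existential"
abbreviation "clauses \<equiv> lin_clauses A Qi"
abbreviation "lm \<equiv> lin_modality A Qi"

text \<open>For a universal component everything is complemented, so that in both cases the
  component is traversed along a finite path.\<close>

definition good :: "('v, 'p set) ltree \<Rightarrow> 'v \<Rightarrow> 'q atom \<Rightarrow> bool" where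
  "good T v a \<longleftrightarrow> (modal_holds T v (fst a) (\<lambda>w. W T w (snd a)) \<longleftrightarrow> ex)"

definition X :: "('v, 'p set) ltree \<Rightarrow> 'v \<Rightarrow> 'q \<Rightarrow> bool" where
  "X T v q \<longleftrightarrow> (W T v q \<longleftrightarrow> ex)"

lemma hw: "hwgt A" using cf by (simp add: hwgt_cf_def)

lemma weak: "weak_gta A (comp_index A) (comp_kind A)" by (rule hwgt_weak[OF hw])

lemma on_tree: "T \<in> sigma_trees (Pow AP) \<Longrightarrow> weak_gta_on_tree A (comp_index A) (comp_kind A) T"
  using weak AP(2) by (simp add: weak_gta_on_tree_def weak_gta_on_tree_axioms_def)

lemma Qi_states: "Qi \<subseteq> states A" by (rule comp_subset_states[OF hw Qi(1)])

lemma Qi_kind: "q \<in> Qi \<Longrightarrow> comp_kind A q = kind_of A Qi"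
  using comp_of_eq[OF hw Qi(1)] by (simp add: comp_kind_def)

lemma kind_cases:
  obtains "kind_of A Qi = Existential" "existential_comp A Qi" "lm = Dia 1"
      "\<And>q \<sigma>. clauses q \<sigma> = dnf (delta A q \<sigma>)"
  | "kind_of A Qi = Universal" "universal_comp A Qi" "lm = Box 1"
      "\<And>q \<sigma>. clauses q \<sigma> = cnf (delta A q \<sigma>)"
proof -
  have k: "case kind_of A Qi of
          Existential \<Rightarrow> existential_comp A Qi \<and> (\<forall>q \<in> Qi. odd (prio A q))
        | Universal \<Rightarrow> universal_comp A Qi \<and> (\<forall>q \<in> Qi. even (prio A q))
        | Transient \<Rightarrow> transient_comp A Qi"
    using hw Qi(1) unfolding hwgt_def by blast
  show thesis
  proof (cases "kind_of A Qi")
    case Existential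
    then show ?thesis using k that(1) by (simp add: lin_modality_def lin_clauses_def)
  next
    case Universal
    then show ?thesis using k that(2) by (simp add: lin_modality_def lin_clauses_def)
  next
    case Transient
    then show ?thesis using Qi(2) by simp
  qed
qed

lemma clause_atoms: "K \<in> clauses q \<sigma> \<Longrightarrow> K \<subseteq> atoms (delta A q \<sigma>)"
  by (cases rule: kind_cases) (simp_all add: dnf_atoms cnf_atoms)

lemma finite_clauses: "finite (clauses q \<sigma>)"
proof (rule finite_subset)
  show "clauses q \<sigma> \<subseteq> Pow (atoms (delta A q \<sigma>))" using clause_atoms by blast
qed (simp add: finite_atoms)

lemma clause_modality:
  assumes "q \<in> Qi" "\<sigma> \<in> Pow AP" "K \<in> clauses q \<sigma>" "(m, p) \<in> K" "p \<in> Qi"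
  shows "m = lm"
proof (cases rule: kind_cases)
  case 1
  have "K \<in> dnf (delta A q \<sigma>)" using assms(3) 1(4) by simp
  then have "\<forall>(m, q') \<in> K. q' \<in> Qi \<longrightarrow> m = Dia 1"
    using 1(2) assms(1,2) AP(2) unfolding existential_comp_def by blast
  then show ?thesis using assms(4,5) 1(3) by auto
next
  case 2
  have "K \<in> cnf (delta A q \<sigma>)" using assms(3) 2(4) by simp
  then have "\<forall>(m, q') \<in> K. q' \<in> Qi \<longrightarrow> m = Box 1"
    using 2(2) assms(1,2) AP(2) unfolding universal_comp_def by blast
  then show ?thesis using assms(4,5) 2(3) by auto
qed

lemma clause_unique:
  assumes "q \<in> Qi" "\<sigma> \<in> Pow AP" "K \<in> clauses q \<sigma>" "a \<in> K" "b \<in> K" "snd a \<in> Qi" "snd b \<in> Qi"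
  shows "a = b"
proof (cases rule: kind_cases)
  case 1
  have "K \<in> dnf (delta A q \<sigma>)" using assms(3) 1(4) by simp
  then have "\<forall>a\<in>K. \<forall>b\<in>K. snd a \<in> Qi \<longrightarrow> snd b \<in> Qi \<longrightarrow> a = b"
    using 1(2) assms(1,2) AP(2) unfolding existential_comp_def by blast
  then show ?thesis using assms(4-7) by simp
next
  case 2
  have "K \<in> cnf (delta A q \<sigma>)" using assms(3) 2(4) by simp
  then have "\<forall>a\<in>K. \<forall>b\<in>K. snd a \<in> Qi \<longrightarrow> snd b \<in> Qi \<longrightarrow> a = b"
    using 2(2) assms(1,2) AP(2) unfolding universal_comp_def by blast
  then show ?thesis using assms(4-7) by simp
qed

text \<open>Winning needs a DNF clause all of whose atoms hold; losing needs a CNF clause all of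
  whose atoms fail. In terms of \<open>X\<close> and \<open>good\<close> these are the same
  statement.\<close>

lemma X_unfold:
  assumes T: "T \<in> sigma_trees (Pow AP)" and v: "v \<in> verts T" and q: "q \<in> Qi"
  shows "X T v q \<longleftrightarrow> (\<exists>K\<in>clauses q (label T v). \<forall>a\<in>K. good T v a)"
proof -
  interpret w: weak_gta_on_tree A "comp_index A" "comp_kind A" T by (rule on_tree[OF T])
  have u: "W T v q \<longleftrightarrow> local_sat A T (W T) v q"
    by (rule w.wins_unfold[OF v]) (use q Qi_states in blast)
  show ?thesis
  proof (cases rule: kind_cases)
    case 1
    have "X T v q \<longleftrightarrow> W T v q" using 1(1) by (simp add: X_def)
    then show ?thesis unfolding u local_sat_def pbf_sat_dnf 1(4) using 1(1)
      by (simp add: good_def split_def)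
  next
    case 2
    have "X T v q \<longleftrightarrow> \<not> W T v q" using 2(1) by (simp add: X_def)
    then show ?thesis unfolding u local_sat_def pbf_sat_cnf 2(4) using 2(1)
      by (simp add: good_def split_def)
  qed
qed

text \<open>A diamond that holds and a box that fails are both witnessed by a single child, so an
  in-component atom extends a path by one node.\<close>

lemma good_lm:
  assumes T: "T \<in> sigma_trees (Pow AP)" and v: "v \<in> verts T"
  shows "good T v (lm, p) \<longleftrightarrow> (\<exists>w\<in>children T v. X T w p)"
proof (cases rule: kind_cases)
  case 1
  then show ?thesis by (simp only: good_def X_def fst_conv snd_conv modal_holds_Dia1 simp_thms)
next
  case 2
  then show ?thesis
    unfolding good_def X_def fst_conv snd_conv 2(3) modal_holds_Box1[OF sigma_treesD(2)[OF T v]] by simp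
qed

text \<open>Strengthens one direction of \<open>X_unfold\<close> by a falling rank, which guarantees
  that following in-component atoms ends after finitely many steps.\<close>

lemma X_descend:
  assumes T: "T \<in> sigma_trees (Pow AP)" and v: "v \<in> verts T" and q: "q \<in> Qi" and x: "X T v q"
  shows "\<exists>K\<in>clauses q (label T v). (\<forall>a\<in>K. good T v a) \<and>
    (\<forall>(m, p)\<in>K. p \<in> Qi \<longrightarrow> (\<exists>w\<in>children T v. X T w p \<and>
       weak_gta_on_tree.rank A (comp_index A) (comp_kind A) T w p <
       weak_gta_on_tree.rank A (comp_index A) (comp_kind A) T v q))"
proof -
  interpret w: weak_gta_on_tree A "comp_index A" "comp_kind A" T by (rule on_tree[OF T])
  have qs: "q \<in> states A" using q Qi_states by blast
  have \<sigma>: "label T v \<in> Pow AP" by (rule sigma_treesD(5)[OF T v])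
  have fin: "finite (children T v)" by (rule sigma_treesD(2)[OF T v])
  have idx: "comp_index A p = comp_index A q" if "p \<in> Qi" for p
    using that q comp_of_eq[OF hw Qi(1)] by (simp add: comp_index_def)
  show ?thesis
  proof (cases rule: kind_cases)
    case 1
    let ?Y = "\<lambda>w p. W T w p \<and> (comp_index A p = comp_index A q \<longrightarrow> w.rank w p < w.rank v q)"
    have "local_sat A T ?Y v q"
      by (rule w.rank_existential[OF v qs]) (use x q 1(1) Qi_kind in \<open>simp_all add: X_def\<close>)
    then obtain K where K: "K \<in> clauses q (label T v)"
      "\<And>m p. (m, p) \<in> K \<Longrightarrow> modal_holds T v m (\<lambda>w. ?Y w p)"
      unfolding local_sat_def pbf_sat_dnf 1(4) by blast
    have "good T v a" if "a \<in> K" for a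
    proof -
      obtain m p where a: "a = (m, p)" by (cases a)
      have "modal_holds T v m (\<lambda>w. W T w p)"
        by (rule modal_holds_mono[OF K(2)[of m p] fin]) (use that a in auto)
      then show ?thesis using a 1(1) by (simp add: good_def)
    qed
    moreover have "\<exists>w\<in>children T v. X T w p \<and> w.rank w p < w.rank v q" if "(m, p) \<in> K" "p \<in> Qi" for m p
    proof -
      have "m = Dia 1" using clause_modality[OF q \<sigma> K(1) that] 1(3) by simp
      then have "\<exists>w\<in>children T v. ?Y w p" using K(2)[OF that(1)] by (simp only: modal_holds_Dia1)
      then show ?thesis using idx[OF that(2)] 1(1) by (auto simp: X_def)
    qed
    ultimately show ?thesis using K(1) by blast
  next
    case 2
    let ?Y = "\<lambda>w p. W T w p \<or> (comp_index A p = comp_index A q \<and> \<not> w.rank w p < w.rank v q)"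
    have "\<not> local_sat A T ?Y v q"
      by (rule w.rank_universal[OF v qs]) (use x q 2(1) Qi_kind in \<open>simp_all add: X_def\<close>)
    then obtain K where K: "K \<in> clauses q (label T v)"
      "\<And>m p. (m, p) \<in> K \<Longrightarrow> \<not> modal_holds T v m (\<lambda>w. ?Y w p)"
      unfolding local_sat_def pbf_sat_cnf 2(4) by blast
    have "good T v a" if "a \<in> K" for a
    proof -
      obtain m p where a: "a = (m, p)" by (cases a)
      have "\<not> modal_holds T v m (\<lambda>w. W T w p)"
      proof
        assume "modal_holds T v m (\<lambda>w. W T w p)"
        then have "modal_holds T v m (\<lambda>w. ?Y w p)" by (rule modal_holds_mono[OF _ fin]) simp
        then show False using K(2)[of m p] that a by simp
      qed
      then show ?thesis using a 2(1) by (simp add: good_def)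
    qed
    moreover have "\<exists>w\<in>children T v. X T w p \<and> w.rank w p < w.rank v q" if "(m, p) \<in> K" "p \<in> Qi" for m p
    proof -
      have "m = Box 1" using clause_modality[OF q \<sigma> K(1) that] 2(3) by simp
      then have "\<not> (\<forall>w\<in>children T v. ?Y w p)" using K(2)[OF that(1)] by (simp only: modal_holds_Box1[OF fin] simp_thms)
      then show ?thesis using idx[OF that(2)] 2(1) by (auto simp: X_def)
    qed
    ultimately show ?thesis using K(1) by blast
  qed
qed

section \<open>The word over clauses that is read along a path\<close>

abbreviation "CAS \<equiv> comp_atom_sets A Qi"

lemma occurring:
  assumes "q \<in> Qi" "\<sigma> \<in> Pow AP"
  shows "atoms (delta A q \<sigma>) \<subseteq> occurring_atoms A"
  using assms Qi_states AP(2) unfolding occurring_atoms_def by blast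

lemma occurring_state: "(m, p) \<in> occurring_atoms A \<Longrightarrow> p \<in> states A"
  unfolding occurring_atoms_def using hwgt_trans(1)[OF hw] by blast

lemma finite_occurring: "finite (occurring_atoms A)"
  using weak_gta.finite_states[OF weak] AP unfolding occurring_atoms_def
  by (simp add: finite_atoms)

lemma CAS_I:
  assumes "q \<in> Qi" "p \<in> Qi" "\<sigma> \<in> Pow AP" "(lm, p) \<notin> C" "insert (lm, p) C \<in> clauses q \<sigma>"
  shows "C \<in> CAS"
proof -
  have "C \<subseteq> occurring_atoms A"
    using clause_atoms[OF assms(5)] occurring[OF assms(1,3)] by blast
  moreover have "Some p \<in> lin_trans A Qi (Some q) (\<sigma>, C)" using assms by simp
  ultimately show ?thesis using assms(1-3) AP(2) unfolding comp_atom_sets_def by blast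
qed

lemma CAS_D:
  assumes "C \<in> CAS"
  obtains q p \<sigma> where "q \<in> Qi" "p \<in> Qi" "\<sigma> \<in> Pow AP" "(lm, p) \<notin> C" "insert (lm, p) C \<in> clauses q \<sigma>"
proof -
  obtain q \<sigma> p where "q \<in> Qi" "\<sigma> \<in> alphabet A" "p \<in> Qi" "Some p \<in> lin_trans A Qi (Some q) (\<sigma>, C)"
    using assms unfolding comp_atom_sets_def by blast
  then show thesis using that AP(2) by (auto split: if_splits)
qed

text \<open>A state of \<open>Qi\<close> inside \<open>C\<close> would be a second in-component atom
  of the clause \<open>insert (lm, p0) C\<close>. So all atoms of \<open>C\<close> point to lower
  components, where state formulas are already available.\<close>

lemma CAS_lower:
  assumes "C \<in> CAS" "(m, p) \<in> C" "q \<in> Qi"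
  shows "p \<in> states A" "comp_index A p < comp_index A q"
proof -
  obtain q0 p0 \<sigma> where c: "q0 \<in> Qi" "p0 \<in> Qi" "\<sigma> \<in> Pow AP" "(lm, p0) \<notin> C" "insert (lm, p0) C \<in> clauses q0 \<sigma>"
    using CAS_D[OF assms(1)] .
  have nQ: "p \<notin> Qi"
  proof
    assume "p \<in> Qi"
    then have "(m, p) = (lm, p0)"
      using clause_unique[OF c(1,3,5), of "(m, p)" "(lm, p0)"] assms(2) c(2) by simp
    then show False using c(4) assms(2) by simp
  qed
  have q0: "q0 \<in> states A" and \<sigma>: "\<sigma> \<in> alphabet A" using c(1,3) Qi_states AP(2) by auto
  have a: "(m, p) \<in> atoms (delta A q0 \<sigma>)" using clause_atoms[OF c(5)] assms(2) by blast
  show p: "p \<in> states A" by (rule hwgt_trans(1)[OF hw q0 \<sigma> a])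
  have "comp_of A p \<noteq> comp_of A q0"
    using nQ comp_of_state(2)[OF hw p] comp_of_eq[OF hw Qi(1) c(1)] by auto
  moreover have "comp_of A q0 = comp_of A q" using comp_of_eq[OF hw Qi(1)] c(1) assms(3) by simp
  ultimately show "comp_index A p < comp_index A q"
    using hwgt_trans(2)[OF hw q0 \<sigma> a] by (auto simp: comp_index_def)
qed

text \<open>At the root of \<open>subtree T v\<close> exactly one of two complementary atoms is
  true. Both therefore cannot be good, whether good means true or false.\<close>

lemma good_unique:
  assumes T: "T \<in> sigma_trees (Pow AP)" and v: "v \<in> verts T"
    and C: "C \<in> CAS" "\<forall>a\<in>C. good T v a" and C': "C' \<in> CAS" "\<forall>a\<in>C'. good T v a"
  shows "C = C'"
proof (rule ccontr)
  assume "C \<noteq> C'"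
  moreover have "mutual_exclusion vt A" using cf by (simp add: hwgt_cf_def)
  ultimately obtain a b where ab: "a \<in> C" "b \<in> C'"
    "(gta_lang (with_init A (PAtom a)) :: ('v, 'p set) ltree set) =
       sigma_trees (alphabet A) - gta_lang (with_init A (PAtom b))"
    using Qi C(1) C'(1) unfolding mutual_exclusion_def by blast
  have sub: "C \<subseteq> occurring_atoms A" "C' \<subseteq> occurring_atoms A"
    using C(1) C'(1) unfolding comp_atom_sets_def by blast+
  have T': "T \<in> sigma_trees (alphabet A)" using T AP(2) by simp
  have lang: "subtree T v \<in> gta_lang (with_init A (PAtom c)) \<longleftrightarrow> (good T v c \<longleftrightarrow> ex)"
    if c: "c \<in> occurring_atoms A" for c
  proof -
    obtain m p where mp: "c = (m, p)" by (cases c)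
    have "p \<in> states A" using occurring_state c mp by blast
    from subtree_in_atom_lang[OF weak this T' v, of m] show ?thesis
      unfolding mp good_def fst_conv snd_conv by blast
  qed
  have "subtree T v \<in> sigma_trees (alphabet A)" by (rule subtree_sigma_trees[OF T' v])
  then have "subtree T v \<in> gta_lang (with_init A (PAtom a)) \<longleftrightarrow>
      \<not> subtree T v \<in> gta_lang (with_init A (PAtom b))"
    using ab(3) by blast
  moreover have "good T v a" "good T v b" using ab(1,2) C(2) C'(2) by auto
  moreover have "a \<in> occurring_atoms A" "b \<in> occurring_atoms A" using sub ab(1,2) by auto
  ultimately show False using lang by simp
qed

text \<open>The default \<open>{}\<close> is chosen only if no member of \<open>CAS\<close> is good.
  Then \<open>{}\<close> is not in \<open>CAS\<close>, since it would be good vacuously, and the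
  letter admits no move inside \<open>Qi\<close>.\<close>

definition letter :: "('v, 'p set) ltree \<Rightarrow> 'v \<Rightarrow> 'p set \<times> 'q atom set" where
  "letter T v = (label T v,
     if \<exists>C\<in>CAS. \<forall>a\<in>C. good T v a then SOME C. C \<in> CAS \<and> (\<forall>a\<in>C. good T v a) else {})"

lemma letter_iff:
  assumes T: "T \<in> sigma_trees (Pow AP)" and v: "v \<in> verts T"
  shows "letter T v = (\<sigma>, C) \<longleftrightarrow> label T v = \<sigma> \<and>
    (C \<in> CAS \<and> (\<forall>a\<in>C. good T v a) \<or> C = {} \<and> (\<forall>C'\<in>CAS. \<not> (\<forall>a\<in>C'. good T v a)))"
proof (cases "\<exists>C\<in>CAS. \<forall>a\<in>C. good T v a")
  case True
  define D where "D = (SOME C. C \<in> CAS \<and> (\<forall>a\<in>C. good T v a))"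
  have D: "D \<in> CAS \<and> (\<forall>a\<in>D. good T v a)"
    unfolding D_def by (rule someI_ex) (use True in blast)
  have "letter T v = (label T v, D)" using True by (simp add: letter_def D_def)
  moreover have "D = C \<longleftrightarrow> C \<in> CAS \<and> (\<forall>a\<in>C. good T v a)" using D good_unique[OF T v, of D C] by blast
  ultimately show ?thesis using True by auto
next
  case False
  then show ?thesis by (auto simp: letter_def)
qed

abbreviation "\<Gamma> \<equiv> Pow AP \<times> Pow (occurring_atoms A)"

lemma letter_in:
  assumes T: "T \<in> sigma_trees (Pow AP)" and v: "v \<in> verts T"
  shows "letter T v \<in> \<Gamma>"
proof -
  obtain \<sigma> C where l: "letter T v = (\<sigma>, C)" by (cases "letter T v")
  then have "label T v = \<sigma>" "C \<in> CAS \<or> C = {}" using letter_iff[OF T v] by auto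
  then show ?thesis using l sigma_treesD(5)[OF T v] unfolding comp_atom_sets_def by auto
qed

text \<open>The automaton reads one fixed clause remainder per node, while an evaluation may choose
  any good one. By \<open>good_unique\<close> the only candidate that permits a move inside
  \<open>Qi\<close> is the one recorded in \<open>letter\<close>.\<close>

lemma lin_trans_letter:
  assumes T: "T \<in> sigma_trees (Pow AP)" and v: "v \<in> verts T" and q: "q \<in> Qi" and p: "p \<in> Qi"
  shows "Some p \<in> lin_trans A Qi (Some q) (letter T v) \<longleftrightarrow>
    (\<exists>C. (\<forall>a\<in>C. good T v a) \<and> (lm, p) \<notin> C \<and> insert (lm, p) C \<in> clauses q (label T v))"
proof -
  obtain D where D: "letter T v = (label T v, D)" by (simp add: letter_def)
  then have gD: "\<forall>a\<in>D. good T v a" using letter_iff[OF T v, of "label T v" D] by auto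
  have "Some p \<in> lin_trans A Qi (Some q) (letter T v) \<longleftrightarrow>
      (lm, p) \<notin> D \<and> insert (lm, p) D \<in> clauses q (label T v)"
    unfolding D using p by auto
  moreover have "C = D" if "\<forall>a\<in>C. good T v a" "(lm, p) \<notin> C" "insert (lm, p) C \<in> clauses q (label T v)" for C
  proof -
    have "C \<in> CAS" by (rule CAS_I[OF q p sigma_treesD(5)[OF T v] that(2,3)])
    then have "letter T v = (label T v, C)" using letter_iff[OF T v] that(1) by simp
    then show ?thesis using D by simp
  qed
  ultimately show ?thesis using gD by blast
qed

section \<open>Paths of the linearization along paths of the tree\<close>

abbreviation "M q \<equiv> linearization A Qi q"

lemma M_trans: "wa_trans (M q) = lin_trans A Qi"
  by (simp add: linearization_def)

lemma wa_path_None: "wa_path (M q0) None w (Some p) \<Longrightarrow> False"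
  by (induction w) (auto simp: M_trans)

lemma wa_path_Some:
  "wa_path (M q0) (Some q) (b # w) (Some p) \<longleftrightarrow>
    (\<exists>q'\<in>Qi. Some q' \<in> lin_trans A Qi (Some q) b \<and> wa_path (M q0) (Some q') w (Some p))"
proof
  assume "wa_path (M q0) (Some q) (b # w) (Some p)"
  then obtain r where r: "r \<in> lin_trans A Qi (Some q) b" "wa_path (M q0) r w (Some p)"
    by (auto simp: M_trans)
  then obtain q' where q': "r = Some q'" using wa_path_None by (cases r) auto
  obtain \<sigma> C where "b = (\<sigma>, C)" by (cases b)
  then have "q' \<in> Qi" using r(1) q' by (auto split: if_splits)
  then show "\<exists>q'\<in>Qi. Some q' \<in> lin_trans A Qi (Some q) b \<and> wa_path (M q0) (Some q') w (Some p)"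
    using r q' by blast
qed (auto simp: M_trans)

text \<open>Replaces the transition to the exit state. Clauses that leave the component need not lie
  in \<open>CAS\<close>, so mutual exclusion does not make them readable from \<open>letter\<close>;
  several may be good at one node, and the choice is made by a state formula.\<close>

definition exits :: "('v, 'p set) ltree \<Rightarrow> 'v \<Rightarrow> 'q \<Rightarrow> bool" where
  "exits T v q \<longleftrightarrow> (\<exists>K\<in>clauses q (label T v). \<forall>a\<in>K. snd a \<notin> Qi \<and> good T v a)"

text \<open>Works backwards from the exit: the rest of the path witnesses the in-component atom of
  the clause, and the letter supplies its remaining atoms.\<close>

lemma X_if_path:
  assumes T: "T \<in> sigma_trees (Pow AP)"
  shows "segment T \<rho> \<Longrightarrow> set \<rho> \<subseteq> verts T \<Longrightarrow> q \<in> Qi \<Longrightarrow> p \<in> Qi \<Longrightarrow>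
    wa_path (M q0) (Some q) (map (letter T) (butlast \<rho>)) (Some p) \<Longrightarrow> exits T (last \<rho>) p \<Longrightarrow>
    X T (hd \<rho>) q"
proof (induction \<rho> arbitrary: q)
  case Nil
  then show ?case by (simp add: segment_def)
next
  case (Cons v \<rho>)
  have v: "v \<in> verts T" using Cons.prems(2) by simp
  show ?case
  proof (cases "\<rho> = []")
    case True
    then have "q = p" "exits T v p" using Cons.prems by auto
    then show ?thesis using X_unfold[OF T v Cons.prems(3)] unfolding exits_def by auto
  next
    case False
    then have b: "map (letter T) (butlast (v # \<rho>)) = letter T v # map (letter T) (butlast \<rho>)" by simp
    obtain q' where q': "q' \<in> Qi" "Some q' \<in> lin_trans A Qi (Some q) (letter T v)"
      "wa_path (M q0) (Some q') (map (letter T) (butlast \<rho>)) (Some p)"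
      using Cons.prems(5) unfolding b wa_path_Some by blast
    obtain C where C: "\<forall>a\<in>C. good T v a" "insert (lm, q') C \<in> clauses q (label T v)"
      using lin_trans_letter[OF T v Cons.prems(3) q'(1)] q'(2) by blast
    have s: "segment T \<rho>" "hd \<rho> \<in> children T v" using Cons.prems(1) False by (auto simp: segment_Cons)
    have "exits T (last \<rho>) p" using Cons.prems(6) False by simp
    then have "X T (hd \<rho>) q'" using Cons.IH[OF s(1) _ q'(1) Cons.prems(4) q'(3)] Cons.prems(2) by simp
    then have "good T v (lm, q')" using good_lm[OF T v] s(2) by blast
    then have "\<forall>a\<in>insert (lm, q') C. good T v a" using C(1) by simp
    then have "X T v q" using X_unfold[OF T v Cons.prems(3)] C(2) by blast
    then show ?thesis by simp
  qed
qed

text \<open>Induction on the rank. A clause with an atom in \<open>Qi\<close> yields the next node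
  and a transition on the remaining atoms; a clause without one ends the path with an exit.\<close>

lemma path_if_X:
  assumes T: "T \<in> sigma_trees (Pow AP)"
  shows "v \<in> verts T \<Longrightarrow> q \<in> Qi \<Longrightarrow> X T v q \<Longrightarrow> \<exists>\<rho>. segment T \<rho> \<and> hd \<rho> = v \<and>
    (\<exists>p\<in>Qi. wa_path (M q0) (Some q) (map (letter T) (butlast \<rho>)) (Some p) \<and> exits T (last \<rho>) p)"
proof (induction "weak_gta_on_tree.rank A (comp_index A) (comp_kind A) T v q" arbitrary: v q rule: less_induct)
  case (less v q)
  let ?rk = "weak_gta_on_tree.rank A (comp_index A) (comp_kind A) T"
  note v = less.prems(1) and q = less.prems(2)
  obtain K where K: "K \<in> clauses q (label T v)" "\<forall>a\<in>K. good T v a"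
    and d: "\<forall>(m, p)\<in>K. p \<in> Qi \<longrightarrow> (\<exists>w\<in>children T v. X T w p \<and> ?rk w p < ?rk v q)"
    using X_descend[OF T less.prems] by (elim bexE conjE)
  show ?case
  proof (cases "\<exists>a\<in>K. snd a \<in> Qi")
    case True
    then obtain m p where mp: "(m, p) \<in> K" "p \<in> Qi" by auto
    have m: "m = lm" by (rule clause_modality[OF q sigma_treesD(5)[OF T v] K(1) mp])
    have "\<exists>w\<in>children T v. X T w p \<and> ?rk w p < ?rk v q" using bspec[OF d mp(1)] mp(2) by simp
    then obtain w where w: "w \<in> children T v" "X T w p" "?rk w p < ?rk v q" by (elim bexE conjE)
    have wv: "w \<in> verts T" by (rule sigma_treesD(4)[OF T v w(1)])
    obtain \<rho> p' where \<rho>: "segment T \<rho>" "hd \<rho> = w" "p' \<in> Qi"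
      "wa_path (M q0) (Some p) (map (letter T) (butlast \<rho>)) (Some p')" "exits T (last \<rho>) p'"
      using less.hyps[OF w(3) wv mp(2) w(2)] by (elim exE conjE bexE)
    have ne: "\<rho> \<noteq> []" using \<rho>(1) by (simp add: segment_def)
    have ins: "insert (lm, p) (K - {(lm, p)}) = K" using mp(1) m by auto
    have "(\<forall>a\<in>K - {(lm, p)}. good T v a) \<and> (lm, p) \<notin> K - {(lm, p)} \<and>
        insert (lm, p) (K - {(lm, p)}) \<in> clauses q (label T v)"
      unfolding ins using K by simp
    then have "Some p \<in> lin_trans A Qi (Some q) (letter T v)"
      using lin_trans_letter[OF T v q mp(2)] by blast
    then have "wa_path (M q0) (Some q) (map (letter T) (butlast (v # \<rho>))) (Some p')"
      using ne \<rho>(4) by (auto simp: M_trans)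
    moreover have "segment T (v # \<rho>)" using \<rho>(1,2) w(1) by (simp add: segment_Cons)
    moreover have "exits T (last (v # \<rho>)) p'" using \<rho>(5) ne by simp
    ultimately show ?thesis using \<rho>(3) by (intro exI[of _ "v # \<rho>"]) auto
  next
    case False
    then have "exits T v q" unfolding exits_def using K by blast
    then show ?thesis using q by (intro exI[of _ "[v]"]) (auto simp: segment_def)
  qed
qed

text \<open>The powerset transition confined to \<open>Qi\<close>. The exit state can be left out
  because it is absorbing, so no path between states of \<open>Qi\<close> passes through it.\<close>

definition move :: "'p set \<times> 'q atom set \<Rightarrow> 'q set \<Rightarrow> 'q set" where
  "move a S = {q' \<in> Qi. \<exists>q\<in>S. Some q' \<in> lin_trans A Qi (Some q) a}"

lemma run_move: "S \<subseteq> Qi \<Longrightarrow> run (map move w) S = {q' \<in> Qi. \<exists>q\<in>S. wa_path (M q0) (Some q) w (Some q')}"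
proof (induction w arbitrary: S)
  case (Cons a w)
  have "move a S \<subseteq> Qi" by (auto simp: move_def)
  from Cons.IH[OF this] have "run (map move (a # w)) S =
      {q' \<in> Qi. \<exists>q\<in>move a S. wa_path (M q0) (Some q) w (Some q')}" by simp
  also have "\<dots> = {q' \<in> Qi. \<exists>q\<in>S. wa_path (M q0) (Some q) (a # w) (Some q')}"
    unfolding wa_path_Some move_def by blast
  finally show ?case .
qed auto

lemma finite_Qi: "finite Qi"
  using Qi_states weak_gta.finite_states[OF weak] finite_subset by blast

text \<open>On subsets, a word acts as the image under its reachability relation \<open>r\<close>.
  Counter-freeness of the linearization turns every cycle of \<open>r\<close> into a loop, which is
  what \<open>image_power_fixed\<close> needs.\<close>

lemma move_counter_free: "counter_free_on (Pow Qi) (move ` \<Gamma>)"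
  unfolding counter_free_on_def
proof (intro ballI allI impI)
  fix w' S and n :: nat
  assume w': "w' \<in> lists (move ` \<Gamma>)" and S: "S \<in> Pow Qi" and n: "1 \<le> n" and fx0: "(run w' ^^ n) S = S"
  obtain w where w: "w \<in> lists \<Gamma>" "w' = map move w" using w' unfolding lists_image by blast
  show "run w' S = S"
  \<comment> \<open>Counter-freeness is available for linearizations started in a state of
    \<open>Qi\<close>, so one must be at hand; the paths themselves do not depend on it.\<close>
  proof (cases "Qi = {}")
    case True
    then show ?thesis using S run_move[of S w] w(2) by auto
  next
    case False
    then obtain q0 where q0: "q0 \<in> Qi" by blast
    have cf0: "counter_free (M q0)" using cf Qi q0 unfolding hwgt_cf_def by blast
    define r where "r = {(q, q'). q \<in> Qi \<and> q' \<in> Qi \<and> wa_path (M q0) (Some q) w (Some q')}"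
    have im: "run w' P = r `` P" if "P \<subseteq> Qi" for P
      unfolding w(2) run_move[OF that, of w q0] r_def using that by blast
    have "(r ^^ k) `` S \<subseteq> Qi \<and> (run w' ^^ k) S = (r ^^ k) `` S" for k
    proof (induction k)
      case (Suc k)
      have "r `` ((r ^^ k) `` S) \<subseteq> Qi" by (auto simp: r_def)
      then show ?case using Suc im[of "(r ^^ k) `` S"] by (simp add: relcomp_Image)
    qed (use S in simp)
    then have fx: "(r ^^ n) `` S = S" using fx0 by simp
    have pw: "wa_path (M q0) (Some q) (concat (replicate k w)) (Some q')" if "(q, q') \<in> r ^^ k" for k q q'
      using that
    proof (induction k arbitrary: q)
      case (Suc k)
      then obtain q1 where q1: "(q, q1) \<in> r" "(q1, q') \<in> r ^^ k" by (meson relpow_Suc_E2)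
      then have "wa_path (M q0) (Some q) w (Some q1)" by (simp add: r_def)
      then show ?case using Suc.IH[OF q1(2)] by (auto simp: wa_path_append)
    qed simp
    have loop: "(q, q) \<in> r" if k: "k \<ge> 1" "(q, q) \<in> r ^^ k" for q k
    proof -
      obtain j where "k = Suc j" using k(1) by (cases k) auto
      then have q: "q \<in> Qi" using k(2) by (auto simp: r_def)
      have "Some q \<in> wa_states (M q0)" using q by (simp add: linearization_def)
      moreover have "w \<in> lists (wa_alphabet (M q0))" using w(1) AP(2) by (simp add: linearization_def)
      ultimately have "wa_path (M q0) (Some q) w (Some q)"
        using cf0 pw[OF that(2)] that(1) unfolding counter_free_def by blast
      then show ?thesis using q by (simp add: r_def)
    qed
    have "finite S" using S finite_Qi finite_subset by blast
    from image_power_fixed[OF this fx n loop] show ?thesis using im S by simp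
  qed
qed

lemma definable_reach:
  assumes "q \<in> Qi" "p \<in> Qi"
  shows "definable \<Gamma> (\<lambda>w. wa_path (M q0) (Some q) w (Some p))"
proof -
  have fin: "finite \<Gamma>" using AP(1) finite_occurring by simp
  have cl: "f ` Pow Qi \<subseteq> Pow Qi" if "f \<in> move ` \<Gamma>" for f
    using that by (auto simp: move_def)
  have q: "{q} \<in> Pow Qi" using assms(1) by simp
  have "definable (move ` \<Gamma>) (\<lambda>w. \<exists>Z\<in>{Z \<in> Pow Qi. p \<in> Z}. run w {q} = Z)"
    by (rule definable_Bex)
      (use finite_Qi definable_counter_free[OF _ finite_imageI[OF fin] cl move_counter_free q] in simp_all)
  from definable_relabel[OF this fin] show ?thesis
  proof (rule definable_eq)
    fix w
    show "(\<exists>Z\<in>{Z \<in> Pow Qi. p \<in> Z}. run (map move w) {q} = Z) = wa_path (M q0) (Some q) w (Some p)"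
      using run_move[of "{q}" w q0] assms by auto
  qed
qed

lemma state_definable_component:
  assumes q: "q \<in> Qi"
    and IH: "\<And>p. p \<in> states A \<Longrightarrow> comp_index A p < comp_index A q \<Longrightarrow> state_definable AP P0 (\<lambda>T v. W T v p)"
  shows "state_definable AP P0 (\<lambda>T v. W T v q)"
proof -
  have gd: "state_definable AP P0 (\<lambda>T v. good T v a)"
    if "snd a \<in> states A" "comp_index A (snd a) < comp_index A q" for a
    using state_definable_modal[OF IH[OF that], of "fst a"] path_definable_neg
    unfolding good_def by (cases "kind_of A Qi = Existential") simp_all
  have finC: "finite C" if "C \<in> CAS" for C
    using that finite_occurring unfolding comp_atom_sets_def by (blast intro: finite_subset)
  have "CAS \<subseteq> Pow (occurring_atoms A)" unfolding comp_atom_sets_def by blast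
  then have finCAS: "finite CAS" using finite_occurring by (simp add: finite_subset)
  have all: "state_definable AP P0 (\<lambda>T v. \<forall>a\<in>C. good T v a)" if "C \<in> CAS" for C
  proof (rule path_definable_Ball[OF P0(1) finC[OF that]])
    fix a assume "a \<in> C"
    then have "(fst a, snd a) \<in> C" by simp
    from CAS_lower[OF that this q] show "state_definable AP P0 (\<lambda>T v. good T v a)" by (rule gd)
  qed
  have letter: "state_definable AP P0 (\<lambda>T v. letter T v = b)" if b: "b \<in> \<Gamma>" for b
  proof -
    obtain \<sigma> C where sC: "b = (\<sigma>, C)" by (cases b)
    have \<sigma>: "\<sigma> \<in> Pow AP" using b sC by simp
    have 1: "state_definable AP P0 (\<lambda>T v. C \<in> CAS \<and> (\<forall>a\<in>C. good T v a))"
      using all[of C] path_definable_const[OF P0(1), of AP False] by (cases "C \<in> CAS") simp_all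
    have 2: "state_definable AP P0 (\<lambda>T v. C = {} \<and> (\<forall>C'\<in>CAS. \<not> (\<forall>a\<in>C'. good T v a)))"
      by (intro path_definable_conj path_definable_const[OF P0(1)] path_definable_Ball[OF P0(1) finCAS]
          path_definable_neg all)
    have "state_definable AP P0 (\<lambda>T v. label T v = \<sigma> \<and>
      (C \<in> CAS \<and> (\<forall>a\<in>C. good T v a) \<or> C = {} \<and> (\<forall>C'\<in>CAS. \<not> (\<forall>a\<in>C'. good T v a))))"
      by (rule path_definable_conj[OF label_definable[OF AP(1) P0 \<sigma>] path_definable_disj[OF 1 2]])
    then show ?thesis unfolding sC
      by (rule state_definable_cong) (simp only: letter_iff)
  qed
  have exits: "state_definable AP P0 (\<lambda>T v. exits T v p)" if p: "p \<in> Qi" for p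
  proof -
    have "state_definable AP P0 (\<lambda>T v.
      \<exists>K\<in>{K \<in> clauses p (label T v). \<forall>a\<in>K. snd a \<notin> Qi}. \<forall>a\<in>K. good T v a)"
    proof (rule state_definable_by_label[OF AP(1) P0], rule path_definable_Bex[OF P0(1)])
      fix \<sigma> assume \<sigma>: "\<sigma> \<in> Pow AP"
      show "finite {K \<in> clauses p \<sigma>. \<forall>a\<in>K. snd a \<notin> Qi}" using finite_clauses by simp
      fix K assume K: "K \<in> {K \<in> clauses p \<sigma>. \<forall>a\<in>K. snd a \<notin> Qi}"
      then have sub: "K \<subseteq> atoms (delta A p \<sigma>)" using clause_atoms by blast
      show "state_definable AP P0 (\<lambda>T v. \<forall>a\<in>K. good T v a)"
      proof (rule path_definable_Ball[OF P0(1) finite_subset[OF sub finite_atoms]])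
        fix a assume a: "a \<in> K"
        have ps: "p \<in> states A" and \<sigma>': "\<sigma> \<in> alphabet A" using p Qi_states \<sigma> AP(2) by auto
        have at: "(fst a, snd a) \<in> atoms (delta A p \<sigma>)" using sub a by auto
        note t = hwgt_trans[OF hw ps \<sigma>' at]
        have "comp_of A (snd a) \<noteq> comp_of A p"
          using K a comp_of_state(2)[OF hw t(1)] comp_of_eq[OF hw Qi(1) p] by auto
        moreover have "comp_index A p = comp_index A q"
          using comp_of_eq[OF hw Qi(1) p] comp_of_eq[OF hw Qi(1) q] by (simp add: comp_index_def)
        ultimately have "comp_index A (snd a) < comp_index A q" using t(2) by simp
        then show "state_definable AP P0 (\<lambda>T v. good T v a)" by (rule gd[OF t(1)])
      qed
    qed
    then show ?thesis by (rule state_definable_cong) (auto simp: exits_def)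
  qed
  have last: "path_definable AP P0 (\<lambda>T \<rho>. exits T (last \<rho>) p)" if p: "p \<in> Qi" for p
  proof -
    \<comment> \<open>The last node is reached by an \<open>until\<close> with trivial left side and
      recognized as the position without a successor on the path.\<close>
    have "path_definable AP P0 (\<lambda>T \<rho>. \<exists>j<length \<rho>.
       (\<not> (tl (drop j \<rho>) \<noteq> [] \<and> True) \<and> exits T (hd (drop j \<rho>)) p) \<and> (\<forall>k<j. True))"
      by (intro path_definable_until[where R' = "\<lambda>T \<rho>. \<not> (tl \<rho> \<noteq> [] \<and> True) \<and> exits T (hd \<rho>) p" and R = "\<lambda>T \<rho>. True"]
          path_definable_conj path_definable_neg
          path_definable_next path_definable_const[OF P0(1)] exits p)
    then show ?thesis
    proof (rule path_definable_cong)
      fix T :: "('v, 'p set) ltree" and \<rho> assume "segment T \<rho>"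
      then have ne: "\<rho> \<noteq> []" by (simp add: segment_def)
      have "(\<not> (tl (drop j \<rho>) \<noteq> [] \<and> True) \<and> exits T (hd (drop j \<rho>)) p) \<and> (\<forall>k<j. True) \<longleftrightarrow>
          j = length \<rho> - 1 \<and> exits T (last \<rho>) p" if "j < length \<rho>" for j
        using that ne
        by (cases "j = length \<rho> - 1")
          (auto simp: tl_drop drop_Suc[symmetric] last_conv_nth hd_drop_conv_nth)
      then show "(\<exists>j<length \<rho>. (\<not> (tl (drop j \<rho>) \<noteq> [] \<and> True) \<and> exits T (hd (drop j \<rho>)) p) \<and> (\<forall>k<j. True))
          = exits T (last \<rho>) p"
        using ne by (metis (no_types, lifting) diff_less length_greater_0_conv less_numeral_extra(1))
    qed
  qed
  have word: "path_definable AP P0 (\<lambda>T \<rho>. wa_path (M q) (Some q) (map (letter T) (butlast \<rho>)) (Some p))"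
    if p: "p \<in> Qi" for p
    by (rule path_definable_word[OF definable_reach[OF q p] P0(1) letter_in letter])
  have "state_definable AP P0 (\<lambda>T v. \<exists>\<rho>. segment T \<rho> \<and> hd \<rho> = v \<and>
    (\<exists>p\<in>Qi. wa_path (M q) (Some q) (map (letter T) (butlast \<rho>)) (Some p) \<and> exits T (last \<rho>) p))"
    by (intro state_definable_path path_definable_Bex[OF P0(1) finite_Qi] path_definable_conj word last)
  then have X: "state_definable AP P0 (\<lambda>T v. X T v q)"
  proof (rule state_definable_cong)
    fix T :: "('v, 'p set) ltree" and v assume T: "T \<in> sigma_trees (Pow AP)" and v: "v \<in> verts T"
    show "(\<exists>\<rho>. segment T \<rho> \<and> hd \<rho> = v \<and>
      (\<exists>p\<in>Qi. wa_path (M q) (Some q) (map (letter T) (butlast \<rho>)) (Some p) \<and> exits T (last \<rho>) p)) = X T v q"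
    proof
      assume "\<exists>\<rho>. segment T \<rho> \<and> hd \<rho> = v \<and>
        (\<exists>p\<in>Qi. wa_path (M q) (Some q) (map (letter T) (butlast \<rho>)) (Some p) \<and> exits T (last \<rho>) p)"
      then obtain \<rho> p where \<rho>: "segment T \<rho>" "hd \<rho> = v" "p \<in> Qi"
        "wa_path (M q) (Some q) (map (letter T) (butlast \<rho>)) (Some p)" "exits T (last \<rho>) p"
        by (elim exE conjE bexE)
      have "set \<rho> \<subseteq> verts T" by (rule segment_verts[OF T \<rho>(1)]) (use \<rho>(2) v in simp)
      then show "X T v q" using X_if_path[OF T \<rho>(1) _ q \<rho>(3,4,5)] \<rho>(2) by simp
    next
      assume "X T v q"
      then show "\<exists>\<rho>. segment T \<rho> \<and> hd \<rho> = v \<and>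
        (\<exists>p\<in>Qi. wa_path (M q) (Some q) (map (letter T) (butlast \<rho>)) (Some p) \<and> exits T (last \<rho>) p)"
        by (rule path_if_X[OF T v q])
    qed
  qed
  show ?thesis
  proof (cases "kind_of A Qi = Existential")
    case True
    then show ?thesis using X by (simp add: X_def)
  next
    case False
    then show ?thesis using path_definable_neg[OF X] by (simp add: X_def)
  qed
qed

end

theorem theorem3:
  fixes AP :: "'p set" and A :: "('q, 'p set) hwgt"
  assumes "finite AP" and "alphabet A = Pow AP" and "hwgt_cf TYPE('v) A"
  shows "\<exists>\<phi> :: 'p cctl. (AP \<noteq> {} \<longrightarrow> props \<phi> \<subseteq> AP) \<and>
           (gta_lang A :: ('v, 'p set) ltree set) = form_lang AP \<phi>"
proof -
  define P0 where "P0 = (if AP = {} then UNIV else AP)"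
  have P0: "P0 \<noteq> {}" "AP \<subseteq> P0" by (auto simp: P0_def)
  have hw: "hwgt A" using assms(3) by (simp add: hwgt_cf_def)
  note weak = hwgt_weak[OF hw]
  let ?W = "wins A (comp_index A) (comp_kind A) :: ('v, 'p set) ltree \<Rightarrow> 'v \<Rightarrow> 'q \<Rightarrow> bool"
  have comp: "cf_component A AP P0 Qi TYPE('v)" if "Qi \<in> comps A" "kind_of A Qi \<noteq> Transient" for Qi
    using assms P0 that by (simp add: cf_component_def)
  have on_tree: "weak_gta_on_tree A (comp_index A) (comp_kind A) T"
    if "T \<in> sigma_trees (Pow AP)" for T :: "('v, 'p set) ltree"
    using weak that assms(2) by (simp add: weak_gta_on_tree_def weak_gta_on_tree_axioms_def)
  have "state_definable AP P0 (\<lambda>T v. ?W T v q)" if "q \<in> states A" for q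
    using that
  proof (induction "comp_index A q" arbitrary: q rule: less_induct)
    case (less q)
    note Q = comp_of_state[OF hw less.prems]
    show ?case
    proof (cases "comp_kind A q = Transient")
      case False
      then have "cf_component A AP P0 (comp_of A q) TYPE('v)"
        using comp[OF Q(1)] by (simp add: comp_kind_def)
      then show ?thesis
        by (rule cf_component.state_definable_component[OF _ Q(2)]) (rule less.hyps)
    next
      case True
      \<comment> \<open>A transient state needs no path: after one unfolding all atoms are of
        smaller index.\<close>
      have "state_definable AP P0 (\<lambda>(T :: ('v, 'p set) ltree) v.
        \<exists>K\<in>dnf (delta A q (label T v)). \<forall>a\<in>K. modal_holds T v (fst a) (\<lambda>w. ?W T w (snd a)))"
      proof (rule state_definable_by_label[OF assms(1) P0], rule path_definable_Bex[OF P0(1)])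
        fix \<sigma> assume \<sigma>: "\<sigma> \<in> Pow AP"
        have "dnf (delta A q \<sigma>) \<subseteq> Pow (atoms (delta A q \<sigma>))" using dnf_atoms by blast
        then show "finite (dnf (delta A q \<sigma>))" by (rule finite_subset) (simp add: finite_atoms)
        fix K assume "K \<in> dnf (delta A q \<sigma>)"
        then have sub: "K \<subseteq> atoms (delta A q \<sigma>)" by (rule dnf_atoms)
        show "state_definable AP P0 (\<lambda>(T :: ('v, 'p set) ltree) v.
            \<forall>a\<in>K. modal_holds T v (fst a) (\<lambda>w. ?W T w (snd a)))"
        proof (rule path_definable_Ball[OF P0(1) finite_subset[OF sub finite_atoms]])
          fix a assume a: "a \<in> K"
          have at: "(fst a, snd a) \<in> atoms (delta A q \<sigma>)" using sub a by auto
          have \<sigma>': "\<sigma> \<in> alphabet A" using \<sigma> assms(2) by simp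
          note t = hwgt_trans[OF hw less.prems \<sigma>' at]
          have "comp_index A (snd a) < comp_index A q" using t(2) True by simp
          then show "state_definable AP P0 (\<lambda>T v. modal_holds T v (fst a) (\<lambda>w. ?W T w (snd a)))"
            by (intro state_definable_modal less.hyps t(1))
        qed
      qed
      then show ?thesis
      proof (rule state_definable_cong)
        fix T :: "('v, 'p set) ltree" and v assume T: "T \<in> sigma_trees (Pow AP)" and v: "v \<in> verts T"
        show "(\<exists>K\<in>dnf (delta A q (label T v)). \<forall>a\<in>K. modal_holds T v (fst a) (\<lambda>w. ?W T w (snd a))) = ?W T v q"
          unfolding weak_gta_on_tree.wins_unfold[OF on_tree[OF T] v less.prems]
          by (simp add: local_sat_def pbf_sat_dnf split_def)
      qed
    qed
  qed
  then have "state_definable AP P0 (\<lambda>T v. ?W T v (init A))"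
    using weak_gta.init_state[OF weak] by blast
  then obtain \<phi> where pr: "props \<phi> \<subseteq> P0" and \<phi>: "\<And>T \<pi> i. T \<in> sigma_trees (Pow AP) \<Longrightarrow>
      \<pi> \<in> finite_paths T \<Longrightarrow> i < length \<pi> \<Longrightarrow> sat T \<pi> i \<phi> \<longleftrightarrow> ?W T (hd (drop i \<pi>)) (init A)"
    unfolding path_definable_def by blast
  have "T \<in> gta_lang A \<longleftrightarrow> T \<in> form_lang AP \<phi>" for T :: "('v, 'p set) ltree"
  proof (cases "T \<in> sigma_trees (Pow AP)")
    case True
    have "sat T \<pi> 0 \<phi> \<longleftrightarrow> ?W T (root T) (init A)" if "\<pi> \<in> finite_paths T" for \<pi>
      using \<phi>[OF True that, of 0] that by (simp add: finite_paths_iff segment_def)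
    \<comment> \<open>The formula has the same truth value at the start of every path, so
      quantifying over all paths changes nothing provided that some path exists.\<close>
    moreover have "[root T] \<in> finite_paths T" by (simp add: finite_paths_def)
    ultimately have "T \<in> form_lang AP \<phi> \<longleftrightarrow> ?W T (root T) (init A)"
      using True by (auto simp: form_lang_def)
    then show ?thesis using weak_gta_on_tree.gta_lang_iff_wins[OF on_tree[OF True]] by simp
  next
    case False
    then show ?thesis using assms(2) by (simp add: form_lang_def gta_lang_def)
  qed
  moreover have "AP \<noteq> {} \<longrightarrow> props \<phi> \<subseteq> AP" using pr by (auto simp: P0_def split: if_splits)
  ultimately show ?thesis by blast
qed

end
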